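(* Let $X$ be an isonormal Gaussian process over a real separable Hilbert space $\mathfrak{H}$. Let $F_n=I_2(f_n)$, $n\ge1$, with $f_n\in\mathfrak{H}^{\odot2}$, and write $\kappa_p^{(n)}=\kappa_p(F_n)$, $p\ge1$, for the $p$th cumulant of $F_n$. Assume that $\kappa_2^{(n)}=E(F_n^2)\to1$ as $n\to\infty$. Let $N\sim\mathcal{N}(0,1)$ and $\Phi(z)=P(N\le z)$. Then, as $n\to\infty$, $F_n$ converges in law to $N$ if and only if $\kappa_4^{(n)}\to0$. In this case, we further have $$d_{\mathrm{Kol}}(F_n,N)\le\sqrt{\frac{\kappa_4^{(n)}}6+(\kappa_2^{(n)}-1)^2}.$$ If, in addition, as $n\to\infty$, $$\frac{\kappa_2^{(n)}-1}{\sqrt{\kappa_4^{(n)}/6+(\kappa_2^{(n)}-1)^2}}\to0,\qquad \frac{\kappa_3^{(n)}}{\sqrt{\kappa_4^{(n)}/6+(\kappa_2^{(n)}-1)^2}}\to\alpha\qquad\text{and}\qquad\frac{\kappa_8^{(n)}}{\big(\kappa_4^{(n)}/6+(\kappa_2^{(n)}-1)^2\big)^2}\to0,$$ then, for every $z\in\mathbb{R}$, $$\frac{P(F_n\le z)-\Phi(z)}{\sqrt{\kappa_4^{(n)}/6+(\kappa_2^{(n)}-1)^2}}\longrightarrow\frac{\alpha}{3!}\frac1{\sqrt{2\pi}}(1-z^2)e^{-z^2/2}\qquad\text{as }n\to\infty.$$ In particular, if $\alpha\ne0$, then there exist $c\in(0,1)$ and $n_0\ge1$ such that, for any $n\ge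 n_0$, $$\sup_{z\in\mathbb{R}}|P(F_n\le z)-\Phi(z)|\ge c\sqrt{\frac{\kappa_4^{(n)}}6+(\kappa_2^{(n)}-1)^2}.$$
   Context: Isonormal Gaussian process: $X=\{X(h):h\in\mathfrak{H}\}$ is a centered Gaussian family with $E[X(h)X(g)]=\langle h,g\rangle_{\mathfrak{H}}$. $\mathfrak{H}^{\odot2}$ is the symmetric second tensor power of $\mathfrak{H}$, and $I_2$ is the double Wiener–Itô integral with respect to $X$, mapping $\mathfrak{H}^{\odot2}$ onto the second Wiener chaos of $X$, with $E[I_2(f)^2]=2\|f\|^2_{\mathfrak{H}^{\otimes2}}$. Kolmogorov distance: $d_{\mathrm{Kol}}(X,Y)=\sup_{z\in\mathbb{R}}|P(X\le z)-P(Y\le z)|$. *)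

theory Defs
  imports "HOL-Probability.Probability"
begin

text \<open>
  Centered Gaussian laws include the degenerate one (a point mass at 0), since
  the variance \<open>\<parallel>h\<parallel>\<^sup>2\<close> of \<open>X h\<close> vanishes for \<open>h = 0\<close>; \<^const>\<open>normal_density\<close> with
  standard deviation 0 does not cover this case.
\<close>

definition centered_gaussian :: "'a measure \<Rightarrow> ('a \<Rightarrow> real) \<Rightarrow> bool" where
  "centered_gaussian M Y \<longleftrightarrow> Y \<in> borel_measurable M \<and>
     (distr M borel Y = return borel 0 \<or>
      (\<exists>\<sigma>>0. distr M borel Y = density lborel (normal_density 0 \<sigma>)))"

definition centered_gaussian_family :: "'a measure \<Rightarrow> ('i \<Rightarrow> 'a \<Rightarrow> real) \<Rightarrow> bool" where
  "centered_gaussian_family M X \<longleftrightarrow>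
     (\<forall>S c. finite S \<longrightarrow> centered_gaussian M (\<lambda>\<omega>. \<Sum>i\<in>S. c i * X i \<omega>))"

text \<open>The sort \<open>{real_inner, polish_space}\<close> is that of real separable Hilbert spaces.\<close>

locale isonormal_gaussian_process = prob_space M
  for M :: "'a measure" +
  fixes X :: "'h::{real_inner, polish_space} \<Rightarrow> 'a \<Rightarrow> real"
  assumes gaussian_family: "centered_gaussian_family M X"
    and covariance: "expectation (\<lambda>\<omega>. X h \<omega> * X g \<omega>) = inner h g"

text \<open>
  \<open>T a b\<close> is the elementary tensor \<open>a \<otimes> b\<close>, and the Hilbert space \<open>'t\<close> is the tensor
  square of \<open>'h\<close>. The conditions determine the pair \<open>('t, T)\<close> up to a unique isometric
  isomorphism; one model is the space of Hilbert-Schmidt operators on \<open>'h\<close>.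
\<close>

locale hilbert_tensor_square =
  fixes T :: "'h::real_inner \<Rightarrow> 'h \<Rightarrow> 't::{real_inner, complete_space}"
  assumes bilinear_tensor: "bilinear T"
    and inner_tensor: "inner (T a b) (T c d) = inner a c * inner b d"
    and dense_tensor: "closure (span {T a b | a b. True}) = UNIV"

text \<open>
  The symmetric tensors are the fixed points of the flip, i.e. of the unitary
  extension of \<open>a \<otimes> b \<mapsto> b \<otimes> a\<close>, tested here against elementary tensors.
\<close>

definition symmetric_tensors :: "('h \<Rightarrow> 'h \<Rightarrow> 't::real_inner) \<Rightarrow> 't set" where
  "symmetric_tensors T = {t. \<forall>a b. inner t (T a b) = inner t (T b a)}"

text \<open>
  \<open>I\<^sub>2\<close> is the continuous linear extension, from the symmetric tensors into \<open>L\<^sup>2\<close>, of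
  \<open>h \<otimes> h \<mapsto> H\<^sub>2 (X h)\<close> for unit vectors \<open>h\<close>, where \<open>H\<^sub>2 x = x\<^sup>2 - 1\<close> is the second
  Hermite polynomial; with this normalisation the second moment of \<open>I\<^sub>2 f\<close> is
  \<open>2 \<parallel>f\<parallel>\<^sup>2\<close>. As \<open>I\<^sub>2 f\<close> is only determined almost surely, it is given as a relation:
  \<open>double_wiener_ito M X T f F\<close> says that the random variable \<open>F\<close> is a version of
  \<open>I\<^sub>2 f\<close>.
\<close>

definition double_wiener_ito_simple ::
  "('h::real_inner \<Rightarrow> 'a \<Rightarrow> real) \<Rightarrow> ('h \<Rightarrow> 'h \<Rightarrow> 't::real_inner) \<Rightarrow> 't \<Rightarrow> ('a \<Rightarrow> real) \<Rightarrow> bool" where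
  "double_wiener_ito_simple X T g G \<longleftrightarrow>
     (\<exists>S c. finite S \<and> (\<forall>h\<in>S. norm h = 1) \<and>
        g = (\<Sum>h\<in>S. c h *\<^sub>R T h h) \<and>
        G = (\<lambda>\<omega>. \<Sum>h\<in>S. c h * ((X h \<omega>)\<^sup>2 - 1)))"

definition double_wiener_ito ::
  "'a measure \<Rightarrow> ('h::real_inner \<Rightarrow> 'a \<Rightarrow> real) \<Rightarrow> ('h \<Rightarrow> 'h \<Rightarrow> 't::real_inner) \<Rightarrow>
     't \<Rightarrow> ('a \<Rightarrow> real) \<Rightarrow> bool" where
  "double_wiener_ito M X T f F \<longleftrightarrow>
     F \<in> borel_measurable M \<and> integrable M (\<lambda>\<omega>. (F \<omega>)\<^sup>2) \<and>
     (\<exists>g G. (\<forall>k::nat. double_wiener_ito_simple X T (g k) (G k)) \<and>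
        g \<longlonglongrightarrow> f \<and>
        (\<lambda>k. integral\<^sup>L M (\<lambda>\<omega>. (G k \<omega> - F \<omega>)\<^sup>2)) \<longlonglongrightarrow> 0)"

text \<open>
  \<open>\<kappa>\<^sub>p(F)\<close> is \<open>(-i)\<^sup>p\<close> times the \<open>p\<close>-th derivative at 0 of the logarithm of the
  characteristic function of \<open>F\<close>. That function is continuous with value 1 at 0, so the
  principal branch is the right one near 0. For \<open>F\<close> with a finite \<open>p\<close>-th moment the
  number is real, and \<^const>\<open>Re\<close> only changes its type.
\<close>

definition cumulant :: "'a measure \<Rightarrow> ('a \<Rightarrow> real) \<Rightarrow> nat \<Rightarrow> real" where
  "cumulant M F p =
     Re ((- \<i>) ^ p *
       ((\<lambda>u t. vector_derivative u (at t)) ^^ p) (\<lambda>t::real. Ln (char (distr M borel F) t)) 0)"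

text \<open>The Kolmogorov distance of two random variables is that of their laws.\<close>

definition kolmogorov_dist :: "real measure \<Rightarrow> real measure \<Rightarrow> real" where
  "kolmogorov_dist \<mu> \<nu> = (SUP z. \<bar>cdf \<mu> z - cdf \<nu> z\<bar>)"

end

(*
  Diagonalising its kernel turns an element F of the second chaos into a sum of l_b (xi_b^2 - 1) with
  independent standard normal xi_b; it suffices to do this for finite sums, because everything used
  about them passes to L^2 limits.  With s_p the sum of the l_b^p, Gaussian integration by parts gives
  E[F psi(F)] = E[psi'(F) Gamma] where Gamma has mean kappa_2 = 2 s_2 and variance kappa_4 / 6 = 8 s_4,
  so that |E[psi'(F) - F psi(F)]|^2 <= (kappa_4 / 6 + (kappa_2 - 1)^2) E[psi'(F)^2].  For the solution psi
  of Stein's equation, |psi'| <= 1, and this is the Kolmogorov bound.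

  For the exact asymptotics, psi' is approximated in L^2(N) by smooth functions p.  The inequality controls
  the error uniformly in n.  For smooth p = q', a second integration by parts gives
  E[F q(F)] = kappa_2 E[p(F)] + (kappa_3 / 2) E[p'(F)] up to O(kappa_4^(3/4)), and
  E[p'(N)] = E[N p(N)] converges to E[N psi'(N)] = (z^2 - 1) phi(z) / 3.

  Finally log E[exp(i t F)] is the power series with terms (2 i t)^p s_p / (2 p); it identifies the cumulants,
  and its quartic term makes kappa_4 small when the law of F is close to N(0,1).
*)
theory Submission
  imports Defs "HOL-Real_Asymp.Real_Asymp" "HOL-Library.Diagonal_Subsequence"
begin

subsection \<open>Orthonormal eigenbases\<close>

text \<open>The obstacle is that psi' jumps at z: the second integration by parts that produces
  kappa_3 cannot be applied to psi, and no continuous function is uniformly close to psi'. The Stein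
  inequality is therefore kept with E[psi'(F)^2] on the right instead of a supremum: used for psi -
  q, it bounds the price of replacing psi' by p = q' by the discrepancy times an L^2 distance under
  the law of F_n. As N has no atoms, that distance converges to the one under N, which can be made
  small. Hence the order of limits: n tends to infinity for fixed p, and only afterwards p tends to
  psi'. The second-order remainder, of size discrepancy^(3/2) with a constant depending on p, is
  harmless in this order. After the diagonalisation only the traces s_p are retained, because
  integration by parts acts on the weights as multiplication by 2 l_b. For p \<ge> 2 the traces of
  the approximating sums are bounded, so their subsequential limits suffice and neither eigenvalues
  nor kernels have to be followed to the limit.\<close>

lemma orthonormal_residual:
  fixes B :: "'a::real_inner set"
  assumes "finite B" "pairwise orthogonal B" "\<And>b. b \<in> B \<Longrightarrow> norm b = 1" "b \<in> B"
  shows "inner b (x - (\<Sum>c\<in>B. inner c x *\<^sub>R c)) = 0"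
proof -
  have "inner b (\<Sum>c\<in>B. inner c x *\<^sub>R c) = (\<Sum>c\<in>B. if c = b then inner b x else 0)"
    unfolding inner_sum_right using assms by (intro sum.cong) (auto simp: pairwise_def orthogonal_def norm_eq_1)
  then show ?thesis using assms by (simp add: inner_diff_right)
qed

lemma orthonormal_expansion:
  fixes B :: "'a::real_inner set"
  assumes "finite B" "pairwise orthogonal B" "\<And>b. b \<in> B \<Longrightarrow> norm b = 1" "x \<in> span B"
  shows "x = (\<Sum>b\<in>B. inner b x *\<^sub>R b)"
proof -
  let ?d = "x - (\<Sum>b\<in>B. inner b x *\<^sub>R b)"
  have "?d \<in> span B" by (intro span_diff span_sum span_scale assms(4)) (auto intro: span_base)
  then have "orthogonal ?d ?d"
    by (rule orthogonal_to_span) (simp add: orthogonal_def inner_commute[of ?d] orthonormal_residual[OF assms(1-3)])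
  then show ?thesis by (simp add: orthogonal_self)
qed

text \<open>The ambient space may be infinite-dimensional, where closed bounded sets need not be
  compact. K is the continuous image of a cube: each vector of B contributes a factor [-1,1], and
  unit vectors have coordinates in [-1,1] by Cauchy-Schwarz.\<close>

lemma exists_compact_superset_unit_sphere_span:
  fixes B :: "'a::real_inner set"
  assumes "finite B" "pairwise orthogonal B" "\<And>b. b \<in> B \<Longrightarrow> norm b = 1"
  shows "\<exists>K. compact K \<and> K \<subseteq> span B \<and> {x \<in> span B. norm x = 1} \<subseteq> K"
proof -
  let ?P = "\<lambda>B K. compact K \<and> K \<subseteq> span B \<and> (\<forall>a. (\<forall>b\<in>B. \<bar>a b\<bar> \<le> 1) \<longrightarrow> (\<Sum>b\<in>B. a b *\<^sub>R b) \<in> K)"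
  have "\<exists>K. ?P B K" using \<open>finite B\<close>
  proof (induction B)
    case empty
    show ?case by (rule exI[of _ "{0}"]) auto
  next
    case (insert c B)
    then obtain K where K: "?P B K" by blast
    let ?f = "\<lambda>(t::real, y). t *\<^sub>R c + y"
    have "compact (?f ` ({-1..1} \<times> K))"
      using K by (intro compact_continuous_image compact_Times)
        (auto simp: case_prod_unfold intro!: continuous_intros)
    moreover have "?f ` ({-1..1} \<times> K) \<subseteq> span (insert c B)"
      using K span_mono[of B "insert c B"]
      by (auto intro!: span_add span_scale intro: span_base)
    moreover have "(\<Sum>b\<in>insert c B. a b *\<^sub>R b) \<in> ?f ` ({-1..1} \<times> K)" if "\<forall>b\<in>insert c B. \<bar>a b\<bar> \<le> 1" for a
      using that insert K by (intro image_eqI[of _ _ "(a c, \<Sum>b\<in>B. a b *\<^sub>R b)"]) (auto simp: abs_le_iff)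
    ultimately show ?case by blast
  qed
  then obtain K where K: "?P B K" by blast
  have "x \<in> K" if "x \<in> span B" "norm x = 1" for x
  proof -
    have "x = (\<Sum>b\<in>B. inner b x *\<^sub>R b)" by (rule orthonormal_expansion[OF assms that(1)])
    moreover have "\<bar>inner b x\<bar> \<le> 1" if "b \<in> B" for b
      using Cauchy_Schwarz_ineq2[of b x] assms(3)[OF that] \<open>norm x = 1\<close> by simp
    ultimately show ?thesis using K[THEN conjunct2, THEN conjunct2, rule_format, of "\<lambda>b. inner b x"] by simp
  qed
  with K show ?thesis by blast
qed

lemma orthonormal_basis_of_span:
  fixes S :: "'a::real_inner set"
  assumes "finite S"
  obtains B where "finite B" "span B = span S" "pairwise orthogonal B" "\<And>b. b \<in> B \<Longrightarrow> norm b = 1"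
proof -
  obtain C where C: "finite C" "span C = span S" "pairwise orthogonal C"
    using basis_orthogonal[OF assms] by blast
  let ?n = "\<lambda>x::'a. (1 / norm x) *\<^sub>R x"
  \<comment> \<open>The orthogonal basis may contain the zero vector, which cannot be
    normalised.\<close>
  let ?B = "?n ` (C - {0})"
  have "span ?B = span (C - {0})"
  unfolding span_eq
  proof
    show "?B \<subseteq> span (C - {0})" by (auto intro!: span_scale intro: span_base)
    show "C - {0} \<subseteq> span ?B"
    proof
      fix x assume x: "x \<in> C - {0}"
      have "norm x *\<^sub>R ?n x \<in> span ?B" by (rule span_scale, rule span_base) (use x in blast)
      then show "x \<in> span ?B" using x by simp
    qed
  qed
  then have "span ?B = span S" using C by simp
  moreover have "pairwise orthogonal ?B"
    using C(3) by (force simp: pairwise_def orthogonal_def)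
  moreover have "norm b = 1" if "b \<in> ?B" for b using that by (auto split: if_splits)
  moreover have "finite ?B" using C(1) by simp
  ultimately show ?thesis by (intro that[of ?B])
qed

text \<open>A maximal orthonormal system of eigenvectors spans: otherwise the quadratic form of \<open>A\<close>
  has a maximum on the unit sphere of its orthogonal complement, which gives one more.\<close>

lemma exists_orthonormal_eigenbasis:
  fixes A :: "'a::real_inner \<Rightarrow> 'a" and S :: "'a set"
  assumes "finite S" and lin: "linear A" and cont: "continuous_on UNIV A"
    and selfadjoint: "\<And>x y. inner (A x) y = inner x (A y)"
    and invariant: "\<And>x. A x \<in> span S"
  obtains B l where "finite B" "span B = span S" "pairwise orthogonal B"
    "\<And>b. b \<in> B \<Longrightarrow> norm b = 1" "\<And>b. b \<in> B \<Longrightarrow> A b = l b *\<^sub>R b"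
proof -
  let ?E = "\<lambda>B. B \<subseteq> span S \<and> finite B \<and> pairwise orthogonal B \<and> (\<forall>b\<in>B. norm b = 1 \<and> (\<exists>l. A b = l *\<^sub>R b))"
  have bound: "card B \<le> card S" if "?E B" for B
    using independent_span_bound[of S B] that \<open>finite S\<close>
    by (metis norm_zero pairwise_orthogonal_independent zero_neq_one)
  obtain B where B: "?E B" and max: "\<And>B'. ?E B' \<Longrightarrow> card B' \<le> card B"
  proof -
    let ?N = "card ` Collect ?E"
    have "finite ?N" by (rule finite_subset[of _ "{..card S}"]) (use bound in auto)
    moreover have "?E {}" by simp
    then have "?N \<noteq> {}" by blast
    ultimately have "Max ?N \<in> ?N" and le: "\<And>n. n \<in> ?N \<Longrightarrow> n \<le> Max ?N" by auto
    then obtain B where "?E B" "card B = Max ?N" by auto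
    then show ?thesis using that[of B] le by auto
  qed
  have "span S \<subseteq> span B"
  proof (rule ccontr)
    assume "\<not> span S \<subseteq> span B"
    then obtain v where v: "v \<in> span S" "v \<notin> span B" by blast
    let ?W = "{x \<in> span S. \<forall>b\<in>B. inner b x = 0}"
    define w where "w = v - (\<Sum>b\<in>B. inner b v *\<^sub>R b)"
    have "w \<noteq> 0" using v(2) unfolding w_def
      by (metis (lifting) eq_iff_diff_eq_0 span_base span_scale span_sum)
    have "w \<in> span S" unfolding w_def using v(1) B
      by (intro span_diff span_sum span_scale) auto
    then have "w \<in> ?W" using orthonormal_residual[of B] B unfolding w_def by blast
    let ?U = "{x \<in> ?W. norm x = 1}"
    have "(1 / norm w) *\<^sub>R w \<in> ?U" using \<open>w \<in> ?W\<close> \<open>w \<noteq> 0\<close> by (auto intro!: span_scale)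
    then have "?U \<noteq> {}" by blast
    moreover have "compact ?U"
    proof -
      obtain C where C: "finite C" "span C = span S" "pairwise orthogonal C" "\<And>b. b \<in> C \<Longrightarrow> norm b = 1"
        using orthonormal_basis_of_span[OF \<open>finite S\<close>] by blast
      obtain K where K: "compact K" "K \<subseteq> span C" "{x \<in> span C. norm x = 1} \<subseteq> K"
        using exists_compact_superset_unit_sphere_span[OF C(1,3,4)] by blast
      have "closed {x::'a. norm x = 1}"
        by (intro closed_Collect_eq continuous_intros)
      moreover have "closed (\<Inter>b\<in>B. {x::'a. inner b x = 0})"
        by (intro closed_INT ballI closed_Collect_eq continuous_intros)
      ultimately have "compact (K \<inter> ({x. norm x = 1} \<inter> (\<Inter>b\<in>B. {x. inner b x = 0})))"
        by (intro compact_Int_closed K closed_Int)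
      moreover have "?U = K \<inter> ({x. norm x = 1} \<inter> (\<Inter>b\<in>B. {x. inner b x = 0}))"
        using K(2,3) C(2) by auto
      ultimately show ?thesis by simp
    qed
    moreover have "continuous_on ?U (\<lambda>x. inner (A x) x)"
      by (intro continuous_intros continuous_on_subset[OF cont]) auto
    ultimately obtain x where x: "x \<in> ?U" and xmax: "\<And>y. y \<in> ?U \<Longrightarrow> inner (A y) y \<le> inner (A x) x"
      using continuous_attains_sup by (metis (no_types, lifting))
    define l where "l = inner (A x) x"
    \<comment> \<open>Maximality on the unit sphere in homogeneous form, so that perturbed vectors
      need not be normalised.\<close>
    have scaled: "inner (A y) y \<le> l * inner y y" if "y \<in> ?W" for y
    proof (cases "y = 0")
      case False
      have "(1 / norm y) *\<^sub>R y \<in> ?U" using that False by (auto intro!: span_scale)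
      from xmax[OF this] have "inner (A y) y / (norm y)\<^sup>2 \<le> l"
        by (simp add: linear_cmul[OF lin] l_def power2_eq_square)
      then show ?thesis using False by (simp add: pos_divide_le_eq power2_norm_eq_inner)
    qed simp
    have xx: "inner x x = 1" using x by (auto simp: norm_eq_1)
    \<comment> \<open>The defect of x as an eigenvector. It lies in \<open>?W\<close> because A is
      self-adjoint and the elements of B are eigenvectors, so x may be varied in its
      direction.\<close>
    define d where "d = A x - l *\<^sub>R x"
    have "d \<in> ?W"
    proof -
      have "inner b (A x) = 0" if "b \<in> B" for b
      proof -
        from B that have "\<exists>m. A b = m *\<^sub>R b" by simp
        then obtain m where "A b = m *\<^sub>R b" ..
        then have "inner b (A x) = m * inner b x" using selfadjoint[of b x] by simp
        then show ?thesis using x that by simp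
      qed
      then show ?thesis using x invariant by (auto simp: d_def inner_diff_right intro!: span_diff span_scale)
    qed
    have xd: "inner x d = 0" by (simp add: d_def inner_diff_right l_def inner_commute xx)
    have "A x = d + l *\<^sub>R x" by (simp add: d_def)
    then have Axd: "inner (A x) d = inner d d" by (simp add: inner_add_left xd)
    have "d = 0"
    proof (rule ccontr)
      assume "d \<noteq> 0"
      then have dd: "inner d d > 0" by simp
      \<comment> \<open>Maximality tested at \<open>x + t *\<^sub>R d\<close>: the gain is linear in
        t, the loss quadratic.\<close>
      have ineq: "2 * t * inner d d \<le> t\<^sup>2 * (l * inner d d - inner (A d) d)" for t
      proof -
        have "x + t *\<^sub>R d \<in> ?W" using x \<open>d \<in> ?W\<close> by (auto intro!: span_add span_scale simp: inner_add_right)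
        from scaled[OF this] show ?thesis
          using xd Axd xx selfadjoint[of d x] inner_commute[of d x] inner_commute[of d "A x"] l_def[symmetric]
          by (simp add: linear_add[OF lin] linear_cmul[OF lin] inner_add_left inner_add_right
              algebra_simps power2_eq_square)
      qed
      define q where "q = l * inner d d - inner (A d) d"
      \<comment> \<open>Small enough that \<open>t * q\<close> is at most \<open>inner d d\<close>;
        the summand 1 avoids a zero denominator.\<close>
      define t where "t = inner d d / (1 + \<bar>q\<bar>)"
      have "t > 0" using dd by (simp add: t_def add_pos_nonneg)
      have "t * (2 * inner d d) \<le> t * (t * q)" using ineq[of t] by (simp add: q_def power2_eq_square ac_simps)
      then have "2 * inner d d \<le> t * q" using \<open>t > 0\<close> by simp
      also have "t * q \<le> t * (1 + \<bar>q\<bar>)" using \<open>t > 0\<close> by (intro mult_left_mono) auto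
      also have "\<dots> = inner d d" by (simp add: t_def add_pos_nonneg)
      finally show False using dd by simp
    qed
    then have "A x = l *\<^sub>R x" by (simp add: d_def)
    then have "\<exists>m. A x = m *\<^sub>R x" by blast
    moreover have "orthogonal x b \<and> orthogonal b x" if "b \<in> B" for b
      using x that inner_commute[of x b] by (simp add: orthogonal_def)
    then have "pairwise orthogonal (insert x B)" using B by (simp add: pairwise_insert)
    ultimately have "card (insert x B) \<le> card B" using B x by (intro max) simp
    moreover have "x \<notin> B" using x xx by auto
    ultimately show False using B by simp
  qed
  moreover have "span B \<subseteq> span S" using B span_minimal subspace_span by blast
  ultimately have "span B = span S" by blast
  moreover have "\<forall>b\<in>B. \<exists>l. A b = l *\<^sub>R b" using B by simp
  then obtain l where "\<forall>b\<in>B. A b = l b *\<^sub>R b" by (auto simp: bchoice_iff)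
  ultimately show ?thesis using that[of B l] B by simp
qed

subsection \<open>Independence of jointly Gaussian variables\<close>

text \<open>Under the probability measure with density w / E[w], the variable Z has the same
  characteristic function as under M, hence by Levy's uniqueness theorem the same law. This carries
  the identity from exponentials over to all measurable f.\<close>

lemma (in prob_space) expectation_weight_mult_of_char:
  fixes w Z :: "'a \<Rightarrow> real" and f :: "real \<Rightarrow> real"
  assumes [measurable]: "w \<in> borel_measurable M" "Z \<in> borel_measurable M" "f \<in> borel_measurable borel"
    and w: "\<And>x. 0 \<le> w x" "\<And>x. w x \<le> C"
    and char: "\<And>s. (CLINT x|M. w x * iexp (s * Z x)) = expectation w * (CLINT x|M. iexp (s * Z x))"
  shows "expectation (\<lambda>x. w x * f (Z x)) = expectation w * expectation (\<lambda>x. f (Z x))"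
proof (cases "expectation w = 0")
  case True
  have int: "integrable M w" by (rule integrable_const_bound[of _ C]) (use w in auto)
  then have "AE x in M. w x = 0" using True w by (subst (asm) integral_nonneg_eq_0_iff_AE) auto
  then have "expectation (\<lambda>x. w x * f (Z x)) = expectation (\<lambda>x. 0)"
    by (intro integral_cong_AE) auto
  then show ?thesis using True by simp
next
  case False
  define c where "c = expectation w"
  have int: "integrable M w" by (rule integrable_const_bound[of _ C]) (use w in auto)
  have "0 \<le> c" unfolding c_def by (rule integral_nonneg_AE) (use w in auto)
  then have c: "c > 0" using False by (simp add: c_def)
  define N where "N = density M (\<lambda>x. ennreal (w x / c))"
  have "emeasure N (space N) = 1"
    unfolding N_def using c w int
    by (simp add: emeasure_density nn_integral_eq_integral c_def[symmetric] cong: nn_integral_cong_simp)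
  then interpret N: prob_space N by (rule prob_spaceI)
  have [measurable]: "Z \<in> borel_measurable N" unfolding N_def by measurable
  interpret NZ: real_distribution "distr N borel Z" by (rule N.real_distribution_distr) simp
  interpret MZ: real_distribution "distr M borel Z" by (rule real_distribution_distr) simp
  have "Characteristic_Functions.char (distr N borel Z) = Characteristic_Functions.char (distr M borel Z)"
  proof
    fix s
    have "(CLINT x|N. iexp (s * Z x)) = (CLINT x|M. (w x / c) *\<^sub>R iexp (s * Z x))"
      unfolding N_def using c w by (subst integral_density) auto
    also have "\<dots> = (1/c) *\<^sub>R (CLINT x|M. w x * iexp (s * Z x))"
      by (subst integral_scaleR_right[symmetric]) (auto simp: scaleR_conv_of_real)
    also have "\<dots> = (CLINT x|M. iexp (s * Z x))"
      using c unfolding char c_def by (simp add: scaleR_conv_of_real)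
    finally show "Characteristic_Functions.char (distr N borel Z) s = Characteristic_Functions.char (distr M borel Z) s"
      by (simp add: char_def integral_distr)
  qed
  then have "distr N borel Z = distr M borel Z"
    by (rule Levy_uniqueness[OF NZ.real_distribution_axioms MZ.real_distribution_axioms])
  then have "(LINT x|distr N borel Z. f x) = (LINT x|distr M borel Z. f x)" by simp
  then have "(LINT x|N. f (Z x)) = expectation (\<lambda>x. f (Z x))" by (simp add: integral_distr)
  moreover have "(LINT x|N. f (Z x)) = (LINT x|M. (w x / c) *\<^sub>R f (Z x))"
    unfolding N_def using c w by (subst integral_density) auto
  moreover have "\<dots> = (1/c) * expectation (\<lambda>x. w x * f (Z x))"
    by (subst integral_mult_right_zero[symmetric]) auto
  ultimately show ?thesis using c by (simp add: c_def field_simps)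
qed

text \<open>A complex weight is no density, but \<open>1 + Re (W x)\<close> and
  \<open>1 + Im (W x)\<close> are nonnegative and at most 2. Their exponential identities are
  combinations of those for W and for its conjugate.\<close>

lemma (in prob_space) expectation_complex_weight_mult_of_char:
  fixes W :: "'a \<Rightarrow> complex" and Z :: "'a \<Rightarrow> real" and f :: "real \<Rightarrow> real"
  assumes [measurable]: "W \<in> borel_measurable M" "Z \<in> borel_measurable M" "f \<in> borel_measurable borel"
    and W: "\<And>x. cmod (W x) \<le> 1" and f: "\<And>x. \<bar>f x\<bar> \<le> C"
    and char: "\<And>s. (CLINT x|M. W x * iexp (s * Z x)) = c * (CLINT x|M. iexp (s * Z x))"
  shows "(CLINT x|M. W x * f (Z x)) = c * expectation (\<lambda>x. f (Z x))"
proof -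
  have [measurable]: "cnj \<in> borel_measurable borel"
    by (intro borel_measurable_continuous_onI continuous_intros)
  have intW: "integrable M W" by (rule integrable_const_bound[of _ 1]) (use W in auto)
  have intWe: "integrable M (\<lambda>x. W x * iexp (s * Z x))" "integrable M (\<lambda>x. cnj (W x) * iexp (s * Z x))" for s
    by (rule integrable_const_bound[of _ 1]; use W in \<open>auto simp: norm_mult\<close>)+
  have inte: "integrable M (\<lambda>x. iexp (s * Z x))" for s
    by (rule integrable_const_bound[of _ 1]) auto
  have intf: "integrable M (\<lambda>x. f (Z x))"
    by (rule integrable_const_bound[of _ C]) (use f in auto)
  have C: "0 \<le> C" using f[of 0] by linarith
  \<comment> \<open>Conjugating the hypothesis at -s gives the identity for the conjugate
    weight.\<close>
  have cnj: "(CLINT x|M. cnj (W x) * iexp (s * Z x)) = cnj c * (CLINT x|M. iexp (s * Z x))" for s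
  proof -
    have "(CLINT x|M. cnj (W x) * iexp (s * Z x)) = (CLINT x|M. cnj (W x * iexp ((-s) * Z x)))"
      by (simp add: exp_cnj del: Bochner_Integration.integral_cnj)
    also have "\<dots> = cnj (CLINT x|M. W x * iexp ((-s) * Z x))" by (rule Bochner_Integration.integral_cnj)
    also have "\<dots> = cnj c * cnj (CLINT x|M. iexp ((-s) * Z x))" by (simp only: char complex_cnj_mult)
    also have "cnj (CLINT x|M. iexp ((-s) * Z x)) = (CLINT x|M. cnj (iexp ((-s) * Z x)))" by (rule Bochner_Integration.integral_cnj[symmetric])
    also have "\<dots> = (CLINT x|M. iexp (s * Z x))" by (simp add: exp_cnj del: Bochner_Integration.integral_cnj)
    finally show ?thesis .
  qed
  have c: "c = integral\<^sup>L M W" using char[of 0] by (simp add: prob_space)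
  have key: "expectation (\<lambda>x. R (W x) * f (Z x)) = R c * expectation (\<lambda>x. f (Z x))"
    if R: "R = Re \<or> R = Im" for R
  proof -
    have [measurable]: "R \<in> borel_measurable borel" using R by auto
    obtain a b where ab: "\<And>z. of_real (R z) = a * z + b * cnj z"
    proof (cases "R = Re")
      case True then show ?thesis
        by (intro that[of "1/2" "1/2"]) (auto simp: complex_eq_iff)
    next
      case False then show ?thesis using R
        by (intro that[of "-\<i>/2" "\<i>/2"]) (auto simp: complex_eq_iff)
    qed
    have Rb: "\<bar>R z\<bar> \<le> cmod z" for z using R abs_Re_le_cmod abs_Im_le_cmod by auto
    have R1: "\<bar>R (W x)\<bar> \<le> 1" for x using Rb[of "W x"] W[of x] by linarith
    have intR: "integrable M (\<lambda>x. R (W x))" by (rule integrable_const_bound[of _ 1]) (use R1 in auto)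
    have intRf: "integrable M (\<lambda>x. R (W x) * f (Z x))"
    proof (rule integrable_const_bound[of _ "1 * C"])
      show "AE x in M. norm (R (W x) * f (Z x)) \<le> 1 * C"
        unfolding real_norm_def abs_mult by (intro AE_I2 mult_mono R1 f) auto
    qed measurable
    have ER: "expectation (\<lambda>x. R (W x)) = R c"
      using R intW by (auto simp: c)
    have "expectation (\<lambda>x. (1 + R (W x)) * f (Z x)) = expectation (\<lambda>x. 1 + R (W x)) * expectation (\<lambda>x. f (Z x))"
    proof (rule expectation_weight_mult_of_char[where C = 2 and w = "\<lambda>x. 1 + R (W x)" and Z = Z and f = f])
      show "0 \<le> 1 + R (W x)" "1 + R (W x) \<le> 2" for x using R1[of x] by auto
      fix s
      have "(CLINT x|M. complex_of_real (1 + R (W x)) * iexp (s * Z x))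
         = (CLINT x|M. iexp (s * Z x) + (a * (W x * iexp (s * Z x)) + b * (cnj (W x) * iexp (s * Z x))))"
        by (intro Bochner_Integration.integral_cong) (auto simp: ab algebra_simps)
      also have "\<dots> = (CLINT x|M. iexp (s * Z x)) + (a * (c * (CLINT x|M. iexp (s * Z x))) + b * (cnj c * (CLINT x|M. iexp (s * Z x))))"
        using inte intWe char[of s] cnj[of s] by simp
      also have "\<dots> = (1 + of_real (R c)) * (CLINT x|M. iexp (s * Z x))" by (simp add: ab algebra_simps)
      also have "1 + of_real (R c) = complex_of_real (expectation (\<lambda>x. 1 + R (W x)))"
        using intR by (simp add: ER prob_space)
      finally show "(CLINT x|M. complex_of_real (1 + R (W x)) * iexp (s * Z x))
         = complex_of_real (expectation (\<lambda>x. 1 + R (W x))) * (CLINT x|M. iexp (s * Z x))" .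
    qed measurable
    then show ?thesis using intR intRf intf by (simp add: ER prob_space algebra_simps)
  qed
  have "integrable M (\<lambda>x. W x * f (Z x))"
  proof (rule integrable_const_bound[of _ "1 * C"])
    show "AE x in M. norm (W x * f (Z x)) \<le> 1 * C"
      unfolding norm_mult norm_of_real by (intro AE_I2 mult_mono W f) auto
  qed measurable
  then show ?thesis using key[of Re] key[of Im]
    by (simp add: complex_eq_iff flip: integral_Re integral_Im)
qed

text \<open>Coordinates are moved from the exponential to the test functions one at a time. The
  product already formed, times the exponential of the coordinates still left, is the complex
  weight; the induction hypothesis at all frequencies s of the coordinate being moved is exactly the
  factorisation required of it.\<close>

lemma (in prob_space) std_normal_family_prod_expectation:
  fixes \<xi> :: "'i \<Rightarrow> 'a \<Rightarrow> real" and f :: "'i \<Rightarrow> real \<Rightarrow> real"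
  assumes fin: "finite B" and meas: "\<And>b. b \<in> B \<Longrightarrow> \<xi> b \<in> borel_measurable M"
    and char: "\<And>t. (CLINT x|M. iexp (\<Sum>b\<in>B. t b * \<xi> b x)) = complex_of_real (exp (- (\<Sum>b\<in>B. (t b)\<^sup>2) / 2))"
    and f: "\<And>b. b \<in> B \<Longrightarrow> f b \<in> borel_measurable borel" "\<And>b y. b \<in> B \<Longrightarrow> 0 \<le> f b y \<and> f b y \<le> 1"
    and "J \<subseteq> B"
  shows "(CLINT x|M. (\<Prod>b\<in>J. f b (\<xi> b x)) * iexp (\<Sum>b\<in>B - J. t b * \<xi> b x))
    = (\<Prod>b\<in>J. expectation (\<lambda>x. f b (\<xi> b x))) * exp (- (\<Sum>b\<in>B - J. (t b)\<^sup>2) / 2)"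
  using finite_subset[OF \<open>J \<subseteq> B\<close> fin] \<open>J \<subseteq> B\<close>
proof (induction J arbitrary: t)
  case empty
  show ?case using char[of t] by simp
next
  case (insert a J)
  have aB: "a \<in> B" "J \<subseteq> B" "a \<notin> J" using insert by auto
  let ?P = "\<lambda>x. \<Prod>b\<in>J. f b (\<xi> b x)"
  let ?Q = "\<Prod>b\<in>J. expectation (\<lambda>x. f b (\<xi> b x))"
  let ?I = "B - insert a J"
  let ?W = "\<lambda>x. ?P x * iexp (\<Sum>b\<in>?I. t b * \<xi> b x)"
  have split: "(\<Sum>b\<in>B - J. g b) = g a + (\<Sum>b\<in>?I. g b)" for g :: "'i \<Rightarrow> real"
    using aB fin by (subst sum.remove[of _ a]) (auto intro!: sum.cong)
  have E: "(CLINT x|M. iexp (s * \<xi> a x)) = exp (- s\<^sup>2 / 2)" for s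
    using char[of "\<lambda>b. if b = a then s else 0"] aB fin
    by (simp add: if_distrib[of "\<lambda>x. x * _"] if_distrib[of "\<lambda>x. x ^ _"] cong: if_cong)
  have "(CLINT x|M. ?W x * f a (\<xi> a x)) = complex_of_real (?Q * exp (- (\<Sum>b\<in>?I. (t b)\<^sup>2) / 2)) * complex_of_real (expectation (\<lambda>x. f a (\<xi> a x)))"
  proof (rule expectation_complex_weight_mult_of_char[where C = 1 and W = ?W and Z = "\<xi> a" and f = "f a"])
    have [measurable]: "?P \<in> borel_measurable M"
      by (intro borel_measurable_prod measurable_compose[OF meas f(1)]) (use aB in auto)
    have [measurable]: "(\<lambda>x. \<Sum>b\<in>?I. t b * \<xi> b x) \<in> borel_measurable M"
      by (intro borel_measurable_sum borel_measurable_times borel_measurable_const meas) auto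
    show "?W \<in> borel_measurable M" by measurable
    have "\<bar>?P x\<bar> \<le> 1" for x using f aB by (auto simp: abs_prod intro!: prod_le_1)
    then show "cmod (?W x) \<le> 1" for x unfolding norm_mult norm_exp_i_times norm_of_real by simp
    show "\<bar>f a x\<bar> \<le> 1" for x using f(2)[OF aB(1), of x] by auto
    fix s
    let ?t = "t(a := s)"
    have eq: "(\<Sum>b\<in>B - J. ?t b * \<xi> b x) = s * \<xi> a x + (\<Sum>b\<in>?I. t b * \<xi> b x)" for x
      unfolding split by (auto intro!: sum.cong)
    have eq2: "(\<Sum>b\<in>B - J. (?t b)\<^sup>2) = s\<^sup>2 + (\<Sum>b\<in>?I. (t b)\<^sup>2)"
      unfolding split by (auto intro!: sum.cong)
    have "(CLINT x|M. ?W x * iexp (s * \<xi> a x)) = (CLINT x|M. ?P x * iexp (\<Sum>b\<in>B - J. ?t b * \<xi> b x))"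
      unfolding eq by (intro Bochner_Integration.integral_cong) (auto simp: distrib_left exp_add mult_ac)
    also have "\<dots> = ?Q * exp (- (\<Sum>b\<in>B - J. (?t b)\<^sup>2) / 2)"
      by (rule insert.IH) (use aB in auto)
    also have "\<dots> = complex_of_real (?Q * exp (- (\<Sum>b\<in>?I. (t b)\<^sup>2) / 2)) * (CLINT x|M. iexp (s * \<xi> a x))"
      unfolding eq2 E by (simp add: exp_add[symmetric] add_divide_distrib diff_divide_distrib flip: of_real_mult exp_add)
    finally show "(CLINT x|M. ?W x * iexp (s * \<xi> a x)) = complex_of_real (?Q * exp (- (\<Sum>b\<in>?I. (t b)\<^sup>2) / 2)) * (CLINT x|M. iexp (s * \<xi> a x))" .
  qed (use aB meas f in auto)
  then show ?case using insert(1,2) by (simp add: mult_ac)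
qed

lemma (in prob_space) std_normal_family_indep_vars:
  fixes \<xi> :: "'i \<Rightarrow> 'a \<Rightarrow> real"
  assumes fin: "finite B" and meas: "\<And>b. b \<in> B \<Longrightarrow> \<xi> b \<in> borel_measurable M"
    and char: "\<And>t. (CLINT x|M. iexp (\<Sum>b\<in>B. t b * \<xi> b x)) = complex_of_real (exp (- (\<Sum>b\<in>B. (t b)\<^sup>2) / 2))"
  shows "indep_vars (\<lambda>_. borel) \<xi> B"
proof (cases "B = {}")
  case True then show ?thesis by (simp add: indep_vars_def indep_sets_def)
next
  case False
  let ?F = "\<lambda>b. {\<xi> b -` A \<inter> space M | A. A \<in> sets borel}"
  \<comment> \<open>Only the full index set needs checking, since each family of preimages contains
    the whole space. The test functions are indicators, and all coordinates are moved at once with J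
    = B.\<close>
  have "prob (\<Inter>j\<in>B. A j) = (\<Prod>j\<in>B. prob (A j))" if A: "A \<in> (\<Pi> b\<in>B. ?F b)" for A
  proof -
    have "\<forall>b\<in>B. \<exists>S. S \<in> sets borel \<and> A b = \<xi> b -` S \<inter> space M" using A by (auto simp: Pi_def)
    then obtain S where S: "\<And>b. b \<in> B \<Longrightarrow> S b \<in> sets borel" "\<And>b. b \<in> B \<Longrightarrow> A b = \<xi> b -` S b \<inter> space M"
      by (auto simp: bchoice_iff)
    have evA: "A b \<in> events" if "b \<in> B" for b using S meas that by (auto intro: measurable_sets)
    have one: "expectation (\<lambda>x. indicat_real (S b) (\<xi> b x)) = prob (A b)" if "b \<in> B" for b
    proof -
      have "expectation (\<lambda>x. indicat_real (S b) (\<xi> b x)) = expectation (\<lambda>x. indicat_real (A b) x)"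
        using that S by (intro Bochner_Integration.integral_cong) (auto simp: indicator_def)
      then show ?thesis using evA[OF that] by simp
    qed
    have "(CLINT x|M. of_real (\<Prod>b\<in>B. indicat_real (S b) (\<xi> b x)))
        = complex_of_real (\<Prod>b\<in>B. expectation (\<lambda>x. indicat_real (S b) (\<xi> b x)))"
      using std_normal_family_prod_expectation[OF fin meas char, of "\<lambda>b. indicator (S b)" B] S
      by (auto simp: indicator_def)
    then have "expectation (\<lambda>x. \<Prod>b\<in>B. indicat_real (S b) (\<xi> b x)) = (\<Prod>b\<in>B. prob (A b))"
      using one by (simp only: integral_complex_of_real of_real_eq_iff) auto
    moreover have "expectation (\<lambda>x. \<Prod>b\<in>B. indicat_real (S b) (\<xi> b x)) = expectation (indicator (\<Inter>j\<in>B. A j))"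
      using S fin False by (intro Bochner_Integration.integral_cong) (auto simp: indicator_def prod_eq_1_iff intro!: prod_zero)
    moreover have "(\<Inter>j\<in>B. A j) \<in> events" using evA fin False by auto
    ultimately show ?thesis by simp
  qed
  moreover have "space M \<in> ?F b" if "b \<in> B" for b by (auto intro!: exI[of _ UNIV])
  moreover have "?F b \<subseteq> events" if "b \<in> B" for b using meas that by (auto intro: measurable_sets)
  ultimately have "indep_sets ?F B"
    by (subst indep_sets_finite) (use False fin in auto)
  then show ?thesis using meas by (auto simp: indep_vars_def2)
qed

subsection \<open>Gaussian integration by parts\<close>

abbreviation std_normal :: "real measure" where "std_normal \<equiv> std_normal_distribution"

lemma integral_std_normal: "g \<in> borel_measurable borel \<Longrightarrow>
    (LINT x|std_normal. g x) = (LBINT x. std_normal_density x * g x)" for g :: "real \<Rightarrow> real"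
  by (subst integral_density) auto

lemma integrable_std_normal_iff: "g \<in> borel_measurable borel \<Longrightarrow>
    integrable std_normal g \<longleftrightarrow> integrable lborel (\<lambda>x. std_normal_density x * g x)" for g :: "real \<Rightarrow> real"
  by (subst integrable_density) auto

lemma integrable_std_normal_le_power4:
  fixes g :: "real \<Rightarrow> real"
  assumes [measurable]: "g \<in> borel_measurable borel" and "\<And>x. \<bar>g x\<bar> \<le> a + b * x^4"
  shows "integrable std_normal g"
proof (rule Bochner_Integration.integrable_bound)
  interpret real_distribution std_normal by (rule real_dist_normal_dist)
  show "integrable std_normal (\<lambda>x. a + b * x^4)"
    by (intro Bochner_Integration.integrable_add integrable_mult_right integrable_std_normal_distribution_moment) auto
  show "AE x in std_normal. norm (g x) \<le> norm (a + b * x^4)"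
    using assms(2) by (intro AE_I2) (simp add: order_trans[OF _ abs_ge_self])
qed simp

lemma DERIV_std_normal_density [derivative_intros]:
  "(std_normal_density has_real_derivative (- x * std_normal_density x)) (at x)"
  unfolding std_normal_density_def by (auto intro!: derivative_eq_intros simp: field_simps)

lemma LBINT_eq_limit_diff:
  fixes F f :: "real \<Rightarrow> real"
  assumes F: "\<And>x. (F has_real_derivative f x) (at x)" and f: "continuous_on UNIV f" "integrable lborel f"
    and lim: "(F \<longlongrightarrow> A) at_bot" "(F \<longlongrightarrow> B) at_top"
  shows "(LBINT x. f x) = B - A"
proof -
  have "(LBINT x=-\<infinity>..\<infinity>. f x) = B - A"
  proof (rule interval_integral_FTC_integrable[where F = F])
    show "((F \<circ> real_of_ereal) \<longlongrightarrow> A) (at_right (-\<infinity>))"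
      using lim(1) by (simp add: ereal_tendsto_simps)
    show "((F \<circ> real_of_ereal) \<longlongrightarrow> B) (at_left \<infinity>)"
      using lim(2) by (simp add: ereal_tendsto_simps)
    show "isCont f x" for x using f(1) by (simp add: continuous_on_eq_continuous_at)
    show "set_integrable lborel (einterval (-\<infinity>) \<infinity>) f" using f(2) by (simp add: set_integrable_def)
  qed (use F in \<open>auto simp: has_real_derivative_iff_has_vector_derivative\<close>)
  then show ?thesis by (simp add: interval_lebesgue_integral_def set_lebesgue_integral_def)
qed

lemma tendsto_mult_std_normal_density_0:
  fixes F :: "real \<Rightarrow> real"
  assumes "\<And>x. \<bar>F x\<bar> \<le> (a + b * x\<^sup>2) * \<bar>x\<bar>"
  shows "((\<lambda>x. F x * std_normal_density x) \<longlongrightarrow> 0) at_top" "((\<lambda>x. F x * std_normal_density x) \<longlongrightarrow> 0) at_bot"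
proof -
  have bd: "norm (F x * std_normal_density x) \<le> (a + b * x\<^sup>2) * \<bar>x\<bar> * std_normal_density x" for x
    unfolding real_norm_def abs_mult abs_of_nonneg[OF normal_density_nonneg] by (intro mult_right_mono assms) auto
  have "((\<lambda>x. (a + b * x\<^sup>2) * \<bar>x\<bar> * std_normal_density x) \<longlongrightarrow> 0) at_top"
    unfolding std_normal_density_def by real_asymp
  then show "((\<lambda>x. F x * std_normal_density x) \<longlongrightarrow> 0) at_top"
    by (intro Lim_null_comparison[OF always_eventually[OF allI[OF bd]]])
  have "((\<lambda>x. (a + b * x\<^sup>2) * \<bar>x\<bar> * std_normal_density x) \<longlongrightarrow> 0) at_bot"
    unfolding std_normal_density_def by real_asymp
  then show "((\<lambda>x. F x * std_normal_density x) \<longlongrightarrow> 0) at_bot"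
    by (intro Lim_null_comparison[OF always_eventually[OF allI[OF bd]]])
qed

text \<open>The difference of the integrands, times the normal density, is the derivative of
  \<open>- x * h x * std_normal_density x\<close>. A second integration would need h to be twice
  differentiable; the factor x that stays on the right will pair with the factor x in the derivative
  of \<open>\<psi> (l b * (x\<^sup>2 - 1) + r)\<close>.\<close>

lemma std_normal_integration_by_parts:
  fixes h h' :: "real \<Rightarrow> real"
  assumes deriv: "\<And>x. (h has_real_derivative h' x) (at x)" and cont: "continuous_on UNIV h'"
    and bound: "\<And>x. \<bar>h x\<bar> \<le> a + b * x\<^sup>2" "\<And>x. \<bar>x * h' x\<bar> \<le> a + b * x\<^sup>2"
  shows "(LINT x|std_normal. (x\<^sup>2 - 1) * h x) = (LINT x|std_normal. x * h' x)"
proof -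
  have conth: "continuous_on UNIV h" using deriv by (meson DERIV_isCont continuous_at_imp_continuous_on)
  have [measurable]: "h \<in> borel_measurable borel" "h' \<in> borel_measurable borel"
    using conth cont by (auto intro: borel_measurable_continuous_onI)
  have bpos: "0 \<le> a + b * x\<^sup>2" for x using bound(1)[of x] by linarith
  have b2: "x\<^sup>2 \<le> 1 + x^4" for x :: real
    using sum_squares_ge_zero[of "x\<^sup>2 - 1" "x\<^sup>2"] by (simp add: power2_eq_square algebra_simps power4_eq_xxxx)
  have a: "0 \<le> a" using bpos[of 0] by simp
  have b: "a + b * x\<^sup>2 \<le> (a + \<bar>b\<bar>) + \<bar>b\<bar> * x^4" for x
    using mult_left_mono[OF b2[of x], of "\<bar>b\<bar>"] mult_right_mono[OF abs_ge_self[of b], of "x\<^sup>2"]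
    by (simp add: algebra_simps)
  have i1: "integrable std_normal (\<lambda>x. (x\<^sup>2 - 1) * h x)"
  proof (rule integrable_std_normal_le_power4)
    fix x :: real
    have "\<bar>(x\<^sup>2 - 1) * h x\<bar> \<le> (1 + x\<^sup>2) * (a + b * x\<^sup>2)"
      unfolding abs_mult by (intro mult_mono bound) (auto simp: abs_if)
    also have "\<dots> = a + (a + b) * x\<^sup>2 + b * x^4" by (simp add: algebra_simps power2_eq_square power4_eq_xxxx)
    also have "\<dots> \<le> a + \<bar>a + b\<bar> * (1 + x^4) + \<bar>b\<bar> * x^4"
      using mult_left_mono[OF b2[of x], of "\<bar>a + b\<bar>"] mult_right_mono[OF abs_ge_self[of "a + b"], of "x\<^sup>2"]
       mult_right_mono[OF abs_ge_self[of b], of "x^4"] by simp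
    also have "\<dots> = (a + \<bar>a + b\<bar>) + (\<bar>a + b\<bar> + \<bar>b\<bar>) * x^4" by (simp add: algebra_simps)
    finally show "\<bar>(x\<^sup>2 - 1) * h x\<bar> \<le> (a + \<bar>a + b\<bar>) + (\<bar>a + b\<bar> + \<bar>b\<bar>) * x^4" .
  qed simp
  have i2: "integrable std_normal (\<lambda>x. x * h' x)"
    by (rule integrable_std_normal_le_power4[OF _ order_trans[OF bound(2) b]]) simp
  have "(LBINT x. std_normal_density x * ((x\<^sup>2 - 1) * h x - x * h' x)) = 0 - 0"
  proof (rule LBINT_eq_limit_diff[where F = "\<lambda>x. - x * h x * std_normal_density x"])
    show "((\<lambda>x. - x * h x * std_normal_density x) has_real_derivative
        std_normal_density x * ((x\<^sup>2 - 1) * h x - x * h' x)) (at x)" for x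
      by (auto intro!: derivative_eq_intros deriv simp: algebra_simps power2_eq_square)
    show "continuous_on UNIV (\<lambda>x. std_normal_density x * ((x\<^sup>2 - 1) * h x - x * h' x))"
      unfolding std_normal_density_def by (intro continuous_intros conth cont) auto
    show "integrable lborel (\<lambda>x. std_normal_density x * ((x\<^sup>2 - 1) * h x - x * h' x))"
      using i1 i2 by (subst integrable_std_normal_iff[symmetric]) auto
    have "\<bar>- x * h x\<bar> \<le> (a + b * x\<^sup>2) * \<bar>x\<bar>" for x
      using mult_left_mono[OF bound(1)[of x], of "\<bar>x\<bar>"] by (simp add: abs_mult mult_ac)
    then show "((\<lambda>x. - x * h x * std_normal_density x) \<longlongrightarrow> 0) at_bot"
      "((\<lambda>x. - x * h x * std_normal_density x) \<longlongrightarrow> 0) at_top"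
      by (rule tendsto_mult_std_normal_density_0)+
  qed
  then have "(LINT x|std_normal. (x\<^sup>2 - 1) * h x - x * h' x) = 0"
    by (subst integral_std_normal) auto
  then show ?thesis using i1 i2 by simp
qed

section \<open>Square integrable functions and the Cauchy-Schwarz inequality\<close>

lemma integrable_mult_of_squares:
  fixes f g :: "'a \<Rightarrow> real"
  assumes [measurable]: "f \<in> borel_measurable M" "g \<in> borel_measurable M"
    and int: "integrable M (\<lambda>x. (f x)\<^sup>2)" "integrable M (\<lambda>x. (g x)\<^sup>2)"
  shows "integrable M (\<lambda>x. f x * g x)"
proof (rule Bochner_Integration.integrable_bound)
  show "integrable M (\<lambda>x. (f x)\<^sup>2 + (g x)\<^sup>2)" using int by simp
  have "\<bar>f x * g x\<bar> \<le> (f x)\<^sup>2 + (g x)\<^sup>2" for x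
    using sum_squares_bound[of "\<bar>f x\<bar>" "\<bar>g x\<bar>"] mult_nonneg_nonneg[OF abs_ge_zero abs_ge_zero, of "f x" "g x"]
    unfolding abs_mult power2_abs by linarith
  then show "AE x in M. norm (f x * g x) \<le> norm ((f x)\<^sup>2 + (g x)\<^sup>2)" by simp
qed simp

lemma integrable_square_add:
  fixes f g :: "'a \<Rightarrow> real"
  assumes [measurable]: "f \<in> borel_measurable M" "g \<in> borel_measurable M"
    and int: "integrable M (\<lambda>x. (f x)\<^sup>2)" "integrable M (\<lambda>x. (g x)\<^sup>2)"
  shows "integrable M (\<lambda>x. (f x + g x)\<^sup>2)"
proof -
  have "integrable M (\<lambda>x. (f x)\<^sup>2 + (g x)\<^sup>2 + 2 * (f x * g x))"
    by (intro Bochner_Integration.integrable_add integrable_mult_right integrable_mult_of_squares assms)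
  then show ?thesis by (simp add: power2_sum mult.assoc)
qed

lemma integrable_square_sum:
  fixes f :: "'i \<Rightarrow> 'a \<Rightarrow> real"
  assumes "finite I" "\<And>i. i \<in> I \<Longrightarrow> f i \<in> borel_measurable M" "\<And>i. i \<in> I \<Longrightarrow> integrable M (\<lambda>x. (f i x)\<^sup>2)"
  shows "integrable M (\<lambda>x. (\<Sum>i\<in>I. f i x)\<^sup>2)"
  using assms by (induction I rule: finite_induct) (auto intro!: integrable_square_add)

lemma integral_Cauchy_Schwarz:
  fixes f g :: "'a \<Rightarrow> real"
  assumes meas: "f \<in> borel_measurable M" "g \<in> borel_measurable M"
    and int: "integrable M (\<lambda>x. (f x)\<^sup>2)" "integrable M (\<lambda>x. (g x)\<^sup>2)"
  shows "(LINT x|M. f x * g x)\<^sup>2 \<le> (LINT x|M. (f x)\<^sup>2) * (LINT x|M. (g x)\<^sup>2)"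
proof -
  let ?a = "LINT x|M. (f x)\<^sup>2" and ?b = "LINT x|M. f x * g x" and ?c = "LINT x|M. (g x)\<^sup>2"
  have quad: "0 \<le> s\<^sup>2 * ?a + 2 * s * t * ?b + t\<^sup>2 * ?c" for s t
  proof -
    have "0 \<le> (LINT x|M. (s * f x + t * g x)\<^sup>2)" by (rule integral_nonneg_AE) simp
    also have "\<dots> = (LINT x|M. s\<^sup>2 * (f x)\<^sup>2 + 2 * s * t * (f x * g x) + t\<^sup>2 * (g x)\<^sup>2)"
      by (simp add: power2_eq_square algebra_simps)
    also have "\<dots> = s\<^sup>2 * ?a + 2 * s * t * ?b + t\<^sup>2 * ?c"
      using int integrable_mult_of_squares[OF assms] by simp
    finally show ?thesis .
  qed
  have "0 \<le> ?a" "0 \<le> ?c" by (auto intro: integral_nonneg_AE)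
  \<comment> \<open>At (c, -b) the quadratic form is c (a c - b^2), which settles c > 0. For c = 0
    the form contains a term linear in s, and its nonnegativity for all s forces b = 0.\<close>
  have "0 \<le> ?c * (?a * ?c - ?b\<^sup>2)" using quad[of ?c "- ?b"] by (simp add: power2_eq_square algebra_simps)
  moreover have "?b\<^sup>2 \<le> 0" if "?c = 0"
  proof -
    have "2 * ?b\<^sup>2 * s \<le> ?a" for s
    proof (cases "s > 0")
      case True
      have "0 \<le> ?a - 2 * (s * ?b) * ?b" using quad[of 1 "- s * ?b"] that by simp
      then show ?thesis by (simp add: power2_eq_square algebra_simps)
    next
      case False
      then have "2 * ?b\<^sup>2 * s \<le> 0" by (intro mult_nonneg_nonpos) auto
      then show ?thesis using \<open>0 \<le> ?a\<close> by linarith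
    qed
    from this[of "(?a + 1) / (2 * ?b\<^sup>2)"] show ?thesis by (cases "?b = 0") auto
  qed
  ultimately show ?thesis using \<open>0 \<le> ?c\<close> by (cases "?c = 0") (auto simp: zero_le_mult_iff)
qed

lemma Lipschitz_of_bounded_derivative:
  fixes \<psi> \<psi>' :: "real \<Rightarrow> real"
  assumes "\<And>x. (\<psi> has_real_derivative \<psi>' x) (at x)" "\<And>x. \<bar>\<psi>' x\<bar> \<le> C"
  shows "\<bar>\<psi> x - \<psi> y\<bar> \<le> C * \<bar>x - y\<bar>"
  using field_differentiable_bound[of UNIV \<psi> \<psi>' C x y] assms by (auto simp: has_field_derivative_at_within)

section \<open>Diagonal quadratic forms in independent standard normal variables\<close>

locale std_normal_family = prob_space M for M :: "'a measure" +
  fixes \<xi> :: "'i \<Rightarrow> 'a \<Rightarrow> real" and B :: "'i set"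
  assumes finite_index: "finite B"
    and indep: "indep_vars (\<lambda>_. borel) \<xi> B"
    and std_normal_distr: "\<And>b. b \<in> B \<Longrightarrow> distr M borel (\<xi> b) = std_normal"
begin

definition chaos :: "('i \<Rightarrow> real) \<Rightarrow> 'a \<Rightarrow> real" where
  "chaos l = (\<lambda>\<omega>. \<Sum>b\<in>B. l b * ((\<xi> b \<omega>)\<^sup>2 - 1))"

lemma measurable_coordinate [measurable]: "b \<in> B \<Longrightarrow> \<xi> b \<in> borel_measurable M"
  using indep by (simp add: indep_vars_def2)

lemma measurable_chaos [measurable]: "chaos l \<in> borel_measurable M"
  unfolding chaos_def by measurable

lemma integral_coordinate:
  fixes g :: "real \<Rightarrow> real"
  assumes "b \<in> B" "g \<in> borel_measurable borel"
  shows "expectation (\<lambda>\<omega>. g (\<xi> b \<omega>)) = (LINT x|std_normal. g x)"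
  using assms by (simp add: integral_distr flip: std_normal_distr)

lemma integrable_coordinate_power: "b \<in> B \<Longrightarrow> integrable M (\<lambda>\<omega>. (\<xi> b \<omega>) ^ k)"
  using integrable_distr_eq[of "\<xi> b" M borel "\<lambda>x. x^k"] integrable_std_normal_distribution_moment[of k]
  by (simp add: std_normal_distr)

lemma expectation_coordinate_square: "b \<in> B \<Longrightarrow> expectation (\<lambda>\<omega>. (\<xi> b \<omega>)\<^sup>2) = 1"
  using std_normal_distribution_even_moments(1)[of 1] integral_coordinate[of b "\<lambda>x. x\<^sup>2"] by simp

lemma integrable_centered_square: "b \<in> B \<Longrightarrow> integrable M (\<lambda>\<omega>. ((\<xi> b \<omega>)\<^sup>2 - 1)\<^sup>2)"
  using integrable_coordinate_power[of b 4] integrable_coordinate_power[of b 2]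
  by (simp add: power2_diff flip: power_mult)

lemma integrable_chaos_square: "integrable M (\<lambda>\<omega>. (chaos l \<omega>)\<^sup>2)"
  unfolding chaos_def using finite_index
  by (intro integrable_square_sum) (auto simp: power_mult_distrib integrable_centered_square)

lemma integrable_chaos: "integrable M (chaos l)"
  by (rule square_integrable_imp_integrable[OF _ integrable_chaos_square]) simp

lemma expectation_chaos: "expectation (chaos l) = 0"
  unfolding chaos_def using integrable_coordinate_power[of _ 2]
  by (subst Bochner_Integration.integral_sum) (auto simp: expectation_coordinate_square prob_space)

text \<open>By independence the other coordinates can be frozen at a value r, and the
  one-dimensional formula applies to \<open>\<psi> (l b * (x\<^sup>2 - 1) + r)\<close> as a function
  of x. Its derivative brings the factor 2 l_b x, hence the square on the right.\<close>

lemma coordinate_integration_by_parts: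
  assumes b: "b \<in> B"
    and deriv: "\<And>x. (\<psi> has_real_derivative \<psi>' x) (at x)" and cont: "continuous_on UNIV \<psi>'"
    and bound: "\<And>x. \<bar>\<psi>' x\<bar> \<le> C"
  shows "integrable M (\<lambda>\<omega>. ((\<xi> b \<omega>)\<^sup>2 - 1) * \<psi> (chaos l \<omega>))"
    and "integrable M (\<lambda>\<omega>. (\<xi> b \<omega>)\<^sup>2 * \<psi>' (chaos l \<omega>))"
    and "expectation (\<lambda>\<omega>. ((\<xi> b \<omega>)\<^sup>2 - 1) * \<psi> (chaos l \<omega>)) = 2 * l b * expectation (\<lambda>\<omega>. (\<xi> b \<omega>)\<^sup>2 * \<psi>' (chaos l \<omega>))"
proof -
  have C: "0 \<le> C" using bound[of 0] by linarith
  have cont\<psi>: "continuous_on UNIV \<psi>" using deriv by (meson DERIV_isCont continuous_at_imp_continuous_on)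
  have [measurable]: "\<psi> \<in> borel_measurable borel" "\<psi>' \<in> borel_measurable borel"
    using cont cont\<psi> by (auto intro: borel_measurable_continuous_onI)
  note [measurable] = measurable_coordinate[OF b]
  have lip: "\<bar>\<psi> x\<bar> \<le> \<bar>\<psi> 0\<bar> + C * \<bar>x\<bar>" for x
    using Lipschitz_of_bounded_derivative[of \<psi> \<psi>' C x 0] deriv bound by fastforce
  have int\<psi>: "integrable M (\<lambda>\<omega>. (\<psi> (chaos l \<omega>))\<^sup>2)"
  proof (rule Bochner_Integration.integrable_bound)
    have "integrable M (\<lambda>\<omega>. \<bar>chaos l \<omega>\<bar>\<^sup>2)" using integrable_chaos_square by simp
    then show "integrable M (\<lambda>\<omega>. (\<bar>\<psi> 0\<bar> + C * \<bar>chaos l \<omega>\<bar>)\<^sup>2)"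
      by (intro integrable_square_add) (auto simp: power_mult_distrib)
    show "AE x in M. norm ((\<psi> (chaos l x))\<^sup>2) \<le> norm ((\<bar>\<psi> 0\<bar> + C * \<bar>chaos l x\<bar>)\<^sup>2)"
      using power_mono[OF lip abs_ge_zero, of _ 2] by (intro AE_I2) simp
  qed simp
  show i1: "integrable M (\<lambda>\<omega>. ((\<xi> b \<omega>)\<^sup>2 - 1) * \<psi> (chaos l \<omega>))"
    by (intro integrable_mult_of_squares integrable_centered_square b int\<psi>) simp_all
  show i2: "integrable M (\<lambda>\<omega>. (\<xi> b \<omega>)\<^sup>2 * \<psi>' (chaos l \<omega>))"
  proof (rule Bochner_Integration.integrable_bound)
    show "integrable M (\<lambda>\<omega>. (\<xi> b \<omega>)\<^sup>2 * C)" using integrable_coordinate_power[OF b, of 2] by simp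
    show "AE x in M. norm ((\<xi> b x)\<^sup>2 * \<psi>' (chaos l x)) \<le> norm ((\<xi> b x)\<^sup>2 * C)"
      using bound C by (intro AE_I2) (auto simp: abs_mult intro!: mult_left_mono)
  qed simp
  let ?R = "\<lambda>\<omega>. \<Sum>c\<in>B - {b}. l c * ((\<xi> c \<omega>)\<^sup>2 - 1)"
  have split: "chaos l \<omega> = l b * ((\<xi> b \<omega>)\<^sup>2 - 1) + ?R \<omega>" for \<omega>
    unfolding chaos_def using b finite_index by (simp add: sum.remove)
  have "indep_var borel (\<xi> b) borel ?R"
  proof -
    \<comment> \<open>Coordinate b is left unchanged and every other one is mapped to its summand,
      so that a single independent family yields the independence of \<open>\<xi> b\<close> from the
      sum of the rest.\<close>
    let ?Y = "\<lambda>c x. if c = b then x else l c * (x\<^sup>2 - 1 :: real)"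
    have "indep_vars (\<lambda>_. borel) (\<lambda>c \<omega>. ?Y c (\<xi> c \<omega>)) B"
      by (rule indep_vars_compose2[OF indep]) auto
    then have "indep_vars (\<lambda>_. borel) (\<lambda>c \<omega>. ?Y c (\<xi> c \<omega>)) (insert b (B - {b}))"
      using b by (simp add: insert_absorb)
    from indep_vars_sum[OF _ _ this] finite_index
    have "indep_var borel (\<lambda>\<omega>. ?Y b (\<xi> b \<omega>)) borel (\<lambda>\<omega>. \<Sum>c\<in>B - {b}. ?Y c (\<xi> c \<omega>))" by simp
    moreover have "(\<lambda>\<omega>. \<Sum>c\<in>B - {b}. ?Y c (\<xi> c \<omega>)) = ?R" by (auto intro!: sum.cong)
    ultimately show ?thesis by simp
  qed
  then have pair: "std_normal \<Otimes>\<^sub>M distr M borel ?R = distr M (borel \<Otimes>\<^sub>M borel) (\<lambda>\<omega>. (\<xi> b \<omega>, ?R \<omega>))"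
    and [measurable]: "?R \<in> borel_measurable M"
    unfolding indep_var_distribution_eq std_normal_distr[OF b] by auto
  interpret N: prob_space std_normal using real_dist_normal_dist by (simp add: real_distribution_def)
  interpret R: prob_space "distr M borel ?R" by (rule prob_space_distr) simp
  interpret P: pair_prob_space std_normal "distr M borel ?R" ..
  \<comment> \<open>Fubini with the rest r outermost, so that the inner integral is against the
    standard normal law.\<close>
  have transfer: "expectation (\<lambda>\<omega>. g (\<xi> b \<omega>) (?R \<omega>)) = (LINT r|distr M borel ?R. LINT x|std_normal. g x r)"
    if "case_prod g \<in> borel_measurable (borel \<Otimes>\<^sub>M borel)" "integrable M (\<lambda>\<omega>. g (\<xi> b \<omega>) (?R \<omega>))" for g :: "real \<Rightarrow> real \<Rightarrow> real"
  proof -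
    have "integrable (std_normal \<Otimes>\<^sub>M distr M borel ?R) (case_prod g)"
      unfolding pair using that by (subst integrable_distr_eq) auto
    from P.integral_snd[OF this] show ?thesis
      unfolding pair using that by (subst (asm) integral_distr) auto
  qed
  have "expectation (\<lambda>\<omega>. ((\<xi> b \<omega>)\<^sup>2 - 1) * \<psi> (chaos l \<omega>))
      = (LINT r|distr M borel ?R. LINT x|std_normal. (x\<^sup>2 - 1) * \<psi> (l b * (x\<^sup>2 - 1) + r))"
    unfolding split using i1 by (intro transfer) (auto simp: split)
  also have "\<dots> = (LINT r|distr M borel ?R. LINT x|std_normal. 2 * l b * (x\<^sup>2 * \<psi>' (l b * (x\<^sup>2 - 1) + r)))"
  proof (rule Bochner_Integration.integral_cong[OF refl])
    fix r
    have "(LINT x|std_normal. (x\<^sup>2 - 1) * \<psi> (l b * (x\<^sup>2 - 1) + r))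
      = (LINT x|std_normal. x * (\<psi>' (l b * (x\<^sup>2 - 1) + r) * (2 * l b * x)))"
    \<comment> \<open>One pair of constants has to serve both growth conditions: the constant term
      comes from the function, the coefficient 2 C |l b| from x times its derivative.\<close>
    proof (rule std_normal_integration_by_parts[where a = "\<bar>\<psi> 0\<bar> + C * \<bar>l b\<bar> + C * \<bar>r\<bar>" and b = "2 * C * \<bar>l b\<bar>"])
      show "((\<lambda>x. \<psi> (l b * (x\<^sup>2 - 1) + r)) has_real_derivative \<psi>' (l b * (x\<^sup>2 - 1) + r) * (2 * l b * x)) (at x)" for x
        by (rule DERIV_chain2[OF deriv]) (auto intro!: derivative_eq_intros)
      show "continuous_on UNIV (\<lambda>x. \<psi>' (l b * (x\<^sup>2 - 1) + r) * (2 * l b * x))"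
        by (intro continuous_intros continuous_on_compose2[OF cont]) auto
      fix x :: real
      have "\<bar>x\<^sup>2 - 1\<bar> \<le> x\<^sup>2 + 1" using zero_le_power2[of x] by linarith
      then have "\<bar>l b * (x\<^sup>2 - 1) + r\<bar> \<le> \<bar>l b\<bar> * (x\<^sup>2 + 1) + \<bar>r\<bar>"
        by (intro order_trans[OF abs_triangle_ineq]) (auto simp: abs_mult intro!: mult_left_mono)
      from mult_left_mono[OF this C] lip[of "l b * (x\<^sup>2 - 1) + r"]
      have "\<bar>\<psi> (l b * (x\<^sup>2 - 1) + r)\<bar> \<le> \<bar>\<psi> 0\<bar> + C * \<bar>l b\<bar> + C * \<bar>r\<bar> + C * \<bar>l b\<bar> * x\<^sup>2"
        by (simp add: algebra_simps)
      also have "\<dots> \<le> \<bar>\<psi> 0\<bar> + C * \<bar>l b\<bar> + C * \<bar>r\<bar> + 2 * C * \<bar>l b\<bar> * x\<^sup>2" using C by simp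
      finally show "\<bar>\<psi> (l b * (x\<^sup>2 - 1) + r)\<bar> \<le> \<bar>\<psi> 0\<bar> + C * \<bar>l b\<bar> + C * \<bar>r\<bar> + 2 * C * \<bar>l b\<bar> * x\<^sup>2" .
      have "\<bar>x * (\<psi>' (l b * (x\<^sup>2 - 1) + r) * (2 * l b * x))\<bar> = \<bar>\<psi>' (l b * (x\<^sup>2 - 1) + r)\<bar> * (2 * \<bar>l b\<bar> * x\<^sup>2)"
        by (simp add: abs_mult power2_eq_square)
      also have "\<dots> \<le> C * (2 * \<bar>l b\<bar> * x\<^sup>2)" by (intro mult_right_mono bound) auto
      also have "\<dots> \<le> \<bar>\<psi> 0\<bar> + C * \<bar>l b\<bar> + C * \<bar>r\<bar> + 2 * C * \<bar>l b\<bar> * x\<^sup>2" using C by simp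
      finally show "\<bar>x * (\<psi>' (l b * (x\<^sup>2 - 1) + r) * (2 * l b * x))\<bar> \<le> \<bar>\<psi> 0\<bar> + C * \<bar>l b\<bar> + C * \<bar>r\<bar> + 2 * C * \<bar>l b\<bar> * x\<^sup>2" .
    qed
    also have "\<dots> = (LINT x|std_normal. 2 * l b * (x\<^sup>2 * \<psi>' (l b * (x\<^sup>2 - 1) + r)))"
      by (simp add: power2_eq_square mult_ac)
    finally show "(LINT x|std_normal. (x\<^sup>2 - 1) * \<psi> (l b * (x\<^sup>2 - 1) + r)) = \<dots>" .
  qed
  also have "\<dots> = expectation (\<lambda>\<omega>. 2 * l b * ((\<xi> b \<omega>)\<^sup>2 * \<psi>' (chaos l \<omega>)))"
    unfolding split using i2 by (intro transfer[symmetric]) (auto simp: split)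
  also have "\<dots> = 2 * l b * expectation (\<lambda>\<omega>. (\<xi> b \<omega>)\<^sup>2 * \<psi>' (chaos l \<omega>))" using i2 by simp
  finally show "expectation (\<lambda>\<omega>. ((\<xi> b \<omega>)\<^sup>2 - 1) * \<psi> (chaos l \<omega>)) = 2 * l b * expectation (\<lambda>\<omega>. (\<xi> b \<omega>)\<^sup>2 * \<psi>' (chaos l \<omega>))" .
qed

end

context std_normal_family begin

text \<open>Each |l b| is at most the Euclidean norm of l; pulling out p - q such factors leaves an
  even power, for which the absolute value disappears. The case q = 2 gives convergence of the power
  series in t, the case q = 4 bounds its tail by the fourth trace.\<close>

lemma abs_power_sum_le:
  fixes l :: "'i \<Rightarrow> real"
  assumes "even q" "q \<le> p"
  shows "\<bar>\<Sum>b\<in>B. l b ^ p\<bar> \<le> (\<Sum>b\<in>B. l b ^ q) * sqrt (\<Sum>b\<in>B. (l b)\<^sup>2) ^ (p - q)"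
proof -
  have "\<bar>l b\<bar> \<le> sqrt (\<Sum>b\<in>B. (l b)\<^sup>2)" if "b \<in> B" for b
    using finite_index that member_le_sum[of b B "\<lambda>b. (l b)\<^sup>2"] by (intro real_le_rsqrt) auto
  then have "\<bar>l b ^ p\<bar> \<le> l b ^ q * sqrt (\<Sum>b\<in>B. (l b)\<^sup>2) ^ (p - q)" if "b \<in> B" for b
  proof -
    have "\<bar>l b ^ p\<bar> = \<bar>l b\<bar> ^ q * \<bar>l b\<bar> ^ (p - q)"
      using assms(2) by (simp add: power_abs flip: power_add)
    also have "\<dots> \<le> \<bar>l b\<bar> ^ q * sqrt (\<Sum>b\<in>B. (l b)\<^sup>2) ^ (p - q)"
      using \<open>\<And>b. b \<in> B \<Longrightarrow> \<bar>l b\<bar> \<le> _\<close> that by (intro mult_left_mono power_mono) auto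
    finally show ?thesis using assms(1) by (simp add: power_even_abs)
  qed
  then have "(\<Sum>b\<in>B. \<bar>l b ^ p\<bar>) \<le> (\<Sum>b\<in>B. l b ^ q) * sqrt (\<Sum>b\<in>B. (l b)\<^sup>2) ^ (p - q)"
    unfolding sum_distrib_right by (rule sum_mono)
  then show ?thesis using sum_abs[of "\<lambda>b. l b ^ p" B] by linarith
qed

lemma abs_power_sum_le_two:
  fixes l :: "'i \<Rightarrow> real"
  assumes "2 \<le> p"
  shows "\<bar>\<Sum>b\<in>B. l b ^ p\<bar> \<le> sqrt (\<Sum>b\<in>B. (l b)\<^sup>2) ^ p"
proof -
  have "(\<Sum>b\<in>B. (l b)\<^sup>2) = sqrt (\<Sum>b\<in>B. (l b)\<^sup>2) ^ 2" by (simp add: sum_nonneg)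
  then show ?thesis using abs_power_sum_le[of 2 p l] assms by (metis even_numeral le_add_diff_inverse power_add)
qed

text \<open>Weighting the coordinate formula by w b leaves 2 w_b l_b xi_b^2, whose centred part is
  again a diagonal form. Integration by parts thus multiplies the weights by 2 l_b, and iterating it
  from w = l produces the successive traces.\<close>

lemma chaos_integration_by_parts:
  assumes deriv: "\<And>x. (\<psi> has_real_derivative \<psi>' x) (at x)" and cont: "continuous_on UNIV \<psi>'"
    and bound: "\<And>x. \<bar>\<psi>' x\<bar> \<le> C"
  shows "expectation (\<lambda>\<omega>. chaos w \<omega> * \<psi> (chaos l \<omega>)) =
       (\<Sum>b\<in>B. 2 * w b * l b) * expectation (\<lambda>\<omega>. \<psi>' (chaos l \<omega>))
       + expectation (\<lambda>\<omega>. chaos (\<lambda>b. 2 * w b * l b) \<omega> * \<psi>' (chaos l \<omega>))"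
proof -
  note ibp = coordinate_integration_by_parts[OF _ deriv cont bound, where l = l]
  have [measurable]: "\<psi>' \<in> borel_measurable borel"
    using cont by (auto intro: borel_measurable_continuous_onI)
  have eq1: "chaos w \<omega> * \<psi> (chaos l \<omega>) = (\<Sum>b\<in>B. w b * (((\<xi> b \<omega>)\<^sup>2 - 1) * \<psi> (chaos l \<omega>)))" for \<omega>
    by (simp add: chaos_def[of w] sum_distrib_right mult.assoc)
  have eq2: "(\<Sum>b\<in>B. 2 * w b * l b * (\<xi> b \<omega>)\<^sup>2) = (\<Sum>b\<in>B. 2 * w b * l b) + chaos (\<lambda>b. 2 * w b * l b) \<omega>" for \<omega>
    by (simp add: chaos_def right_diff_distrib sum_subtractf)
  have i\<psi>': "integrable M (\<lambda>\<omega>. \<psi>' (chaos l \<omega>))"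
    by (rule integrable_const_bound[of _ C]) (use bound in auto)
  have "expectation (\<lambda>\<omega>. chaos w \<omega> * \<psi> (chaos l \<omega>)) = (\<Sum>b\<in>B. w b * (2 * l b * expectation (\<lambda>\<omega>. (\<xi> b \<omega>)\<^sup>2 * \<psi>' (chaos l \<omega>))))"
    unfolding eq1 using ibp by (subst Bochner_Integration.integral_sum) auto
  also have "\<dots> = expectation (\<lambda>\<omega>. \<Sum>b\<in>B. 2 * w b * l b * ((\<xi> b \<omega>)\<^sup>2 * \<psi>' (chaos l \<omega>)))"
    using ibp by (subst Bochner_Integration.integral_sum) (auto simp: mult_ac)
  also have "\<dots> = expectation (\<lambda>\<omega>. (\<Sum>b\<in>B. 2 * w b * l b) * \<psi>' (chaos l \<omega>) + chaos (\<lambda>b. 2 * w b * l b) \<omega> * \<psi>' (chaos l \<omega>))"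
    unfolding sum_distrib_right[symmetric] mult.assoc[symmetric] eq2 distrib_right[symmetric] ..
  also have "\<dots> = (\<Sum>b\<in>B. 2 * w b * l b) * expectation (\<lambda>\<omega>. \<psi>' (chaos l \<omega>))
       + expectation (\<lambda>\<omega>. chaos (\<lambda>b. 2 * w b * l b) \<omega> * \<psi>' (chaos l \<omega>))"
  proof (subst Bochner_Integration.integral_add)
    show "integrable M (\<lambda>\<omega>. chaos (\<lambda>b. 2 * w b * l b) \<omega> * \<psi>' (chaos l \<omega>))"
    proof (rule Bochner_Integration.integrable_bound)
      show "integrable M (\<lambda>\<omega>. chaos (\<lambda>b. 2 * w b * l b) \<omega> * C)" using integrable_chaos by simp
      show "AE x in M. norm (chaos (\<lambda>b. 2 * w b * l b) x * \<psi>' (chaos l x)) \<le> norm (chaos (\<lambda>b. 2 * w b * l b) x * C)"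
        using order_trans[OF bound abs_ge_self] by (intro AE_I2) (auto simp: abs_mult intro!: mult_left_mono)
    qed simp
  qed (use i\<psi>' in auto)
  finally show ?thesis .
qed

text \<open>The identity as test function turns the variance into a trace, without any covariances
  of squares.\<close>

lemma expectation_chaos_square: "expectation (\<lambda>\<omega>. (chaos w \<omega>)\<^sup>2) = 2 * (\<Sum>b\<in>B. (w b)\<^sup>2)"
proof -
  have "expectation (\<lambda>\<omega>. chaos w \<omega> * chaos w \<omega>) = (\<Sum>b\<in>B. 2 * w b * w b) * expectation (\<lambda>\<omega>. 1)
       + expectation (\<lambda>\<omega>. chaos (\<lambda>b. 2 * w b * w b) \<omega> * 1)"
    by (rule chaos_integration_by_parts[where C = 1]) auto
  then show ?thesis using expectation_chaos[of "\<lambda>b. 2 * w b * w b"]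
    by (simp add: prob_space power2_eq_square sum_distrib_left mult.assoc)
qed

text \<open>With w = l, integration by parts gives Gamma = 2 s_2 + \<open>chaos\<close> with weights
  2 l^2, and Cauchy-Schwarz is applied to (Gamma - 1) psi'(F). The variance of Gamma is twice the
  sum of 4 l_b^4, whence the 8. The second factor stays an L^2 norm so that it is small when psi' is
  a difference of close functions.\<close>

lemma stein_discrepancy_bound:
  assumes deriv: "\<And>x. (\<psi> has_real_derivative \<psi>' x) (at x)" and cont: "continuous_on UNIV \<psi>'"
    and bound: "\<And>x. \<bar>\<psi>' x\<bar> \<le> C"
  shows "(expectation (\<lambda>\<omega>. \<psi>' (chaos l \<omega>)) - expectation (\<lambda>\<omega>. chaos l \<omega> * \<psi> (chaos l \<omega>)))\<^sup>2
    \<le> (8 * (\<Sum>b\<in>B. l b ^ 4) + (2 * (\<Sum>b\<in>B. l b ^ 2) - 1)\<^sup>2) * expectation (\<lambda>\<omega>. (\<psi>' (chaos l \<omega>))\<^sup>2)"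
proof -
  have [measurable]: "\<psi>' \<in> borel_measurable borel"
    using cont by (auto intro: borel_measurable_continuous_onI)
  define s where "s = 2 * (\<Sum>b\<in>B. l b ^ 2) - 1"
  let ?w = "\<lambda>b. 2 * l b * l b"
  let ?D = "\<lambda>\<omega>. s + chaos ?w \<omega>"
  have s: "(\<Sum>b\<in>B. 2 * l b * l b) = 1 + s" by (simp add: s_def sum_distrib_left power2_eq_square mult.assoc)
  have i\<psi>': "integrable M (\<lambda>\<omega>. \<psi>' (chaos l \<omega>))"
    by (rule integrable_const_bound[of _ C]) (use bound in auto)
  have i\<psi>'2: "integrable M (\<lambda>\<omega>. (\<psi>' (chaos l \<omega>))\<^sup>2)"
    by (rule integrable_const_bound[of _ "C\<^sup>2"]) (use power_mono[OF bound abs_ge_zero, of _ 2] in auto)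
  have iD: "integrable M (\<lambda>\<omega>. (?D \<omega>)\<^sup>2)"
    by (intro integrable_square_add integrable_chaos_square) auto
  have ic: "integrable M (\<lambda>\<omega>. chaos ?w \<omega> * \<psi>' (chaos l \<omega>))"
    by (intro integrable_mult_of_squares integrable_chaos_square i\<psi>'2) auto
  have "expectation (\<lambda>\<omega>. \<psi>' (chaos l \<omega>)) - expectation (\<lambda>\<omega>. chaos l \<omega> * \<psi> (chaos l \<omega>))
     = - expectation (\<lambda>\<omega>. ?D \<omega> * \<psi>' (chaos l \<omega>))"
    unfolding chaos_integration_by_parts[OF assms] s using i\<psi>' ic by (simp add: algebra_simps)
  then have "(expectation (\<lambda>\<omega>. \<psi>' (chaos l \<omega>)) - expectation (\<lambda>\<omega>. chaos l \<omega> * \<psi> (chaos l \<omega>)))\<^sup>2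
     \<le> expectation (\<lambda>\<omega>. (?D \<omega>)\<^sup>2) * expectation (\<lambda>\<omega>. (\<psi>' (chaos l \<omega>))\<^sup>2)"
    using integral_Cauchy_Schwarz[OF _ _ iD i\<psi>'2] by simp
  also have "expectation (\<lambda>\<omega>. (?D \<omega>)\<^sup>2) = s\<^sup>2 + expectation (\<lambda>\<omega>. (chaos ?w \<omega>)\<^sup>2)"
    using integrable_chaos[of ?w] integrable_chaos_square[of ?w] expectation_chaos[of ?w]
    by (simp add: power2_sum prob_space)
  also have "expectation (\<lambda>\<omega>. (chaos ?w \<omega>)\<^sup>2) = 8 * (\<Sum>b\<in>B. l b ^ 4)"
    unfolding expectation_chaos_square by (simp add: sum_distrib_left power2_eq_square power4_eq_xxxx mult_ac)
  finally show ?thesis by (simp add: s_def add.commute)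
qed

text \<open>Each l_b^2 is at most the square root of s_4. This makes the second-order remainder of
  size s_4^(3/4), which is small compared with s_4^(1/2).\<close>

lemma sum_power6_le: "(\<Sum>b\<in>B. l b ^ 6) \<le> (\<Sum>b\<in>B. l b ^ 4) * sqrt (\<Sum>b\<in>B. l b ^ 4)" for l :: "'i \<Rightarrow> real"
proof -
  have "l b ^ 6 \<le> l b ^ 4 * sqrt (\<Sum>b\<in>B. l b ^ 4)" if "b \<in> B" for b
  proof -
    have "l b ^ 4 \<le> (\<Sum>b\<in>B. l b ^ 4)"
      using finite_index that by (intro member_le_sum) auto
    then have "sqrt (l b ^ 4) \<le> sqrt (\<Sum>b\<in>B. l b ^ 4)" by simp
    also have "sqrt (l b ^ 4) = (l b)\<^sup>2" by (rule real_sqrt_unique) (simp_all flip: power_mult)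
    finally have "l b ^ 4 * (l b)\<^sup>2 \<le> l b ^ 4 * sqrt (\<Sum>b\<in>B. l b ^ 4)" by (intro mult_left_mono) auto
    then show ?thesis by (simp flip: power_add)
  qed
  then show ?thesis unfolding sum_distrib_right by (rule sum_mono)
qed

text \<open>Integrating by parts twice turns the weights l into 2 l^2 and then 4 l^3. The form with
  weights 4 l^3 is the remainder; its variance is 2 times 16 s_6. The first-order term keeps its
  exact coefficient 2 s_2, whose distance from 1 is itself part of the discrepancy.\<close>

lemma second_order_expansion_bound:
  assumes deriv: "\<And>x. (\<psi> has_real_derivative \<psi>' x) (at x)" "\<And>x. (\<psi>' has_real_derivative \<psi>'' x) (at x)"
    and cont: "continuous_on UNIV \<psi>''"
    and bound: "\<And>x. \<bar>\<psi>' x\<bar> \<le> C'" "\<And>x. \<bar>\<psi>'' x\<bar> \<le> C"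
  shows "(expectation (\<lambda>\<omega>. chaos l \<omega> * \<psi> (chaos l \<omega>)) - 2 * (\<Sum>b\<in>B. l b ^ 2) * expectation (\<lambda>\<omega>. \<psi>' (chaos l \<omega>))
       - 4 * (\<Sum>b\<in>B. l b ^ 3) * expectation (\<lambda>\<omega>. \<psi>'' (chaos l \<omega>)))\<^sup>2
    \<le> 32 * ((\<Sum>b\<in>B. l b ^ 4) * sqrt (\<Sum>b\<in>B. l b ^ 4)) * C\<^sup>2"
proof -
  have cont': "continuous_on UNIV \<psi>'" using deriv(2) by (meson DERIV_isCont continuous_at_imp_continuous_on)
  have [measurable]: "\<psi>'' \<in> borel_measurable borel"
    using cont by (auto intro: borel_measurable_continuous_onI)
  let ?w = "\<lambda>b. 2 * (2 * l b * l b) * l b"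
  have "expectation (\<lambda>\<omega>. chaos l \<omega> * \<psi> (chaos l \<omega>)) = 2 * (\<Sum>b\<in>B. l b ^ 2) * expectation (\<lambda>\<omega>. \<psi>' (chaos l \<omega>))
       + (4 * (\<Sum>b\<in>B. l b ^ 3) * expectation (\<lambda>\<omega>. \<psi>'' (chaos l \<omega>)) + expectation (\<lambda>\<omega>. chaos ?w \<omega> * \<psi>'' (chaos l \<omega>)))"
    unfolding chaos_integration_by_parts[OF deriv(1) cont' bound(1)]
      chaos_integration_by_parts[OF deriv(2) cont bound(2)]
    by (simp add: sum_distrib_left power2_eq_square power3_eq_cube mult_ac)
  then have "(expectation (\<lambda>\<omega>. chaos l \<omega> * \<psi> (chaos l \<omega>)) - 2 * (\<Sum>b\<in>B. l b ^ 2) * expectation (\<lambda>\<omega>. \<psi>' (chaos l \<omega>))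
       - 4 * (\<Sum>b\<in>B. l b ^ 3) * expectation (\<lambda>\<omega>. \<psi>'' (chaos l \<omega>)))\<^sup>2 = (expectation (\<lambda>\<omega>. chaos ?w \<omega> * \<psi>'' (chaos l \<omega>)))\<^sup>2"
    by simp
  also have "\<dots> \<le> expectation (\<lambda>\<omega>. (chaos ?w \<omega>)\<^sup>2) * expectation (\<lambda>\<omega>. (\<psi>'' (chaos l \<omega>))\<^sup>2)"
  proof (rule integral_Cauchy_Schwarz)
    show "integrable M (\<lambda>\<omega>. (\<psi>'' (chaos l \<omega>))\<^sup>2)"
      by (rule integrable_const_bound[of _ "C\<^sup>2"]) (use power_mono[OF bound(2) abs_ge_zero, of _ 2] in auto)
  qed (auto intro: integrable_chaos_square)
  also have "expectation (\<lambda>\<omega>. (chaos ?w \<omega>)\<^sup>2) = 32 * (\<Sum>b\<in>B. l b ^ 6)"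
    unfolding expectation_chaos_square by (simp add: sum_distrib_left power2_eq_square power_numeral_reduce mult_ac)
  also have "32 * (\<Sum>b\<in>B. l b ^ 6) * expectation (\<lambda>\<omega>. (\<psi>'' (chaos l \<omega>))\<^sup>2) \<le> 32 * ((\<Sum>b\<in>B. l b ^ 4) * sqrt (\<Sum>b\<in>B. l b ^ 4)) * C\<^sup>2"
  proof (intro mult_mono mult_left_mono sum_power6_le)
    show "expectation (\<lambda>\<omega>. (\<psi>'' (chaos l \<omega>))\<^sup>2) \<le> C\<^sup>2"
      using power_mono[OF bound(2) abs_ge_zero, of _ 2] by (intro integral_le_const integrable_const_bound[of _ "C\<^sup>2"]) auto
  qed (auto intro!: integral_nonneg_AE sum_nonneg mult_nonneg_nonneg)
  finally show ?thesis .
qed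

text \<open>Real and imaginary part are the real formula for the test functions
  \<open>cos (t * x)\<close> and \<open>sin (t * x)\<close>.\<close>

lemma complex_chaos_integration_by_parts:
  "(CLINT \<omega>|M. chaos w \<omega> * iexp (t * chaos l \<omega>)) =
     \<i> * t * (complex_of_real (\<Sum>b\<in>B. 2 * w b * l b) * (CLINT \<omega>|M. iexp (t * chaos l \<omega>))
       + (CLINT \<omega>|M. chaos (\<lambda>b. 2 * w b * l b) \<omega> * iexp (t * chaos l \<omega>)))"
proof -
  define v where "v = (\<lambda>b. 2 * w b * l b)"
  have iex: "integrable M (\<lambda>\<omega>. iexp (t * chaos l \<omega>))" by (rule integrable_iexp) simp_all
  have ichex: "integrable M (\<lambda>\<omega>. chaos v \<omega> * iexp (t * chaos l \<omega>))" for v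
    by (rule Bochner_Integration.integrable_bound[OF integrable_chaos[of v]]) (auto simp: norm_mult)
  have Rec: "Re (iexp (t * x)) = cos (t * x)" "Im (iexp (t * x)) = sin (t * x)" for x :: real
    by (simp_all add: Re_exp Im_exp)
  have bound: "\<bar>- sin (t * x) * t\<bar> \<le> \<bar>t\<bar>" "\<bar>cos (t * x) * t\<bar> \<le> \<bar>t\<bar>" for x
    by (simp_all add: abs_mult mult_left_le_one_le)
  have c: "expectation (\<lambda>\<omega>. chaos w \<omega> * cos (t * chaos l \<omega>)) =
     (\<Sum>b\<in>B. v b) * expectation (\<lambda>\<omega>. - sin (t * chaos l \<omega>) * t) + expectation (\<lambda>\<omega>. chaos v \<omega> * (- sin (t * chaos l \<omega>) * t))"
    unfolding v_def by (rule chaos_integration_by_parts[OF _ _ bound(1)]) (auto intro!: derivative_eq_intros continuous_intros)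
  have s: "expectation (\<lambda>\<omega>. chaos w \<omega> * sin (t * chaos l \<omega>)) =
     (\<Sum>b\<in>B. v b) * expectation (\<lambda>\<omega>. cos (t * chaos l \<omega>) * t) + expectation (\<lambda>\<omega>. chaos v \<omega> * (cos (t * chaos l \<omega>) * t))"
    unfolding v_def by (rule chaos_integration_by_parts[OF _ _ bound(2)]) (auto intro!: derivative_eq_intros continuous_intros)
  have parts: "Re (CLINT \<omega>|M. chaos v \<omega> * iexp (t * chaos l \<omega>)) = expectation (\<lambda>\<omega>. chaos v \<omega> * cos (t * chaos l \<omega>))"
    "Im (CLINT \<omega>|M. chaos v \<omega> * iexp (t * chaos l \<omega>)) = expectation (\<lambda>\<omega>. chaos v \<omega> * sin (t * chaos l \<omega>))" for v
    using ichex[of v] by (simp_all add: Rec del: of_real_mult flip: integral_Re integral_Im)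
  have parts1: "Re (CLINT \<omega>|M. iexp (t * chaos l \<omega>)) = expectation (\<lambda>\<omega>. cos (t * chaos l \<omega>))"
    "Im (CLINT \<omega>|M. iexp (t * chaos l \<omega>)) = expectation (\<lambda>\<omega>. sin (t * chaos l \<omega>))"
    using iex by (simp_all add: Rec del: of_real_mult flip: integral_Re integral_Im)
  have "(CLINT \<omega>|M. chaos w \<omega> * iexp (t * chaos l \<omega>)) =
     \<i> * t * (complex_of_real (\<Sum>b\<in>B. v b) * (CLINT \<omega>|M. iexp (t * chaos l \<omega>)) + (CLINT \<omega>|M. chaos v \<omega> * iexp (t * chaos l \<omega>)))"
  proof -
    have "expectation (\<lambda>\<omega>. chaos v \<omega> * (- sin (t * chaos l \<omega>) * t)) = - t * expectation (\<lambda>\<omega>. chaos v \<omega> * sin (t * chaos l \<omega>))"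
      "expectation (\<lambda>\<omega>. chaos v \<omega> * (cos (t * chaos l \<omega>) * t)) = t * expectation (\<lambda>\<omega>. chaos v \<omega> * cos (t * chaos l \<omega>))"
      by (simp_all add: mult_ac flip: integral_mult_right_zero)
    then show ?thesis
      unfolding complex_eq_iff times_complex.sel plus_complex.sel parts parts1 c s Re_complex_of_real Im_complex_of_real
      by (simp add: algebra_simps)
  qed
  then show ?thesis by (simp add: v_def)
qed

text \<open>For the weights l^(m+1) integration by parts reads a_m = 2 i t (s_(m+2) phi + a_(m+1)),
  and iterating it expands the derivative of the characteristic function phi, up to the factor i, in
  traces. The remainder vanishes because a_m is at most sqrt 2 times the (m+1)-st power of the
  Euclidean norm of l. This is the logarithmic derivative of the product formula for phi, written
  with traces only so that it survives L^2 limits.\<close>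

lemma chaos_char_derivative_sums:
  assumes t: "2 * \<bar>t\<bar> * sqrt (\<Sum>b\<in>B. (l b)\<^sup>2) < 1"
  shows "(\<lambda>j. (2 * \<i> * t) ^ Suc j * complex_of_real (\<Sum>b\<in>B. l b ^ (j + 2)) * (CLINT \<omega>|M. iexp (t * chaos l \<omega>)))
    sums (CLINT \<omega>|M. chaos l \<omega> * iexp (t * chaos l \<omega>))"
proof -
  define \<phi> where "\<phi> = (CLINT \<omega>|M. iexp (t * chaos l \<omega>))"
  define s where "s = (\<lambda>p. \<Sum>b\<in>B. l b ^ p)"
  define a where "a = (\<lambda>m. CLINT \<omega>|M. chaos (\<lambda>b. l b ^ Suc m) \<omega> * iexp (t * chaos l \<omega>))"
  have rec: "a m = 2 * \<i> * t * (of_real (s (m + 2)) * \<phi> + a (Suc m))" for m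
  proof -
    have "chaos (\<lambda>b. 2 * l b ^ Suc m * l b) \<omega> = 2 * chaos (\<lambda>b. l b ^ Suc (Suc m)) \<omega>" for \<omega>
      by (simp add: chaos_def sum_distrib_left mult_ac)
    moreover have "(\<Sum>b\<in>B. 2 * l b ^ Suc m * l b) = 2 * s (m + 2)"
      by (simp add: s_def sum_distrib_left mult_ac)
    ultimately show ?thesis
      unfolding a_def complex_chaos_integration_by_parts[of "\<lambda>b. l b ^ Suc m"] \<phi>_def
      by (simp add: mult.assoc algebra_simps)
  qed
  have partial: "a 0 = (\<Sum>j<m. (2 * \<i> * t) ^ Suc j * of_real (s (j + 2)) * \<phi>) + (2 * \<i> * t) ^ m * a m" for m
  proof (induction m)
    case (Suc m)
    have "(2 * \<i> * t) ^ m * a m = (2 * \<i> * t) ^ Suc m * of_real (s (m + 2)) * \<phi> + (2 * \<i> * t) ^ Suc m * a (Suc m)"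
      by (subst rec) (simp add: algebra_simps)
    then show ?case using Suc by simp
  qed simp
  let ?r = "sqrt (\<Sum>b\<in>B. (l b)\<^sup>2)"
  have bound: "cmod (a m) \<le> sqrt 2 * ?r ^ Suc m" for m
  proof -
    let ?w = "\<lambda>b. l b ^ Suc m"
    have "cmod (a m) \<le> expectation (\<lambda>\<omega>. \<bar>chaos ?w \<omega>\<bar>)"
      unfolding a_def by (rule order_trans[OF integral_norm_bound]) (simp add: norm_mult)
    also have "\<dots> \<le> sqrt (2 * (\<Sum>b\<in>B. (?w b)\<^sup>2))"
    proof (rule real_le_rsqrt)
      show "(expectation (\<lambda>\<omega>. \<bar>chaos ?w \<omega>\<bar>))\<^sup>2 \<le> 2 * (\<Sum>b\<in>B. (?w b)\<^sup>2)"
        using integral_Cauchy_Schwarz[of "\<lambda>\<omega>. \<bar>chaos ?w \<omega>\<bar>" M "\<lambda>_. 1"] integrable_chaos_square[of ?w]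
        by (simp add: prob_space expectation_chaos_square)
    qed
    also have "(\<Sum>b\<in>B. (?w b)\<^sup>2) = (\<Sum>b\<in>B. l b ^ (2 * Suc m))"
      unfolding power_mult[symmetric] by (simp only: mult.commute)
    also have "\<dots> \<le> ?r ^ (2 * Suc m)" by (rule order_trans[OF abs_ge_self abs_power_sum_le_two]) simp
    also have "\<dots> = (?r ^ Suc m)\<^sup>2" unfolding power_mult[symmetric] by (simp only: mult.commute)
    finally show ?thesis by (simp add: real_sqrt_mult sum_nonneg)
  qed
  have "(\<lambda>m. (2 * \<i> * t) ^ m * a m) \<longlonglongrightarrow> 0"
  proof (rule Lim_null_comparison)
    show "eventually (\<lambda>m. cmod ((2 * \<i> * t) ^ m * a m) \<le> (2 * \<bar>t\<bar> * ?r) ^ m * (sqrt 2 * ?r)) sequentially"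
    proof (rule always_eventually, rule allI)
      fix m
      have "cmod ((2 * \<i> * t) ^ m * a m) \<le> (2 * \<bar>t\<bar>) ^ m * (sqrt 2 * ?r ^ Suc m)"
        unfolding norm_mult norm_power using bound by (intro mult_mono power_mono) (auto simp: norm_mult)
      then show "cmod ((2 * \<i> * t) ^ m * a m) \<le> (2 * \<bar>t\<bar> * ?r) ^ m * (sqrt 2 * ?r)"
        by (simp add: power_mult_distrib mult_ac)
    qed
    show "(\<lambda>m. (2 * \<bar>t\<bar> * ?r) ^ m * (sqrt 2 * ?r)) \<longlonglongrightarrow> 0"
      using t by (intro tendsto_mult_left_zero LIMSEQ_power_zero) (simp add: sum_nonneg)
  qed
  from tendsto_diff[OF tendsto_const[of "a 0"] this]
  have "(\<lambda>m. a 0 - (2 * \<i> * t) ^ m * a m) \<longlonglongrightarrow> a 0" by simp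
  moreover have "a 0 - (2 * \<i> * t) ^ m * a m = (\<Sum>j<m. (2 * \<i> * t) ^ Suc j * of_real (s (j + 2)) * \<phi>)" for m
    using partial[of m] by (simp add: diff_eq_eq)
  ultimately have "(\<lambda>m. \<Sum>j<m. (2 * \<i> * t) ^ Suc j * of_real (s (j + 2)) * \<phi>) \<longlonglongrightarrow> a 0" by simp
  then show ?thesis by (simp add: sums_def a_def s_def \<phi>_def)
qed

end

subsection \<open>Limits of diagonal quadratic forms\<close>

lemma diagonal_convergent_subsequence:
  fixes f :: "nat \<Rightarrow> nat \<Rightarrow> real"
  assumes "\<And>p. Bseq (\<lambda>k. f k p)"
  obtains r where "strict_mono (r :: nat \<Rightarrow> nat)" "\<And>p. convergent (\<lambda>k. f (r k) p)"
proof -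
  interpret subseqs "\<lambda>p r. convergent (\<lambda>k. f (r k) p)"
  proof
    fix p and r :: "nat \<Rightarrow> nat" assume "strict_mono r"
    have "Bseq (\<lambda>k. f (r k) p)" using Bseq_subseq[OF assms[of p]] by simp
    then have "bounded (range (\<lambda>k. f (r k) p))" by (simp add: Bseq_eq_bounded)
    then obtain r' l where "strict_mono r'" "((\<lambda>k. f (r k) p) \<circ> r') \<longlonglongrightarrow> l"
      using bounded_imp_convergent_subsequence by blast
    then show "\<exists>r'. strict_mono r' \<and> convergent (\<lambda>k. f ((r \<circ> r') k) p)"
      by (auto simp: convergent_def o_def)
  qed
  have "convergent (\<lambda>k. f (diagseq k) p)" for p
  proof -
    \<comment> \<open>Only from index p + 1 on is the diagonal sequence known to be a subsequence of
      the one selected for p; the initial segment is discarded afterwards.\<close>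
    have "convergent (\<lambda>k. f ((diagseq \<circ> ((+) (Suc p))) k) p)"
    proof (rule diagseq_holds)
      fix n and s r :: "nat \<Rightarrow> nat" assume "strict_mono r" "convergent (\<lambda>k. f (s k) n)"
      then show "convergent (\<lambda>k. f ((s \<circ> r) k) n)"
        using convergent_subseq_convergent[of "\<lambda>k. f (s k) n" r] by (simp add: o_def)
    qed
    then have "convergent (\<lambda>k. (\<lambda>k. f (diagseq k) p) (k + Suc p))" by (simp add: o_def add.commute)
    then show ?thesis by (subst (asm) convergent_ignore_initial_segment)
  qed
  then show ?thesis using that subseq_diagseq by blast
qed

text \<open>For \<open>F = (\<Sum>b\<in>B. l b * (\<xi> b\<^sup>2 - 1))\<close> with a family \<open>\<xi>\<close> of independent standard normal variables,
  \<open>s p\<close> is the power sum \<open>(\<Sum>b\<in>B. l b ^ p)\<close>, the trace of the \<open>p\<close>-th power of the operator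
  with kernel \<open>f\<close>; the cumulants of \<open>F\<close> are \<open>2\<^sup>p\<^sup>-\<^sup>1 (p-1)! s p\<close>. The axioms are those properties of such
  variables that survive limits in \<open>L\<^sup>2\<close>, so that no spectral theory in infinite dimension is needed.\<close>

locale second_chaos_variable = prob_space M for M :: "'a measure" +
  fixes F :: "'a \<Rightarrow> real" and s :: "nat \<Rightarrow> real"
  assumes measurable_F [measurable]: "F \<in> borel_measurable M"
    and integrable_square: "integrable M (\<lambda>\<omega>. (F \<omega>)\<^sup>2)"
    and expectation_square: "expectation (\<lambda>\<omega>. (F \<omega>)\<^sup>2) = 2 * s 2"
    and trace_bound: "2 \<le> p \<Longrightarrow> \<bar>s p\<bar> \<le> sqrt (s 2) ^ p"
    and trace_bound4: "4 \<le> p \<Longrightarrow> \<bar>s p\<bar> \<le> s 4 * sqrt (s 2) ^ (p - 4)"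
    and stein_bound: "\<lbrakk>\<And>x. (\<psi> has_real_derivative \<psi>' x) (at x); continuous_on UNIV \<psi>'; \<And>x. \<bar>\<psi>' x\<bar> \<le> C\<rbrakk> \<Longrightarrow>
      (expectation (\<lambda>\<omega>. \<psi>' (F \<omega>)) - expectation (\<lambda>\<omega>. F \<omega> * \<psi> (F \<omega>)))\<^sup>2
        \<le> (8 * s 4 + (2 * s 2 - 1)\<^sup>2) * expectation (\<lambda>\<omega>. (\<psi>' (F \<omega>))\<^sup>2)"
    and expansion_bound: "\<lbrakk>\<And>x. (\<psi> has_real_derivative \<psi>' x) (at x); \<And>x. (\<psi>' has_real_derivative \<psi>'' x) (at x);
        continuous_on UNIV \<psi>''; \<And>x. \<bar>\<psi>' x\<bar> \<le> C'; \<And>x. \<bar>\<psi>'' x\<bar> \<le> C\<rbrakk> \<Longrightarrow>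
      (expectation (\<lambda>\<omega>. F \<omega> * \<psi> (F \<omega>)) - 2 * s 2 * expectation (\<lambda>\<omega>. \<psi>' (F \<omega>))
         - 4 * s 3 * expectation (\<lambda>\<omega>. \<psi>'' (F \<omega>)))\<^sup>2 \<le> 32 * (s 4 * sqrt (s 4)) * C\<^sup>2"
    and char_derivative_sums: "2 * \<bar>t\<bar> * sqrt (s 2) < 1 \<Longrightarrow>
      (\<lambda>j. (2 * \<i> * t) ^ Suc j * complex_of_real (s (j + 2)) * (CLINT \<omega>|M. iexp (t * F \<omega>)))
        sums (CLINT \<omega>|M. F \<omega> * iexp (t * F \<omega>))"

lemma (in std_normal_family) second_chaos_variable_chaos:
  "second_chaos_variable M (chaos l) (\<lambda>p. \<Sum>b\<in>B. l b ^ p)"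
proof
  show "\<bar>\<Sum>b\<in>B. l b ^ p\<bar> \<le> (\<Sum>b\<in>B. l b ^ 4) * sqrt (\<Sum>b\<in>B. (l b)\<^sup>2) ^ (p - 4)" if "4 \<le> p" for p
    using that by (intro abs_power_sum_le) auto
qed (rule measurable_chaos integrable_chaos_square expectation_chaos_square abs_power_sum_le_two
    stein_discrepancy_bound second_order_expansion_bound chaos_char_derivative_sums; assumption)+

section \<open>Passage to L^2 limits\<close>

context prob_space begin

text \<open>The difference of the products splits into (H - F) psi(H) and F (psi(H) - psi(F)).
  Cauchy-Schwarz bounds each by the L^2 distance of H and F, because a Lipschitz psi grows at most
  linearly. Unbounded psi must be covered, since Stein test functions have only a bounded
  derivative.\<close>

lemma tendsto_expectation_mult_Lipschitz_of_L2:
  fixes H :: "nat \<Rightarrow> 'a \<Rightarrow> real" and F :: "'a \<Rightarrow> real" and \<psi> :: "real \<Rightarrow> real"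
  assumes [measurable]: "\<And>k. H k \<in> borel_measurable M" "F \<in> borel_measurable M"
    and int: "\<And>k. integrable M (\<lambda>\<omega>. (H k \<omega>)\<^sup>2)" "integrable M (\<lambda>\<omega>. (F \<omega>)\<^sup>2)"
    and L2: "(\<lambda>k. expectation (\<lambda>\<omega>. (H k \<omega> - F \<omega>)\<^sup>2)) \<longlonglongrightarrow> 0"
    and Lip: "\<And>x y. \<bar>\<psi> x - \<psi> y\<bar> \<le> C * \<bar>x - y\<bar>"
  shows "(\<lambda>k. expectation (\<lambda>\<omega>. H k \<omega> * \<psi> (H k \<omega>))) \<longlonglongrightarrow> expectation (\<lambda>\<omega>. F \<omega> * \<psi> (F \<omega>))"
proof -
  have C: "0 \<le> C" using Lip[of 1 0] by simp
  have "continuous_on UNIV \<psi>"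
  proof -
    have "C-lipschitz_on UNIV \<psi>" using Lip C by (auto simp: lipschitz_on_def dist_real_def)
    then show ?thesis by (rule lipschitz_on_continuous_on)
  qed
  then have [measurable]: "\<psi> \<in> borel_measurable borel" by (rule borel_measurable_continuous_onI)
  let ?d = "\<lambda>k. expectation (\<lambda>\<omega>. (H k \<omega> - F \<omega>)\<^sup>2)"
  have iD: "integrable M (\<lambda>\<omega>. (H k \<omega> - F \<omega>)\<^sup>2)" for k
    using integrable_square_add[of "H k" M "\<lambda>\<omega>. - F \<omega>"] int by simp
  have i\<psi>: "integrable M (\<lambda>\<omega>. (\<psi> (Y \<omega>))\<^sup>2)" and b\<psi>: "expectation (\<lambda>\<omega>. (\<psi> (Y \<omega>))\<^sup>2) \<le> 2 * (\<psi> 0)\<^sup>2 + 2 * C\<^sup>2 * expectation (\<lambda>\<omega>. (Y \<omega>)\<^sup>2)"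
    if [measurable]: "Y \<in> borel_measurable M" and Y: "integrable M (\<lambda>\<omega>. (Y \<omega>)\<^sup>2)" for Y :: "'a \<Rightarrow> real"
  proof -
    have le: "(\<psi> y)\<^sup>2 \<le> 2 * (\<psi> 0)\<^sup>2 + 2 * C\<^sup>2 * y\<^sup>2" for y
    proof -
      have "\<bar>\<psi> y\<bar> \<le> \<bar>\<psi> 0\<bar> + C * \<bar>y\<bar>" using Lip[of y 0] by simp
      from power_mono[OF this abs_ge_zero, of 2]
      have "(\<psi> y)\<^sup>2 \<le> (\<bar>\<psi> 0\<bar> + C * \<bar>y\<bar>)\<^sup>2" by simp
      also have "\<dots> \<le> 2 * \<bar>\<psi> 0\<bar>\<^sup>2 + 2 * (C * \<bar>y\<bar>)\<^sup>2"
        using sum_squares_bound[of "\<bar>\<psi> 0\<bar>" "C * \<bar>y\<bar>"] by (simp add: power2_sum)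
      finally show ?thesis by (simp add: power_mult_distrib)
    qed
    show i: "integrable M (\<lambda>\<omega>. (\<psi> (Y \<omega>))\<^sup>2)"
      by (rule Bochner_Integration.integrable_bound[where f = "\<lambda>\<omega>. 2 * (\<psi> 0)\<^sup>2 + 2 * C\<^sup>2 * (Y \<omega>)\<^sup>2"])
        (use Y le in \<open>auto intro: order_trans[OF _ abs_ge_self]\<close>)
    have "expectation (\<lambda>\<omega>. (\<psi> (Y \<omega>))\<^sup>2) \<le> expectation (\<lambda>\<omega>. 2 * (\<psi> 0)\<^sup>2 + 2 * C\<^sup>2 * (Y \<omega>)\<^sup>2)"
      by (rule integral_mono) (use i Y le in auto)
    then show "expectation (\<lambda>\<omega>. (\<psi> (Y \<omega>))\<^sup>2) \<le> 2 * (\<psi> 0)\<^sup>2 + 2 * C\<^sup>2 * expectation (\<lambda>\<omega>. (Y \<omega>)\<^sup>2)"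
      using Y by (simp add: prob_space)
  qed
  have EH: "expectation (\<lambda>\<omega>. (H k \<omega>)\<^sup>2) \<le> 2 * ?d k + 2 * expectation (\<lambda>\<omega>. (F \<omega>)\<^sup>2)" for k
  proof -
    have "expectation (\<lambda>\<omega>. (H k \<omega>)\<^sup>2) \<le> expectation (\<lambda>\<omega>. 2 * (H k \<omega> - F \<omega>)\<^sup>2 + 2 * (F \<omega>)\<^sup>2)"
    proof (rule integral_mono)
      show "(H k \<omega>)\<^sup>2 \<le> 2 * (H k \<omega> - F \<omega>)\<^sup>2 + 2 * (F \<omega>)\<^sup>2" for \<omega>
        using zero_le_power2[of "H k \<omega> - 2 * F \<omega>"] by (simp add: power2_eq_square algebra_simps)
    qed (use int iD in auto)
    then show ?thesis using int iD by simp
  qed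
  let ?A = "\<lambda>k. expectation (\<lambda>\<omega>. (H k \<omega> - F \<omega>) * \<psi> (H k \<omega>))"
  let ?B = "\<lambda>k. expectation (\<lambda>\<omega>. F \<omega> * (\<psi> (H k \<omega>) - \<psi> (F \<omega>)))"
  have i\<psi>d: "integrable M (\<lambda>\<omega>. (\<psi> (H k \<omega>) - \<psi> (F \<omega>))\<^sup>2)" for k
    using integrable_square_add[of "\<lambda>\<omega>. \<psi> (H k \<omega>)" M "\<lambda>\<omega>. - \<psi> (F \<omega>)"] int i\<psi> by simp
  have "(?A k)\<^sup>2 \<le> ?d k * (2 * (\<psi> 0)\<^sup>2 + 2 * C\<^sup>2 * (2 * ?d k + 2 * expectation (\<lambda>\<omega>. (F \<omega>)\<^sup>2)))" for k
  proof -
    have "(?A k)\<^sup>2 \<le> ?d k * expectation (\<lambda>\<omega>. (\<psi> (H k \<omega>))\<^sup>2)"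
      by (intro integral_Cauchy_Schwarz iD i\<psi> int) simp_all
    also have "\<dots> \<le> ?d k * (2 * (\<psi> 0)\<^sup>2 + 2 * C\<^sup>2 * (2 * ?d k + 2 * expectation (\<lambda>\<omega>. (F \<omega>)\<^sup>2)))"
      by (intro mult_left_mono order_trans[OF b\<psi>] add_mono mult_left_mono EH order_refl int integral_nonneg_AE) auto
    finally show ?thesis .
  qed
  moreover have "(\<lambda>k. ?d k * (2 * (\<psi> 0)\<^sup>2 + 2 * C\<^sup>2 * (2 * ?d k + 2 * expectation (\<lambda>\<omega>. (F \<omega>)\<^sup>2)))) \<longlonglongrightarrow>
      0 * (2 * (\<psi> 0)\<^sup>2 + 2 * C\<^sup>2 * (2 * 0 + 2 * expectation (\<lambda>\<omega>. (F \<omega>)\<^sup>2)))"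
    by (intro tendsto_intros L2)
  ultimately have "(\<lambda>k. (?A k)\<^sup>2) \<longlonglongrightarrow> 0"
    by (intro Lim_null_comparison[of "\<lambda>k. (?A k)\<^sup>2"]) auto
  then have A: "?A \<longlonglongrightarrow> 0" by (simp add: power_tendsto_0_iff)
  have "(?B k)\<^sup>2 \<le> expectation (\<lambda>\<omega>. (F \<omega>)\<^sup>2) * (C\<^sup>2 * ?d k)" for k
  proof -
    have "(?B k)\<^sup>2 \<le> expectation (\<lambda>\<omega>. (F \<omega>)\<^sup>2) * expectation (\<lambda>\<omega>. (\<psi> (H k \<omega>) - \<psi> (F \<omega>))\<^sup>2)"
      by (intro integral_Cauchy_Schwarz int i\<psi>d) simp_all
    moreover have "expectation (\<lambda>\<omega>. (\<psi> (H k \<omega>) - \<psi> (F \<omega>))\<^sup>2) \<le> expectation (\<lambda>\<omega>. C\<^sup>2 * (H k \<omega> - F \<omega>)\<^sup>2)"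
    proof (rule integral_mono)
      show "(\<psi> (H k \<omega>) - \<psi> (F \<omega>))\<^sup>2 \<le> C\<^sup>2 * (H k \<omega> - F \<omega>)\<^sup>2" for \<omega>
        using power_mono[OF Lip abs_ge_zero, of _ _ 2] by (simp add: power_mult_distrib)
    qed (use iD i\<psi>d in auto)
    then have "expectation (\<lambda>\<omega>. (F \<omega>)\<^sup>2) * expectation (\<lambda>\<omega>. (\<psi> (H k \<omega>) - \<psi> (F \<omega>))\<^sup>2)
        \<le> expectation (\<lambda>\<omega>. (F \<omega>)\<^sup>2) * (C\<^sup>2 * ?d k)"
      by (intro mult_left_mono integral_nonneg_AE) auto
    ultimately show ?thesis by linarith
  qed
  moreover have "(\<lambda>k. expectation (\<lambda>\<omega>. (F \<omega>)\<^sup>2) * (C\<^sup>2 * ?d k)) \<longlonglongrightarrow> expectation (\<lambda>\<omega>. (F \<omega>)\<^sup>2) * (C\<^sup>2 * 0)"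
    by (intro tendsto_intros L2)
  ultimately have "(\<lambda>k. (?B k)\<^sup>2) \<longlonglongrightarrow> 0"
    by (intro Lim_null_comparison[of "\<lambda>k. (?B k)\<^sup>2"]) auto
  then have B: "?B \<longlonglongrightarrow> 0" by (simp add: power_tendsto_0_iff)
  have "expectation (\<lambda>\<omega>. H k \<omega> * \<psi> (H k \<omega>)) = ?A k + ?B k + expectation (\<lambda>\<omega>. F \<omega> * \<psi> (F \<omega>))" for k
  proof -
    have "integrable M (\<lambda>\<omega>. (H k \<omega> - F \<omega>) * \<psi> (H k \<omega>))" "integrable M (\<lambda>\<omega>. F \<omega> * (\<psi> (H k \<omega>) - \<psi> (F \<omega>)))"
      "integrable M (\<lambda>\<omega>. F \<omega> * \<psi> (F \<omega>))"
      by (intro integrable_mult_of_squares iD i\<psi> i\<psi>d int; simp)+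
    then have "?A k + ?B k + expectation (\<lambda>\<omega>. F \<omega> * \<psi> (F \<omega>)) =
       expectation (\<lambda>\<omega>. (H k \<omega> - F \<omega>) * \<psi> (H k \<omega>) + F \<omega> * (\<psi> (H k \<omega>) - \<psi> (F \<omega>)) + F \<omega> * \<psi> (F \<omega>))"
      by simp
    also have "\<dots> = expectation (\<lambda>\<omega>. H k \<omega> * \<psi> (H k \<omega>))" by (simp add: algebra_simps)
    finally show ?thesis ..
  qed
  then show ?thesis using tendsto_add[OF tendsto_add[OF A B] tendsto_const] by simp
qed

end

lemma (in second_chaos_variable) trace2_nonneg: "0 \<le> s 2"
  using expectation_square integral_nonneg_AE[of "\<lambda>\<omega>. (F \<omega>)\<^sup>2" M] by simp

lemma (in second_chaos_variable) trace4_nonneg: "0 \<le> s 4"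
  using trace_bound4[of 4] by simp

context prob_space begin

lemma tendsto_expectation_of_AE:
  fixes H :: "nat \<Rightarrow> 'a \<Rightarrow> real" and g :: "real \<Rightarrow> 'b::{banach, second_countable_topology}"
  assumes [measurable]: "\<And>k. H k \<in> borel_measurable M" "F \<in> borel_measurable M"
    and AE: "AE \<omega> in M. (\<lambda>k. H k \<omega>) \<longlonglongrightarrow> F \<omega>"
    and g: "continuous_on UNIV g" "\<And>x. norm (g x) \<le> C"
  shows "(\<lambda>k. LINT \<omega>|M. g (H k \<omega>)) \<longlonglongrightarrow> (LINT \<omega>|M. g (F \<omega>))"
proof (rule integral_dominated_convergence[where w = "\<lambda>_. C"])
  have [measurable]: "g \<in> borel_measurable borel" using g(1) by (rule borel_measurable_continuous_onI)
  show "(\<lambda>\<omega>. g (F \<omega>)) \<in> borel_measurable M" "\<And>k. (\<lambda>\<omega>. g (H k \<omega>)) \<in> borel_measurable M" by measurable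
  show "AE \<omega> in M. (\<lambda>k. g (H k \<omega>)) \<longlonglongrightarrow> g (F \<omega>)"
    using AE by eventually_elim (use g(1) in \<open>auto intro: continuous_on_tendsto_compose\<close>)
qed (use g(2) in auto)

lemma L2_convergent_AE_subsequence:
  fixes G :: "nat \<Rightarrow> 'a \<Rightarrow> real"
  assumes [measurable]: "\<And>k. G k \<in> borel_measurable M" "F \<in> borel_measurable M"
    and int: "\<And>k. integrable M (\<lambda>\<omega>. (G k \<omega>)\<^sup>2)" "integrable M (\<lambda>\<omega>. (F \<omega>)\<^sup>2)"
    and L2: "(\<lambda>k. expectation (\<lambda>\<omega>. (G k \<omega> - F \<omega>)\<^sup>2)) \<longlonglongrightarrow> 0"
  obtains r where "strict_mono (r :: nat \<Rightarrow> nat)" "AE \<omega> in M. (\<lambda>k. G (r k) \<omega>) \<longlonglongrightarrow> F \<omega>"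
proof -
  have "integrable M (\<lambda>\<omega>. (G k \<omega> - F \<omega>)\<^sup>2)" for k
    using integrable_square_add[of "G k" M "\<lambda>\<omega>. - F \<omega>"] int by simp
  then obtain r where r: "strict_mono (r :: nat \<Rightarrow> nat)" "AE \<omega> in M. (\<lambda>k. (G (r k) \<omega> - F \<omega>)\<^sup>2) \<longlonglongrightarrow> 0"
    using tendsto_L1_AE_subseq[of M "\<lambda>k \<omega>. (G k \<omega> - F \<omega>)\<^sup>2"] L2 by auto
  have "AE \<omega> in M. (\<lambda>k. G (r k) \<omega>) \<longlonglongrightarrow> F \<omega>"
    using r(2) by eventually_elim (simp add: power_tendsto_0_iff LIM_zero_iff)
  with r(1) show ?thesis by (rule that)
qed

text \<open>The sequence s consists of limits of the traces along a diagonal subsequence, refined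
  once more to obtain almost sure convergence. Every property then passes to the limit: terms with a
  factor F by L^2 convergence, bounded continuous functions of F by dominated convergence.\<close>

lemma second_chaos_variable_limit:
  fixes G :: "nat \<Rightarrow> 'a \<Rightarrow> real"
  assumes G: "\<And>k. second_chaos_variable M (G k) (sG k)"
    and [measurable]: "F \<in> borel_measurable M" and intF: "integrable M (\<lambda>\<omega>. (F \<omega>)\<^sup>2)"
    and L2: "(\<lambda>k. expectation (\<lambda>\<omega>. (G k \<omega> - F \<omega>)\<^sup>2)) \<longlonglongrightarrow> 0"
  obtains s where "second_chaos_variable M F s"
proof -
  interpret G: second_chaos_variable M "G k" "sG k" for k by (rule G)
  have E2: "(\<lambda>k. 2 * sG k 2) \<longlonglongrightarrow> expectation (\<lambda>\<omega>. (F \<omega>)\<^sup>2)"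
    using tendsto_expectation_mult_Lipschitz_of_L2[OF G.measurable_F _ G.integrable_square intF L2, of "\<lambda>x. x" 1]
    by (simp add: power2_eq_square flip: G.expectation_square)
  have E2': "(\<lambda>k. sG k 2) \<longlonglongrightarrow> expectation (\<lambda>\<omega>. (F \<omega>)\<^sup>2) / 2"
    using tendsto_divide[OF E2 tendsto_const[of 2]] by simp
  \<comment> \<open>Only exponents from 2 on are bounded, whence the shift: for finite sums s_0
    counts the terms and s_1 may grow without bound.\<close>
  have "Bseq (\<lambda>k. sG k (p + 2))" for p
  proof -
    obtain K where K: "\<And>k. \<bar>sG k 2\<bar> \<le> K"
      using convergent_imp_Bseq[OF convergentI[OF E2']] by (auto simp: Bseq_def)
    have "norm (sG k (p + 2)) \<le> sqrt K ^ (p + 2)" for k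
    proof -
      have "sqrt (sG k 2) \<le> sqrt K" using K[of k] by simp
      then show ?thesis
        using order_trans[OF G.trace_bound[of "p + 2" k] power_mono[of "sqrt (sG k 2)" "sqrt K" "p + 2"]] G.trace2_nonneg[of k]
        by simp
    qed
    then show ?thesis by (rule BseqI')
  qed
  then obtain r1 where r1: "strict_mono (r1 :: nat \<Rightarrow> nat)" "\<And>p. convergent (\<lambda>k. sG (r1 k) (p + 2))"
    using diagonal_convergent_subsequence[of "\<lambda>k p. sG k (p + 2)"] by auto
  have "(\<lambda>k. expectation (\<lambda>\<omega>. (G (r1 k) \<omega> - F \<omega>)\<^sup>2)) \<longlonglongrightarrow> 0"
    using LIMSEQ_subseq_LIMSEQ[OF L2 r1(1)] by (simp add: o_def)
  from L2_convergent_AE_subsequence[OF G.measurable_F _ G.integrable_square intF this]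
  obtain r2 where r2: "strict_mono (r2 :: nat \<Rightarrow> nat)" "AE \<omega> in M. (\<lambda>k. G (r1 (r2 k)) \<omega>) \<longlonglongrightarrow> F \<omega>" by auto
  define r where "r = r1 \<circ> r2"
  have r: "strict_mono r" unfolding r_def by (intro strict_mono_o r1 r2)
  define H where "H k = G (r k)" for k
  define sH where "sH k = sG (r k)" for k
  define s where "s p = lim (\<lambda>k. sH k p)" for p
  interpret H: second_chaos_variable M "H k" "sH k" for k unfolding H_def sH_def by (rule G)
  have slim: "(\<lambda>k. sH k p) \<longlonglongrightarrow> s p" if "2 \<le> p" for p
  proof -
    have "convergent (\<lambda>k. sH k (p - 2 + 2))"
      unfolding sH_def r_def using convergent_subseq_convergent[OF r1(2) r2(1), of "p - 2"] by (simp add: o_def)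
    moreover have "p - 2 + 2 = p" using that by simp
    ultimately show ?thesis by (simp only: s_def convergent_LIMSEQ_iff)
  qed
  have L2H: "(\<lambda>k. expectation (\<lambda>\<omega>. (H k \<omega> - F \<omega>)\<^sup>2)) \<longlonglongrightarrow> 0"
    using LIMSEQ_subseq_LIMSEQ[OF L2 r] by (simp add: o_def H_def)
  have AEH: "AE \<omega> in M. (\<lambda>k. H k \<omega>) \<longlonglongrightarrow> F \<omega>" using r2(2) by (simp add: H_def r_def)
  have lip: "(\<lambda>k. expectation (\<lambda>\<omega>. H k \<omega> * \<psi> (H k \<omega>))) \<longlonglongrightarrow> expectation (\<lambda>\<omega>. F \<omega> * \<psi> (F \<omega>))"
    if "\<And>x. (\<psi> has_real_derivative \<psi>' x) (at x)" "\<And>x. \<bar>\<psi>' x\<bar> \<le> C" for \<psi> \<psi>' C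
    by (rule tendsto_expectation_mult_Lipschitz_of_L2[OF H.measurable_F _ H.integrable_square intF L2H])
      (fact, rule Lipschitz_of_bounded_derivative[OF that])
  note bdd = tendsto_expectation_of_AE[OF H.measurable_F assms(2) AEH]
  have s2: "expectation (\<lambda>\<omega>. (F \<omega>)\<^sup>2) = 2 * s 2"
    using LIMSEQ_unique[OF LIMSEQ_subseq_LIMSEQ[OF E2 r], of "2 * s 2"] slim[of 2]
    by (auto simp: o_def sH_def intro!: tendsto_intros)
  have "second_chaos_variable M F s"
  proof
    show "F \<in> borel_measurable M" "integrable M (\<lambda>\<omega>. (F \<omega>)\<^sup>2)" "expectation (\<lambda>\<omega>. (F \<omega>)\<^sup>2) = 2 * s 2"
      by fact+
    show "\<bar>s p\<bar> \<le> sqrt (s 2) ^ p" if "2 \<le> p" for p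
      using H.trace_bound[OF that] slim[OF that] slim[of 2]
      by (intro LIMSEQ_le[of "\<lambda>k. \<bar>sH k p\<bar>" _ "\<lambda>k. sqrt (sH k 2) ^ p"] tendsto_intros) auto
    show "\<bar>s p\<bar> \<le> s 4 * sqrt (s 2) ^ (p - 4)" if "4 \<le> p" for p
      using H.trace_bound4[OF that] slim[of p] slim[of 2] slim[of 4] that
      by (intro LIMSEQ_le[of "\<lambda>k. \<bar>sH k p\<bar>" _ "\<lambda>k. sH k 4 * sqrt (sH k 2) ^ (p - 4)"] tendsto_intros) auto
  next
    fix \<psi> \<psi>' :: "real \<Rightarrow> real" and C :: real
    assume \<psi>: "\<And>x. (\<psi> has_real_derivative \<psi>' x) (at x)" "continuous_on UNIV \<psi>'" "\<And>x. \<bar>\<psi>' x\<bar> \<le> C"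
    have \<psi>'2: "(\<lambda>k. expectation (\<lambda>\<omega>. (\<psi>' (H k \<omega>))\<^sup>2)) \<longlonglongrightarrow> expectation (\<lambda>\<omega>. (\<psi>' (F \<omega>))\<^sup>2)"
      using power_mono[OF \<psi>(3) abs_ge_zero, of _ 2] by (intro bdd[where C = "C\<^sup>2"] continuous_intros \<psi>) auto
    have "(\<lambda>k. (expectation (\<lambda>\<omega>. \<psi>' (H k \<omega>)) - expectation (\<lambda>\<omega>. H k \<omega> * \<psi> (H k \<omega>)))\<^sup>2)
      \<longlonglongrightarrow> (expectation (\<lambda>\<omega>. \<psi>' (F \<omega>)) - expectation (\<lambda>\<omega>. F \<omega> * \<psi> (F \<omega>)))\<^sup>2"
      using \<psi> by (intro tendsto_intros bdd[where C = C] lip[of _ \<psi>' C]) auto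
    moreover have "(\<lambda>k. (8 * sH k 4 + (2 * sH k 2 - 1)\<^sup>2) * expectation (\<lambda>\<omega>. (\<psi>' (H k \<omega>))\<^sup>2))
        \<longlonglongrightarrow> (8 * s 4 + (2 * s 2 - 1)\<^sup>2) * expectation (\<lambda>\<omega>. (\<psi>' (F \<omega>))\<^sup>2)"
      by (intro tendsto_intros \<psi>'2 slim) auto
    ultimately show "(expectation (\<lambda>\<omega>. \<psi>' (F \<omega>)) - expectation (\<lambda>\<omega>. F \<omega> * \<psi> (F \<omega>)))\<^sup>2
        \<le> (8 * s 4 + (2 * s 2 - 1)\<^sup>2) * expectation (\<lambda>\<omega>. (\<psi>' (F \<omega>))\<^sup>2)"
      by (rule LIMSEQ_le) (use H.stein_bound[OF \<psi>] in blast)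
  next
    fix \<psi> \<psi>' \<psi>'' :: "real \<Rightarrow> real" and C' C :: real
    assume \<psi>: "\<And>x. (\<psi> has_real_derivative \<psi>' x) (at x)" "\<And>x. (\<psi>' has_real_derivative \<psi>'' x) (at x)"
        "continuous_on UNIV \<psi>''" "\<And>x. \<bar>\<psi>' x\<bar> \<le> C'" "\<And>x. \<bar>\<psi>'' x\<bar> \<le> C"
    have cont': "continuous_on UNIV \<psi>'" using \<psi>(2) by (meson DERIV_isCont continuous_at_imp_continuous_on)
    have "(\<lambda>k. (expectation (\<lambda>\<omega>. H k \<omega> * \<psi> (H k \<omega>)) - 2 * sH k 2 * expectation (\<lambda>\<omega>. \<psi>' (H k \<omega>))
         - 4 * sH k 3 * expectation (\<lambda>\<omega>. \<psi>'' (H k \<omega>)))\<^sup>2)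
      \<longlonglongrightarrow> (expectation (\<lambda>\<omega>. F \<omega> * \<psi> (F \<omega>)) - 2 * s 2 * expectation (\<lambda>\<omega>. \<psi>' (F \<omega>))
         - 4 * s 3 * expectation (\<lambda>\<omega>. \<psi>'' (F \<omega>)))\<^sup>2"
      using \<psi> cont' by (intro tendsto_intros bdd[where C = C' and g = \<psi>'] bdd[where C = C and g = \<psi>''] lip[of _ \<psi>' C'] slim) auto
    moreover have "(\<lambda>k. 32 * (sH k 4 * sqrt (sH k 4)) * C\<^sup>2) \<longlonglongrightarrow> 32 * (s 4 * sqrt (s 4)) * C\<^sup>2"
      by (intro tendsto_intros slim) auto
    ultimately show "(expectation (\<lambda>\<omega>. F \<omega> * \<psi> (F \<omega>)) - 2 * s 2 * expectation (\<lambda>\<omega>. \<psi>' (F \<omega>))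
         - 4 * s 3 * expectation (\<lambda>\<omega>. \<psi>'' (F \<omega>)))\<^sup>2 \<le> 32 * (s 4 * sqrt (s 4)) * C\<^sup>2"
      by (rule LIMSEQ_le) (use H.expansion_bound[OF \<psi>] in blast)
  next
    fix t :: real
    assume t: "2 * \<bar>t\<bar> * sqrt (s 2) < 1"
    define \<phi> where "\<phi> k = (CLINT \<omega>|M. iexp (t * H k \<omega>))" for k
    define \<phi>F where "\<phi>F = (CLINT \<omega>|M. iexp (t * F \<omega>))"
    have \<phi>: "\<phi> \<longlonglongrightarrow> \<phi>F" unfolding \<phi>_def \<phi>F_def
      by (rule bdd[where g = "\<lambda>x. iexp (t * x)" and C = 1]) (auto intro!: continuous_intros)
    have \<phi>1: "cmod (\<phi> k) \<le> 1" for k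
      unfolding \<phi>_def by (rule order_trans[OF integral_norm_bound]) (simp add: prob_space)
    have lhs: "(\<lambda>k. CLINT \<omega>|M. H k \<omega> * iexp (t * H k \<omega>)) \<longlonglongrightarrow> (CLINT \<omega>|M. F \<omega> * iexp (t * F \<omega>))"
    proof -
      \<comment> \<open>The limit lemma for Lipschitz factors is real-valued, so real and imaginary
        parts are separated.\<close>
      have *: "(CLINT \<omega>|M. Y \<omega> * iexp (t * Y \<omega>)) = Complex (expectation (\<lambda>\<omega>. Y \<omega> * cos (t * Y \<omega>))) (expectation (\<lambda>\<omega>. Y \<omega> * sin (t * Y \<omega>)))"
        if [measurable]: "Y \<in> borel_measurable M" and Y: "integrable M (\<lambda>\<omega>. (Y \<omega>)\<^sup>2)" for Y
      proof -
        have iY: "integrable M Y" by (rule square_integrable_imp_integrable[OF _ Y]) simp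
        have "integrable M (\<lambda>\<omega>. Y \<omega> * iexp (t * Y \<omega>))"
          by (rule Bochner_Integration.integrable_bound[OF iY]) (auto simp: norm_mult)
        moreover have "Re (iexp (t * x)) = cos (t * x)" "Im (iexp (t * x)) = sin (t * x)" for x :: real
          by (simp_all add: Re_exp Im_exp)
        ultimately show ?thesis
          by (intro complex_eqI) (simp_all del: of_real_mult flip: integral_Re integral_Im)
      qed
      have "(\<lambda>k. expectation (\<lambda>\<omega>. H k \<omega> * cos (t * H k \<omega>))) \<longlonglongrightarrow> expectation (\<lambda>\<omega>. F \<omega> * cos (t * F \<omega>))"
        by (rule lip[of _ "\<lambda>x. - sin (t * x) * t" "\<bar>t\<bar>"]) (auto intro!: derivative_eq_intros simp: abs_mult mult_left_le_one_le)
      moreover have "(\<lambda>k. expectation (\<lambda>\<omega>. H k \<omega> * sin (t * H k \<omega>))) \<longlonglongrightarrow> expectation (\<lambda>\<omega>. F \<omega> * sin (t * F \<omega>))"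
        by (rule lip[of _ "\<lambda>x. cos (t * x) * t" "\<bar>t\<bar>"]) (auto intro!: derivative_eq_intros simp: abs_mult mult_left_le_one_le)
      ultimately show ?thesis
        using *[OF H.measurable_F H.integrable_square] *[OF _ intF] by (simp add: tendsto_Complex)
    qed
    \<comment> \<open>A fixed ratio q below 1 and above the limiting one gives a single geometric
      majorant for all large k, as Tannery's theorem demands for exchanging limit and sum.\<close>
    obtain q where q: "2 * \<bar>t\<bar> * sqrt (s 2) < q" "q < 1" using dense t by blast
    have s20: "0 \<le> s 2" using s2 integral_nonneg_AE[of "\<lambda>\<omega>. (F \<omega>)\<^sup>2" M] by simp
    then have "0 \<le> 2 * \<bar>t\<bar> * sqrt (s 2)" by simp
    then have q0: "0 < q" using q(1) by linarith
    let ?u = "\<lambda>j k. (2 * \<i> * t) ^ Suc j * complex_of_real (sH k (j + 2)) * \<phi> k"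
    have "(\<lambda>k. 2 * \<bar>t\<bar> * sqrt (sH k 2)) \<longlonglongrightarrow> 2 * \<bar>t\<bar> * sqrt (s 2)"
      by (intro tendsto_intros slim) auto
    then have ev: "eventually (\<lambda>k. 2 * \<bar>t\<bar> * sqrt (sH k 2) < q) sequentially"
      using q(1) by (rule order_tendstoD)
    have s2b: "eventually (\<lambda>k. sqrt (sH k 2) < sqrt (s 2) + 1) sequentially"
      by (rule order_tendstoD(2)[OF tendsto_real_sqrt[OF slim[of 2]]]) auto
    have bound: "eventually (\<lambda>k. \<forall>j. norm (?u j k) \<le> q ^ Suc j * (sqrt (s 2) + 1)) sequentially"
      using ev s2b
    proof eventually_elim
      case (elim k)
      show ?case
      proof
        fix j
        have r0: "0 \<le> sqrt (sH k 2)" using H.trace2_nonneg by simp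
        have "norm (?u j k) \<le> (2 * \<bar>t\<bar>) ^ Suc j * \<bar>sH k (j + 2)\<bar> * 1"
          unfolding norm_mult norm_power using \<phi>1 by (intro mult_mono) (auto simp: norm_mult norm_power)
        also have "\<dots> \<le> (2 * \<bar>t\<bar>) ^ Suc j * sqrt (sH k 2) ^ (j + 2)"
          using H.trace_bound[of "j + 2" k] by (auto intro!: mult_left_mono)
        also have "\<dots> = (2 * \<bar>t\<bar> * sqrt (sH k 2)) ^ Suc j * sqrt (sH k 2)"
          by (simp add: power_mult_distrib)
        also have "\<dots> \<le> q ^ Suc j * (sqrt (s 2) + 1)"
          using elim r0 q0 by (intro mult_mono power_mono) auto
        finally show "norm (?u j k) \<le> q ^ Suc j * (sqrt (s 2) + 1)" .
      qed
    qed
    have tann: "summable (\<lambda>j. norm ((2 * \<i> * t) ^ Suc j * complex_of_real (s (j + 2)) * \<phi>F)) \<and>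
      (\<lambda>k. \<Sum>j. ?u j k) \<longlonglongrightarrow> (\<Sum>j. (2 * \<i> * t) ^ Suc j * complex_of_real (s (j + 2)) * \<phi>F)"
    proof (rule tannerys_theorem[THEN conjunct2])
      show "(\<lambda>k. ?u j k) \<longlonglongrightarrow> (2 * \<i> * t) ^ Suc j * complex_of_real (s (j + 2)) * \<phi>F" for j
        by (intro tendsto_intros slim \<phi>) auto
      show "\<forall>\<^sub>F (j, k) in at_top \<times>\<^sub>F sequentially. norm (?u j k) \<le> q ^ Suc j * (sqrt (s 2) + 1)"
        unfolding eventually_prod_filter
        by (rule exI[of _ "\<lambda>_. True"], rule exI, rule conjI, simp, rule conjI, rule bound) simp
      show "summable (\<lambda>j. q ^ Suc j * (sqrt (s 2) + 1))"
        using q0 q(2) by (intro summable_mult2 summable_ignore_initial_segment[of _ 1, simplified] summable_geometric) auto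
    qed simp
    have "eventually (\<lambda>k. (\<Sum>j. ?u j k) = (CLINT \<omega>|M. H k \<omega> * iexp (t * H k \<omega>))) sequentially"
      using ev
    proof eventually_elim
      case (elim k)
      then have "2 * \<bar>t\<bar> * sqrt (sH k 2) < 1" using q by simp
      from sums_unique[OF H.char_derivative_sums[OF this]] show ?case by (simp add: \<phi>_def)
    qed
    then have "(\<lambda>k. CLINT \<omega>|M. H k \<omega> * iexp (t * H k \<omega>)) \<longlonglongrightarrow> (\<Sum>j. (2 * \<i> * t) ^ Suc j * complex_of_real (s (j + 2)) * \<phi>F)"
      by (rule Lim_transform_eventually[OF conjunct2[OF tann]])
    from summable_sums[OF summable_norm_cancel[OF conjunct1[OF tann]], unfolded LIMSEQ_unique[OF this lhs]]
    show "(\<lambda>j. (2 * \<i> * t) ^ Suc j * complex_of_real (s (j + 2)) * (CLINT \<omega>|M. iexp (t * F \<omega>)))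
        sums (CLINT \<omega>|M. F \<omega> * iexp (t * F \<omega>))"
      unfolding \<phi>F_def .
  qed
  then show ?thesis by (rule that)
qed

end

subsection \<open>Double Wiener-Ito integrals\<close>

lemma (in prob_space) centered_gaussian_integrable_char:
  assumes "centered_gaussian M Y"
  shows "integrable M (\<lambda>\<omega>. (Y \<omega>)\<^sup>2)"
    and "(CLINT \<omega>|M. iexp (t * Y \<omega>)) = complex_of_real (exp (- (t\<^sup>2 * expectation (\<lambda>\<omega>. (Y \<omega>)\<^sup>2)) / 2))"
proof -
  have [measurable]: "Y \<in> borel_measurable M" using assms by (simp add: centered_gaussian_def)
  have "integrable M (\<lambda>\<omega>. (Y \<omega>)\<^sup>2) \<and> (CLINT \<omega>|M. iexp (t * Y \<omega>)) = complex_of_real (exp (- (t\<^sup>2 * expectation (\<lambda>\<omega>. (Y \<omega>)\<^sup>2)) / 2))"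
  proof (cases "distr M borel Y = return borel 0")
    case True
    have "AE y in distr M borel Y. y = 0" unfolding True by (subst AE_return) auto
    then have "AE \<omega> in M. Y \<omega> = 0" by (subst (asm) AE_distr_iff) auto
    then have Y0: "AE \<omega> in M. (Y \<omega>)\<^sup>2 = 0" "AE \<omega> in M. iexp (t * Y \<omega>) = 1" by (eventually_elim, simp)+
    have "expectation (\<lambda>\<omega>. (Y \<omega>)\<^sup>2) = expectation (\<lambda>\<omega>. 0)" by (intro integral_cong_AE Y0) auto
    moreover have "(CLINT \<omega>|M. iexp (t * Y \<omega>)) = (CLINT \<omega>|M. 1)" by (intro integral_cong_AE Y0) auto
    moreover have "integrable M (\<lambda>\<omega>. (Y \<omega>)\<^sup>2) \<longleftrightarrow> integrable M (\<lambda>\<omega>. 0::real)"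
      by (intro integrable_cong_AE Y0) auto
    ultimately show ?thesis by (simp add: prob_space)
  next
    case False
    then obtain \<sigma> where \<sigma>: "\<sigma> > 0" "distr M borel Y = density lborel (normal_density 0 \<sigma>)"
      using assms by (auto simp: centered_gaussian_def)
    have "distributed M lborel Y (normal_density 0 \<sigma>)"
      using \<sigma> by (simp add: distributed_def cong: distr_cong)
    then have "distributed M lborel (\<lambda>\<omega>. (Y \<omega> - 0) / \<sigma>) std_normal_density"
      using normal_standard_normal_convert[OF \<sigma>(1)] by blast
    then have Z: "distr M borel (\<lambda>\<omega>. Y \<omega> / \<sigma>) = std_normal"
      by (simp add: distributed_def cong: distr_cong)
    have "integrable std_normal (\<lambda>x. x\<^sup>2)" using integrable_std_normal_distribution_moment by simp
    then have iZ: "integrable M (\<lambda>\<omega>. (Y \<omega> / \<sigma>)\<^sup>2)"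
      unfolding Z[symmetric] by (subst (asm) integrable_distr_eq) auto
    have "(LINT x|std_normal. x\<^sup>2) = 1" using std_normal_distribution_even_moments(1)[of 1] by simp
    then have EZ: "expectation (\<lambda>\<omega>. (Y \<omega> / \<sigma>)\<^sup>2) = 1"
      unfolding Z[symmetric] by (subst (asm) integral_distr) auto
    have "(CLINT \<omega>|M. iexp (t * \<sigma> * (Y \<omega> / \<sigma>))) = Characteristic_Functions.char std_normal (t * \<sigma>)"
      unfolding Z[symmetric] char_def by (subst integral_distr) auto
    then have char: "(CLINT \<omega>|M. iexp (t * Y \<omega>)) = complex_of_real (exp (- (t * \<sigma>)\<^sup>2 / 2))"
      using \<sigma>(1) by (simp add: char_std_normal_distribution)
    have eq: "(Y \<omega>)\<^sup>2 = \<sigma>\<^sup>2 * (Y \<omega> / \<sigma>)\<^sup>2" for \<omega> using \<sigma>(1) by (simp add: power_divide)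
    have "integrable M (\<lambda>\<omega>. (Y \<omega>)\<^sup>2)" using iZ unfolding eq by (rule integrable_mult_right)
    moreover have "expectation (\<lambda>\<omega>. (Y \<omega>)\<^sup>2) = \<sigma>\<^sup>2" unfolding eq using EZ by (subst integral_mult_right_zero) simp
    ultimately show ?thesis using char by (simp add: power_mult_distrib)
  qed
  then show "integrable M (\<lambda>\<omega>. (Y \<omega>)\<^sup>2)"
    "(CLINT \<omega>|M. iexp (t * Y \<omega>)) = complex_of_real (exp (- (t\<^sup>2 * expectation (\<lambda>\<omega>. (Y \<omega>)\<^sup>2)) / 2))" by auto
qed

context isonormal_gaussian_process begin

lemma gaussian_sum: "finite S \<Longrightarrow> centered_gaussian M (\<lambda>\<omega>. \<Sum>h\<in>S. c h * X h \<omega>)"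
  using gaussian_family by (simp add: centered_gaussian_family_def)

lemma gaussian_X: "centered_gaussian M (X h)"
  using gaussian_sum[of "{h}" "\<lambda>_. 1"] by simp

lemma measurable_X [measurable]: "X h \<in> borel_measurable M"
  using gaussian_X[of h] by (simp add: centered_gaussian_def)

lemma integrable_X_square: "integrable M (\<lambda>\<omega>. (X h \<omega>)\<^sup>2)"
  by (rule centered_gaussian_integrable_char[OF gaussian_X])

lemma integrable_X_mult: "integrable M (\<lambda>\<omega>. X h \<omega> * X g \<omega>)"
  by (intro integrable_mult_of_squares integrable_X_square) auto

lemma covariance_sum:
  "expectation (\<lambda>\<omega>. X g \<omega> * (\<Sum>h\<in>S. c h * X h \<omega>)) = inner g (\<Sum>h\<in>S. c h *\<^sub>R h)"
  "integrable M (\<lambda>\<omega>. X g \<omega> * (\<Sum>h\<in>S. c h * X h \<omega>))"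
proof -
  have eq: "X g \<omega> * (\<Sum>h\<in>S. c h * X h \<omega>) = (\<Sum>h\<in>S. c h * (X g \<omega> * X h \<omega>))" for \<omega>
    by (simp add: sum_distrib_left mult_ac)
  show "expectation (\<lambda>\<omega>. X g \<omega> * (\<Sum>h\<in>S. c h * X h \<omega>)) = inner g (\<Sum>h\<in>S. c h *\<^sub>R h)"
    unfolding eq by (subst Bochner_Integration.integral_sum) (auto simp: integrable_X_mult covariance inner_sum_right)
  show "integrable M (\<lambda>\<omega>. X g \<omega> * (\<Sum>h\<in>S. c h * X h \<omega>))"
    unfolding eq by (auto intro!: Bochner_Integration.integrable_sum integrable_X_mult)
qed

lemma variance_sum:
  "expectation (\<lambda>\<omega>. (\<Sum>h\<in>S. c h * X h \<omega>)\<^sup>2) = inner (\<Sum>h\<in>S. c h *\<^sub>R h) (\<Sum>h\<in>S. c h *\<^sub>R h)"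
  "integrable M (\<lambda>\<omega>. (\<Sum>h\<in>S. c h * X h \<omega>)\<^sup>2)"
proof -
  have eq: "(\<Sum>h\<in>S. c h * X h \<omega>)\<^sup>2 = (\<Sum>g\<in>S. c g * (X g \<omega> * (\<Sum>h\<in>S. c h * X h \<omega>)))" for \<omega>
    by (simp add: power2_eq_square sum_distrib_right mult.assoc)
  show "expectation (\<lambda>\<omega>. (\<Sum>h\<in>S. c h * X h \<omega>)\<^sup>2) = inner (\<Sum>h\<in>S. c h *\<^sub>R h) (\<Sum>h\<in>S. c h *\<^sub>R h)"
    unfolding eq by (subst Bochner_Integration.integral_sum) (simp_all add: covariance_sum inner_sum_left)
  show "integrable M (\<lambda>\<omega>. (\<Sum>h\<in>S. c h * X h \<omega>)\<^sup>2)"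
    unfolding eq by (auto intro!: Bochner_Integration.integrable_sum covariance_sum)
qed

text \<open>Linearity of X is a consequence of the covariance alone: the second moment of the
  difference is |h|^2 - 2 |h|^2 + |h|^2 = 0. It holds only almost surely.\<close>

lemma X_linear_AE:
  assumes h: "h = (\<Sum>b\<in>B. a b *\<^sub>R b)"
  shows "AE \<omega> in M. X h \<omega> = (\<Sum>b\<in>B. a b * X b \<omega>)"
proof -
  let ?Y = "\<lambda>\<omega>. \<Sum>b\<in>B. a b * X b \<omega>"
  have eq: "(X h \<omega> - ?Y \<omega>)\<^sup>2 = (X h \<omega>)\<^sup>2 - 2 * (X h \<omega> * ?Y \<omega>) + (?Y \<omega>)\<^sup>2" for \<omega>
    by (simp add: power2_diff)
  have "expectation (\<lambda>\<omega>. (X h \<omega> - ?Y \<omega>)\<^sup>2) = inner h h - 2 * inner h h + inner h h"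
    unfolding eq using covariance[of h h]
    by (simp add: integrable_X_square covariance_sum variance_sum h[symmetric] power2_eq_square[of "X h _"] integrable_X_mult)
  then have "expectation (\<lambda>\<omega>. (X h \<omega> - ?Y \<omega>)\<^sup>2) = 0" by simp
  moreover have "integrable M (\<lambda>\<omega>. (X h \<omega> - ?Y \<omega>)\<^sup>2)"
    unfolding eq by (simp add: integrable_X_square covariance_sum variance_sum)
  ultimately have "AE \<omega> in M. (X h \<omega> - ?Y \<omega>)\<^sup>2 = 0"
    by (subst (asm) integral_nonneg_eq_0_iff_AE) auto
  then show ?thesis by eventually_elim simp
qed

text \<open>A linear combination is centred Gaussian, and orthonormality makes its variance the sum
  of the squared coefficients. This is the joint characteristic function from which independence was
  derived.\<close>

lemma std_normal_family_orthonormal: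
  assumes "finite B" "pairwise orthogonal B" "\<And>b. b \<in> B \<Longrightarrow> norm b = 1"
  shows "std_normal_family M X B"
proof
  show "finite B" by fact
  have char: "(CLINT x|M. iexp (\<Sum>b\<in>B. t b * X b x)) = complex_of_real (exp (- (\<Sum>b\<in>B. (t b)\<^sup>2) / 2))" for t
  proof -
    have "inner (\<Sum>h\<in>B. t h *\<^sub>R h) (\<Sum>h\<in>B. t h *\<^sub>R h) = (\<Sum>b\<in>B. \<Sum>c\<in>B. if c = b then (t b)\<^sup>2 else 0)"
      unfolding inner_sum_left inner_sum_right using assms
      by (intro sum.cong) (auto simp: pairwise_def orthogonal_def norm_eq_1 power2_eq_square)
    also have "\<dots> = (\<Sum>b\<in>B. (t b)\<^sup>2)" using assms by simp
    finally show ?thesis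
      using centered_gaussian_integrable_char(2)[OF gaussian_sum[OF assms(1), of t], of 1] variance_sum(1)[of t B] by simp
  qed
  show "indep_vars (\<lambda>_. borel) X B"
    by (rule std_normal_family_indep_vars[OF assms(1) _ char]) simp
  show "distr M borel (X b) = std_normal" if "b \<in> B" for b
  proof (rule Levy_uniqueness)
    show "real_distribution (distr M borel (X b))" by (rule real_distribution_distr) simp
    show "Characteristic_Functions.char (distr M borel (X b)) = Characteristic_Functions.char std_normal"
    proof
      fix t
      have "Characteristic_Functions.char (distr M borel (X b)) t = (CLINT \<omega>|M. iexp (t * X b \<omega>))"
        unfolding char_def by (subst integral_distr) auto
      also have "\<dots> = complex_of_real (exp (- (t\<^sup>2 * 1) / 2))"
        using centered_gaussian_integrable_char(2)[OF gaussian_X, of t b] covariance[of b b] assms(3)[OF that]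
        by (simp add: power2_eq_square norm_eq_1)
      finally show "Characteristic_Functions.char (distr M borel (X b)) t = Characteristic_Functions.char std_normal t"
        by (simp add: char_std_normal_distribution)
    qed
  qed (rule real_dist_normal_dist)
qed

text \<open>A is the self-adjoint finite-rank operator whose kernel is the tensor g. In an
  orthonormal eigenbasis of A the quadratic form in X loses its mixed terms, after each X h has been
  expanded almost surely in that basis.\<close>

lemma double_wiener_ito_simple_diagonal:
  assumes "double_wiener_ito_simple X T g G"
  obtains B l where "std_normal_family M X B" "AE \<omega> in M. G \<omega> = std_normal_family.chaos X B l \<omega>"
    "G \<in> borel_measurable M"
proof -
  obtain S c where S: "finite S" "\<And>h. h \<in> S \<Longrightarrow> norm h = 1" and G: "G = (\<lambda>\<omega>. \<Sum>h\<in>S. c h * ((X h \<omega>)\<^sup>2 - 1))"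
    using assms unfolding double_wiener_ito_simple_def by auto
  define A where "A x = (\<Sum>h\<in>S. (c h * inner h x) *\<^sub>R h)" for x
  have innerA: "inner (A x) y = (\<Sum>h\<in>S. c h * inner h x * inner h y)" for x y
    by (simp add: A_def inner_sum_left)
  obtain B l where B: "finite B" "span B = span S" "pairwise orthogonal B"
    "\<And>b. b \<in> B \<Longrightarrow> norm b = 1" "\<And>b. b \<in> B \<Longrightarrow> A b = l b *\<^sub>R b"
  proof (rule exists_orthonormal_eigenbasis[of S A])
    show "linear A" by (rule linearI)
      (simp_all add: A_def inner_add_right distrib_left scaleR_add_left sum.distrib scaleR_sum_right mult_ac)
    show "continuous_on UNIV A" unfolding A_def by (intro continuous_intros)
    show "inner (A x) y = inner x (A y)" for x y
      by (simp add: innerA inner_commute[of x "A y"] mult_ac)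
    show "A x \<in> span S" for x unfolding A_def by (intro span_sum span_scale span_base)
  qed (use S in auto)
  interpret B: std_normal_family M X B by (rule std_normal_family_orthonormal) (use B in auto)
  have exp: "h = (\<Sum>b\<in>B. inner b h *\<^sub>R b)" if "h \<in> S" for h
    using that B by (intro orthonormal_expansion) (auto intro: span_base)
  have diag: "(\<Sum>h\<in>S. c h * inner b h * inner b' h) = (if b' = b then l b else 0)" if "b \<in> B" "b' \<in> B" for b b'
  proof -
    have "(\<Sum>h\<in>S. c h * inner b h * inner b' h) = inner (A b) b'"
      unfolding innerA by (simp only: inner_commute)
    also have "\<dots> = l b * inner b b'" using B(5)[OF that(1)] by simp
    also have "inner b b' = (if b' = b then 1 else 0)"
      using B(3,4) that by (auto simp: pairwise_def orthogonal_def norm_eq_1)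
    finally show ?thesis by simp
  qed
  have "AE \<omega> in M. \<forall>h\<in>S. X h \<omega> = (\<Sum>b\<in>B. inner b h * X b \<omega>)"
    using S by (intro AE_finite_allI X_linear_AE exp)
  then have "AE \<omega> in M. G \<omega> = B.chaos l \<omega>"
  proof eventually_elim
    case (elim \<omega>)
    have "(\<Sum>h\<in>S. c h * (X h \<omega>)\<^sup>2) = (\<Sum>h\<in>S. c h * ((\<Sum>b\<in>B. inner b h * X b \<omega>) * (\<Sum>b'\<in>B. inner b' h * X b' \<omega>)))"
      using elim by (simp add: power2_eq_square)
    also have "\<dots> = (\<Sum>h\<in>S. \<Sum>b\<in>B. \<Sum>b'\<in>B. (c h * inner b h * inner b' h) * (X b \<omega> * X b' \<omega>))"
      by (simp add: sum_product sum_distrib_left mult_ac)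
    also have "\<dots> = (\<Sum>b\<in>B. \<Sum>b'\<in>B. (\<Sum>h\<in>S. c h * inner b h * inner b' h) * (X b \<omega> * X b' \<omega>))"
      by (subst sum.swap, intro sum.cong[OF refl], subst sum.swap) (simp add: sum_distrib_right)
    also have "\<dots> = (\<Sum>b\<in>B. l b * (X b \<omega>)\<^sup>2)"
      using diag B(1) by (intro sum.cong[OF refl]) (simp add: if_distrib[of "\<lambda>x. x * _"] power2_eq_square cong: if_cong)
    finally have 1: "(\<Sum>h\<in>S. c h * (X h \<omega>)\<^sup>2) = (\<Sum>b\<in>B. l b * (X b \<omega>)\<^sup>2)" .
    \<comment> \<open>The subtracted constants have to agree too: for unit vectors h the sum of the
      c h is the trace of A, which is also the sum of its eigenvalues.\<close>
    have "(\<Sum>h\<in>S. c h) = (\<Sum>h\<in>S. c h * (\<Sum>b\<in>B. inner b h * inner b h))"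
    proof (rule sum.cong[OF refl])
      fix h assume h: "h \<in> S"
      have "inner h h = (\<Sum>b\<in>B. inner b h * inner b h)"
        using arg_cong[where f = "\<lambda>x. inner x h", OF exp[OF h]] by (simp add: inner_sum_left)
      then show "c h = c h * (\<Sum>b\<in>B. inner b h * inner b h)" using S(2)[OF h] by (simp add: norm_eq_1)
    qed
    also have "\<dots> = (\<Sum>b\<in>B. \<Sum>h\<in>S. c h * inner b h * inner b h)"
      by (subst sum.swap) (simp add: sum_distrib_left mult.assoc)
    also have "\<dots> = (\<Sum>b\<in>B. l b)" using diag by (intro sum.cong[OF refl]) simp
    finally show ?case using 1 by (simp add: G B.chaos_def right_diff_distrib sum_subtractf)
  qed
  moreover have "G \<in> borel_measurable M" unfolding G by measurable
  ultimately show ?thesis using that B.std_normal_family_axioms by blast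
qed

text \<open>Bases and eigenvalues may change completely with k; the limit lemma only uses that the
  diagonal forms converge in L^2.\<close>

theorem double_wiener_ito_second_chaos_variable:
  assumes "double_wiener_ito M X T f F"
  obtains s where "second_chaos_variable M F s"
proof -
  have [measurable]: "F \<in> borel_measurable M" and intF: "integrable M (\<lambda>\<omega>. (F \<omega>)\<^sup>2)"
    using assms by (auto simp: double_wiener_ito_def)
  obtain g G where G: "\<And>k. double_wiener_ito_simple X T (g k) (G k)"
    and L2: "(\<lambda>k. expectation (\<lambda>\<omega>. (G k \<omega> - F \<omega>)\<^sup>2)) \<longlonglongrightarrow> 0"
    using assms by (auto simp: double_wiener_ito_def)
  have "\<exists>B l. std_normal_family M X B \<and> (AE \<omega> in M. G k \<omega> = std_normal_family.chaos X B l \<omega>) \<and> G k \<in> borel_measurable M" for k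
    using double_wiener_ito_simple_diagonal[OF G[of k]] by metis
  then obtain B l where B: "\<And>k. std_normal_family M X (B k)"
    and AE: "\<And>k. AE \<omega> in M. G k \<omega> = std_normal_family.chaos X (B k) (l k) \<omega>" and [measurable]: "\<And>k. G k \<in> borel_measurable M"
    by metis
  interpret B: std_normal_family M X "B k" for k by (rule B)
  show ?thesis
  proof (rule second_chaos_variable_limit)
    show "second_chaos_variable M (B.chaos k (l k)) (\<lambda>p. \<Sum>b\<in>B k. l k b ^ p)" for k
      by (rule B.second_chaos_variable_chaos)
    have "expectation (\<lambda>\<omega>. (B.chaos k (l k) \<omega> - F \<omega>)\<^sup>2) = expectation (\<lambda>\<omega>. (G k \<omega> - F \<omega>)\<^sup>2)" for k
      by (rule integral_cong_AE) (use AE[of k] in auto)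
    then show "(\<lambda>k. expectation (\<lambda>\<omega>. (B.chaos k (l k) \<omega> - F \<omega>)\<^sup>2)) \<longlonglongrightarrow> 0" using L2 by simp
  qed (use intF that in auto)
qed

end

subsection \<open>Characteristic function and cumulants\<close>

abbreviation law_char :: "'a measure \<Rightarrow> ('a \<Rightarrow> real) \<Rightarrow> real \<Rightarrow> complex" where
  "law_char M F \<equiv> Characteristic_Functions.char (distr M borel F)"

lemma (in prob_space) law_char_eq:
  "F \<in> borel_measurable M \<Longrightarrow> law_char M F t = (CLINT \<omega>|M. iexp (t * F \<omega>))"
  unfolding char_def by (subst integral_distr) auto

text \<open>The finite second moment makes the first-order Taylor remainder quadratic in y - t,
  which gives the derivative directly without an exchange of limit and integral.\<close>

lemma (in prob_space) has_vector_derivative_law_char: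
  assumes [measurable]: "F \<in> borel_measurable M" and int: "integrable M (\<lambda>\<omega>. (F \<omega>)\<^sup>2)"
  shows "(law_char M F has_vector_derivative \<i> * (CLINT \<omega>|M. F \<omega> * iexp (t * F \<omega>))) (at t)"
proof -
  let ?D = "\<i> * (CLINT \<omega>|M. F \<omega> * iexp (t * F \<omega>))"
  have iF: "integrable M F" by (rule square_integrable_imp_integrable[OF _ int]) simp
  have i1: "integrable M (\<lambda>\<omega>. iexp (u * F \<omega>))" for u by (rule integrable_iexp) simp_all
  have i2: "integrable M (\<lambda>\<omega>. F \<omega> * iexp (t * F \<omega>))"
    by (rule Bochner_Integration.integrable_bound[OF iF]) (auto simp: norm_mult)
  have bound: "norm (law_char M F y - law_char M F t - (y - t) *\<^sub>R ?D) \<le> \<bar>y - t\<bar>\<^sup>2 * expectation (\<lambda>\<omega>. (F \<omega>)\<^sup>2)" for y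
  proof -
    define c where "c = \<i> * complex_of_real (y - t)"
    have "law_char M F y - law_char M F t - (y - t) *\<^sub>R ?D =
        (CLINT \<omega>|M. iexp (y * F \<omega>)) - (CLINT \<omega>|M. iexp (t * F \<omega>)) - c * (CLINT \<omega>|M. F \<omega> * iexp (t * F \<omega>))"
      by (simp add: law_char_eq scaleR_conv_of_real c_def)
    also have "\<dots> = (CLINT \<omega>|M. iexp (y * F \<omega>) - iexp (t * F \<omega>) - c * (F \<omega> * iexp (t * F \<omega>)))"
      using i1[of y] i1[of t] i2 by simp
    also have "\<dots> = (CLINT \<omega>|M. iexp (y * F \<omega>) - iexp (t * F \<omega>) - \<i> * (y - t) * (F \<omega> * iexp (t * F \<omega>)))"
      by (simp add: c_def)
    also have "norm \<dots> \<le> expectation (\<lambda>\<omega>. \<bar>y - t\<bar>\<^sup>2 * (F \<omega>)\<^sup>2)"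
    proof (rule order_trans[OF integral_norm_bound integral_mono])
      fix \<omega>
      have "iexp (y * F \<omega>) = iexp (t * F \<omega>) * iexp ((y - t) * F \<omega>)"
        by (simp add: algebra_simps flip: exp_add)
      then have "iexp (y * F \<omega>) - iexp (t * F \<omega>) - \<i> * (y - t) * (F \<omega> * iexp (t * F \<omega>))
        = iexp (t * F \<omega>) * (iexp ((y - t) * F \<omega>) - (\<Sum>k\<le>1. (\<i> * ((y - t) * F \<omega>)) ^ k / fact k))"
        by (simp add: algebra_simps)
      then have "norm (iexp (y * F \<omega>) - iexp (t * F \<omega>) - \<i> * (y - t) * (F \<omega> * iexp (t * F \<omega>)))
        = norm (iexp ((y - t) * F \<omega>) - (\<Sum>k\<le>1. (\<i> * ((y - t) * F \<omega>)) ^ k / fact k))"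
        by (simp only: norm_mult norm_exp_i_times mult_1)
      also have "\<dots> \<le> \<bar>(y - t) * F \<omega>\<bar> ^ Suc 1 / fact (Suc 1)" by (rule iexp_approx1)
      also have "\<dots> = (\<bar>y - t\<bar>\<^sup>2 * (F \<omega>)\<^sup>2) / 2" by (simp add: power2_eq_square mult_ac)
      also have "\<dots> \<le> \<bar>y - t\<bar>\<^sup>2 * (F \<omega>)\<^sup>2" by simp
      finally show "norm (iexp (y * F \<omega>) - iexp (t * F \<omega>) - \<i> * (y - t) * (F \<omega> * iexp (t * F \<omega>))) \<le> \<bar>y - t\<bar>\<^sup>2 * (F \<omega>)\<^sup>2" .
    qed (use i1 i2 int in auto)
    finally show ?thesis by simp
  qed
  show ?thesis unfolding has_vector_derivative_def
  proof (rule has_derivativeI_sandwich[where e = 1 and H = "\<lambda>y. \<bar>y - t\<bar> * expectation (\<lambda>\<omega>. (F \<omega>)\<^sup>2)"])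
    show "norm (law_char M F y - law_char M F t - (y - t) *\<^sub>R ?D) / norm (y - t) \<le> \<bar>y - t\<bar> * expectation (\<lambda>\<omega>. (F \<omega>)\<^sup>2)"
      if "y \<noteq> t" for y
      using bound[of y] that by (simp add: divide_le_eq power2_eq_square mult_ac)
    show "((\<lambda>y. \<bar>y - t\<bar> * expectation (\<lambda>\<omega>. (F \<omega>)\<^sup>2)) \<longlongrightarrow> 0) (at t)"
      by (rule tendsto_eq_intros tendsto_intros | simp)+
  qed (auto intro: bounded_linear_scaleR_left)
qed

context second_chaos_variable begin

text \<open>The logarithm of the characteristic function as a formal power series, so that
  derivatives of every order at 0 are read off from its coefficients. Orders 0 and 1 vanish because
  F is centred.\<close>

definition log_char_fps :: "complex fps" where
  "log_char_fps = Abs_fps (\<lambda>p. if p < 2 then 0 else (2 * \<i>) ^ p * of_real (s p) / (2 * of_nat p))"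

lemma log_char_fps_nth: "fps_nth log_char_fps p = (if p < 2 then 0 else (2 * \<i>) ^ p * of_real (s p) / (2 * of_nat p))"
  by (simp add: log_char_fps_def)

lemma norm_log_char_fps_nth_eq:
  "2 \<le> p \<Longrightarrow> norm (fps_nth log_char_fps p * z ^ p) = (2 * norm z) ^ p * \<bar>s p\<bar> / (2 * real p)"
  by (simp add: log_char_fps_nth norm_mult norm_divide norm_power power_mult_distrib mult_ac)

lemma norm_log_char_fps_nth: "norm (fps_nth log_char_fps p * z ^ p) \<le> (2 * norm z * sqrt (s 2)) ^ p"
proof (cases "p < 2")
  case True then show ?thesis using trace2_nonneg by (simp add: log_char_fps_nth)
next
  case False
  then have "norm (fps_nth log_char_fps p * z ^ p) = (2 * norm z) ^ p * \<bar>s p\<bar> / (2 * real p)"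
    by (intro norm_log_char_fps_nth_eq) simp
  also have "\<dots> \<le> (2 * norm z) ^ p * \<bar>s p\<bar> / 1"
    using False by (intro divide_left_mono) auto
  also have "\<dots> \<le> (2 * norm z) ^ p * sqrt (s 2) ^ p"
    using trace_bound[of p] False by (auto intro!: mult_left_mono)
  finally show ?thesis by (simp add: power_mult_distrib)
qed

lemma log_char_fps_conv_radius:
  assumes "2 * r * sqrt (s 2) \<le> 1" "0 < r"
  shows "ereal r \<le> fps_conv_radius log_char_fps"
  unfolding fps_conv_radius_def
proof (rule conv_radius_geI_ex')
  fix u assume u: "0 < u" "ereal u < ereal r"
  have "2 * u * sqrt (s 2) < 1"
  proof (cases "s 2 = 0")
    case False
    then have "2 * u * sqrt (s 2) < 2 * r * sqrt (s 2)" using u trace2_nonneg by simp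
    then show ?thesis using assms by simp
  qed simp
  then have sum: "summable (\<lambda>p. (2 * norm (complex_of_real u) * sqrt (s 2)) ^ p)"
    using u trace2_nonneg by (intro summable_geometric) simp
  show "summable (\<lambda>n. fps_nth log_char_fps n * complex_of_real u ^ n)"
    by (rule summable_comparison_test'[OF sum]) (rule norm_log_char_fps_nth)
qed

text \<open>By \<open>char_derivative_sums\<close> the characteristic function phi satisfies phi' =
  phi K', where K is the power series. Hence phi exp(-K) is constant near 0, with value 1 at 0; in
  this form no logarithm has to be taken.\<close>

lemma law_char_eq_exp:
  assumes r: "2 * r * sqrt (s 2) \<le> 1" "0 < r" and t: "\<bar>t\<bar> < r"
  shows "law_char M F t = exp (eval_fps log_char_fps (of_real t))"
proof -
  let ?K = "eval_fps log_char_fps" and ?K' = "eval_fps (fps_deriv log_char_fps)"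
  have rad: "ereal (norm (complex_of_real u)) < fps_conv_radius log_char_fps" if "\<bar>u\<bar> < r" for u
    using log_char_fps_conv_radius[OF r] that by (simp add: less_le_trans[of "ereal \<bar>u\<bar>" "ereal r"])
  have K': "((\<lambda>u. ?K (of_real u)) has_vector_derivative ?K' (of_real u)) (at u)" if "\<bar>u\<bar> < r" for u :: real
    using has_vector_derivative_real_field[OF has_field_derivative_eval_fps[OF rad[OF that], of UNIV]] by simp
  have char': "\<i> * (CLINT \<omega>|M. F \<omega> * iexp (u * F \<omega>)) = law_char M F u * ?K' (of_real u)" if "\<bar>u\<bar> < r" for u
  proof -
    have "2 * \<bar>u\<bar> * sqrt (s 2) < 1"
    proof (cases "s 2 = 0")
      case False
      then have "2 * \<bar>u\<bar> * sqrt (s 2) < 2 * r * sqrt (s 2)" using that trace2_nonneg by simp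
      then show ?thesis using r by simp
    qed simp
    from char_derivative_sums[OF this]
    have "(\<lambda>j. \<i> * ((2 * \<i> * u) ^ Suc j * complex_of_real (s (j + 2)) * law_char M F u)) sums (\<i> * (CLINT \<omega>|M. F \<omega> * iexp (u * F \<omega>)))"
      unfolding law_char_eq[OF measurable_F] by (rule sums_mult)
    moreover have "(\<lambda>j. \<i> * ((2 * \<i> * u) ^ Suc j * complex_of_real (s (j + 2)) * law_char M F u)) sums (law_char M F u * ?K' (of_real u))"
    proof -
      have "(\<lambda>n. fps_nth (fps_deriv log_char_fps) n * of_real u ^ n) sums ?K' (of_real u)"
        using less_le_trans[OF rad[OF that] fps_conv_radius_deriv] by (rule sums_eval_fps)
      \<comment> \<open>The constant term of the derivative is zero, so dropping it aligns the
        series with the one that starts at s_2.\<close>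
      then have "(\<lambda>n. fps_nth (fps_deriv log_char_fps) (Suc n) * of_real u ^ Suc n) sums (?K' (of_real u) - 0)"
        by (subst sums_Suc_iff) (simp add: log_char_fps_nth)
      moreover have eq: "fps_nth (fps_deriv log_char_fps) (Suc n) * of_real u ^ Suc n = \<i> * ((2 * \<i> * u) ^ Suc n * complex_of_real (s (n + 2)))" for n
      proof -
        have "fps_nth (fps_deriv log_char_fps) (Suc n) = (2 * \<i>) ^ (n + 2) * of_real (s (n + 2)) / 2"
          by (simp add: log_char_fps_nth del: of_nat_Suc power_Suc)
        then show ?thesis by (simp add: power_mult_distrib)
      qed
      ultimately have "(\<lambda>n. \<i> * ((2 * \<i> * u) ^ Suc n * complex_of_real (s (n + 2)))) sums ?K' (of_real u)"
        by (simp only: eq diff_zero)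
      from sums_mult[OF this, of "law_char M F u"] show ?thesis by (simp add: mult_ac)
    qed
    ultimately show ?thesis by (rule sums_unique2)
  qed
  have "((\<lambda>u. law_char M F u * exp (- ?K (of_real u))) has_vector_derivative 0) (at u within {-r<..<r})" if "u \<in> {-r<..<r}" for u
  proof -
    have u: "\<bar>u\<bar> < r" using that by auto
    have e: "((\<lambda>u. exp (- ?K (of_real u))) has_vector_derivative - ?K' (of_real u) * exp (- ?K (of_real u))) (at u)"
      using field_vector_diff_chain_at[OF has_vector_derivative_minus[OF K'[OF u]] DERIV_exp] by (simp add: o_def)
    show ?thesis
      using has_vector_derivative_mult[OF has_vector_derivative_law_char[OF measurable_F integrable_square, of u] e]
      unfolding char'[OF u] by (simp add: algebra_simps has_vector_derivative_at_within)
  qed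
  then obtain c where c: "\<And>u. u \<in> {-r<..<r} \<Longrightarrow> law_char M F u * exp (- ?K (of_real u)) = c"
    using has_vector_derivative_zero_constant[of "{-r<..<r}" "\<lambda>u. law_char M F u * exp (- ?K (of_real u))"] by auto
  have "c = 1" using c[of 0] r(2) by (simp add: law_char_eq prob_space eval_fps_at_0 log_char_fps_nth)
  then have "law_char M F t * exp (- ?K (of_real t)) = 1" using c[of t] t \<open>c = 1\<close> by (simp add: abs_less_iff)
  then show ?thesis by (simp add: exp_minus field_simps)
qed

text \<open>Near 0 the power series has modulus below 1, so its imaginary part stays within the
  principal strip and \<open>Ln\<close> inverts \<open>exp\<close> on it. The iterated derivatives
  are then formal derivatives, and the powers of i cancel to leave 2^p.\<close>

lemma cumulant_eq_trace:
  assumes p: "2 \<le> p"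
  shows "cumulant M F p = fact p * 2 ^ (p - 1) * s p / real p"
proof -
  define r where "r = 1 / (2 * (sqrt (s 2) + 1))"
  have r0: "r > 0" using trace2_nonneg by (simp add: r_def add_nonneg_pos)
  have r: "2 * r * sqrt (s 2) \<le> 1" using trace2_nonneg by (simp add: r_def divide_simps add_nonneg_pos)
  let ?D = "\<lambda>u t. vector_derivative u (at t)"
  have "isCont (eval_fps log_char_fps) 0"
    using less_le_trans[of "ereal 0" "ereal r"] log_char_fps_conv_radius[OF r r0] r0
    by (intro DERIV_isCont[OF has_field_derivative_eval_fps]) simp
  then have "\<exists>d>0. \<forall>z. dist z 0 < d \<longrightarrow> dist (eval_fps log_char_fps z) (eval_fps log_char_fps 0) < 1"
    unfolding continuous_at_eps_delta by (metis zero_less_one)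
  then obtain d where d: "d > 0" "\<And>z. norm z < d \<Longrightarrow> norm (eval_fps log_char_fps z) < 1"
    by (auto simp: eval_fps_at_0 log_char_fps_nth)
  define e where "e = min d r"
  have e: "e > 0" using d r0 by (simp add: e_def)
  \<comment> \<open>Stated on an interval and not only at 0, because differentiating once more needs
    equality in a neighbourhood.\<close>
  have iter: "(?D ^^ n) (\<lambda>t. Ln (law_char M F t)) t = eval_fps ((fps_deriv ^^ n) log_char_fps) (of_real t)"
    if "\<bar>t\<bar> < e" for t n using that
  proof (induction n arbitrary: t)
    case 0
    have "norm (eval_fps log_char_fps (of_real t)) < 1" using d(2)[of "of_real t"] 0 by (simp add: e_def)
    then have "\<bar>Im (eval_fps log_char_fps (of_real t))\<bar> < 1" using abs_Im_le_cmod order_le_less_trans by blast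
    then have "Ln (exp (eval_fps log_char_fps (of_real t))) = eval_fps log_char_fps (of_real t)"
      using pi_gt3 by (intro Ln_exp) auto
    then show ?case using law_char_eq_exp[OF r r0, of t] 0 by (simp add: e_def)
  next
    case (Suc n)
    let ?G = "(fps_deriv ^^ n) log_char_fps"
    have "fps_conv_radius log_char_fps \<le> fps_conv_radius ?G"
      by (induction n) (auto intro: order_trans fps_conv_radius_deriv)
    then have "ereal (norm (complex_of_real t)) < fps_conv_radius ?G"
      using log_char_fps_conv_radius[OF r r0] Suc.prems by (simp add: e_def less_le_trans[of "ereal \<bar>t\<bar>" "ereal r"])
    then have "((\<lambda>u. eval_fps ?G (of_real u)) has_vector_derivative eval_fps (fps_deriv ?G) (of_real t)) (at t)"
      using has_vector_derivative_real_field[OF has_field_derivative_eval_fps[of "of_real t" ?G UNIV]] by simp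
    then have "((?D ^^ n) (\<lambda>t. Ln (law_char M F t)) has_vector_derivative eval_fps (fps_deriv ?G) (of_real t)) (at t)"
      by (rule has_vector_derivative_transform_within_open[of _ _ _ "{-e<..<e}"]) (use Suc in auto)
    then show ?case by (simp add: vector_derivative_at)
  qed
  have "(?D ^^ p) (\<lambda>t. Ln (law_char M F t)) 0 = fact p * ((2 * \<i>) ^ p * of_real (s p) / (2 * of_nat p))"
    using iter[of 0 p] e p by (simp add: eval_fps_at_0 fps_0th_higher_deriv log_char_fps_nth)
  then have "cumulant M F p = Re ((- \<i>) ^ p * (2 * \<i>) ^ p * (fact p * of_real (s p) / (2 * of_nat p)))"
    unfolding cumulant_def by (simp add: mult_ac)
  also have "(- \<i>) ^ p * (2 * \<i>) ^ p = complex_of_real (2 ^ p)"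
  proof -
    have "- \<i> * (2 * \<i>) = 2" by (simp add: complex_eq_iff)
    then show ?thesis unfolding power_mult_distrib[symmetric] by simp
  qed
  also have "complex_of_real (2 ^ p) * (fact p * of_real (s p) / (2 * of_nat p)) = of_real (2 ^ p * (fact p * s p / (2 * real p)))"
    by simp
  also have "(2::real) ^ p = 2 * 2 ^ (p - 1)" using p by (cases p) auto
  finally show ?thesis by (simp add: field_simps)
qed

lemma cumulants: "cumulant M F 2 = 2 * s 2" "cumulant M F 3 = 8 * s 3" "cumulant M F 4 = 48 * s 4"
  by (simp_all add: cumulant_eq_trace fact_numeral)

text \<open>The modulus is the exponential of the real part of the power series. Its quadratic term
  is - t^2 s_2, the cubic one is imaginary, the quartic one is 2 t^4 s_4, and the tail is at most
  8/5 t^4 s_4, which leaves 2/5. A positive s_4 thus lifts the modulus above the Gaussian value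
  exp(- t^2 s_2).\<close>

lemma norm_law_char_ge:
  assumes t: "0 < t" "4 * t * sqrt (s 2) \<le> 1"
  shows "exp (2 / 5 * t ^ 4 * s 4 - t\<^sup>2 * s 2) \<le> norm (law_char M F t)"
proof -
  let ?K = "eval_fps log_char_fps (of_real t)"
  have r: "2 * (2 * t) * sqrt (s 2) \<le> 1" "0 < 2 * t" "\<bar>t\<bar> < 2 * t" using t by auto
  have sums: "(\<lambda>n. fps_nth log_char_fps n * of_real t ^ n) sums ?K"
    using log_char_fps_conv_radius[OF r(1,2)] r(3) by (intro sums_eval_fps) (simp add: less_le_trans[of "ereal t" "ereal (2 * t)"])
  let ?a = "\<lambda>n. fps_nth log_char_fps n * of_real t ^ n"
  have tail: "(\<lambda>n. ?a (n + 5)) sums (?K - (\<Sum>n<5. ?a n))"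
    by (subst sums_iff_shift[of ?a 5 "?K - (\<Sum>n<5. ?a n)"]) (use sums in simp)
  define x where "x = 2 * t * sqrt (s 2)"
  have x: "0 \<le> x" "x \<le> 1 / 2" using t trace2_nonneg by (auto simp: x_def)
  \<comment> \<open>The factor 8/5 is 2^4 / 10, as 2 (n + 5) \<ge> 10. The trace bound at n + 5 has
    n + 1 factors \<open>sqrt (s 2)\<close>, so one x more than in \<open>x ^ n\<close> remains, and
    x \<le> 1/2 makes the geometric sum x / (1 - x) at most 1.\<close>
  have bound: "norm (?a (n + 5)) \<le> 8 / 5 * t ^ 4 * s 4 * (x * x ^ n)" for n
  proof -
    have "norm (?a (n + 5)) = (2 * t) ^ (n + 5) * \<bar>s (n + 5)\<bar> / (2 * real (n + 5))"
      using t(1) norm_log_char_fps_nth_eq[of "n + 5" "complex_of_real t"] by simp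
    also have "\<dots> \<le> (2 * t) ^ (n + 5) * \<bar>s (n + 5)\<bar> / 10"
      using t(1) by (intro divide_left_mono) auto
    also have "\<dots> \<le> (2 * t) ^ (n + 5) * (s 4 * sqrt (s 2) ^ (n + 5 - 4)) / 10"
      using trace_bound4[of "n + 5"] t(1) by (intro divide_right_mono mult_left_mono) auto
    also have "\<dots> = 8 / 5 * t ^ 4 * s 4 * (x * x ^ n)"
      by (simp add: x_def power_mult_distrib power_add power_numeral_reduce)
    finally show ?thesis .
  qed
  have geo: "(\<lambda>n. 8 / 5 * t ^ 4 * s 4 * (x * x ^ n)) sums (8 / 5 * t ^ 4 * s 4 * (x * (1 / (1 - x))))"
    using x by (intro sums_mult geometric_sums) auto
  have "norm (?K - (\<Sum>n<5. ?a n)) \<le> 8 / 5 * t ^ 4 * s 4 * (x * (1 / (1 - x)))"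
    using norm_suminf_le[OF bound sums_summable[OF geo]] sums_unique[OF tail] sums_unique[OF geo] by simp
  also have "\<dots> \<le> 8 / 5 * t ^ 4 * s 4 * 1"
    using x trace4_nonneg by (intro mult_left_mono) (auto simp: divide_le_eq)
  finally have "\<bar>Re (?K - (\<Sum>n<5. ?a n))\<bar> \<le> 8 / 5 * t ^ 4 * s 4 * 1"
    by (rule order_trans[OF abs_Re_le_cmod])
  moreover have "Re (\<Sum>n<5. ?a n) = 2 * t ^ 4 * s 4 - t\<^sup>2 * s 2"
    by (simp add: log_char_fps_nth eval_nat_numeral power_mult_distrib)
  moreover have "Re (?K - (\<Sum>n<5. ?a n)) = Re ?K - Re (\<Sum>n<5. ?a n)" by (rule minus_complex.sel)
  ultimately have "2 / 5 * t ^ 4 * s 4 - t\<^sup>2 * s 2 \<le> Re ?K" by linarith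
  then show ?thesis using law_char_eq_exp[OF r] by simp
qed

end

subsection \<open>Stein's equation\<close>

abbreviation std_normal_cdf :: "real \<Rightarrow> real" where "std_normal_cdf \<equiv> cdf std_normal"

interpretation std_normal: real_distribution std_normal by (rule real_dist_normal_dist)

section \<open>The standard normal distribution function and its Mills ratio\<close>

lemma std_normal_density_positive: "0 < std_normal_density x"
  by (simp add: normal_density_pos)

lemma isCont_std_normal_density: "isCont std_normal_density x"
  by (rule DERIV_isCont[OF DERIV_std_normal_density])

lemma DERIV_std_normal_cdf: "(std_normal_cdf has_real_derivative std_normal_density x) (at x)"
proof -
  let ?a = "x - 1" and ?b = "x + 1"
  have cont: "continuous_on A std_normal_density" for A
    by (intro continuous_at_imp_continuous_on ballI isCont_std_normal_density)
  have eq: "std_normal_cdf y = std_normal_cdf ?a + integral {?a..y} std_normal_density" if y: "?a < y" for y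
  proof -
    have "std_normal_cdf y - std_normal_cdf ?a = measure std_normal {?a<..y}"
      using y by (rule std_normal.cdf_diff_eq)
    also have "\<dots> = (LINT t:{?a<..y}|lborel. std_normal_density t)"
      using integral_std_normal[of "indicat_real {?a<..y}"]
      by (simp add: set_lebesgue_integral_def mult.commute)
    also have "\<dots> = (LBINT t=?a..y. std_normal_density t)"
      using y by (simp add: interval_integral_Ioc)
    also have "\<dots> = integral {?a..y} std_normal_density"
      using y cont by (intro interval_integral_eq_integral borel_integrable_atLeastAtMost') auto
    finally show ?thesis by simp
  qed
  have "((\<lambda>y. integral {?a..y} std_normal_density) has_real_derivative std_normal_density x) (at x within {?a..?b})"
    by (rule integral_has_real_derivative) (use cont in auto)
  then have "((\<lambda>y. std_normal_cdf ?a + integral {?a..y} std_normal_density) has_real_derivative std_normal_density x) (at x)"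
    by (subst (asm) at_within_interior) (auto intro!: derivative_eq_intros)
  then show ?thesis
    by (rule has_field_derivative_transform_within_open[where S = "{?a<..}"]) (use eq in auto)
qed

lemma isCont_std_normal_cdf: "isCont std_normal_cdf x"
  by (rule DERIV_isCont[OF DERIV_std_normal_cdf])

lemma std_normal_singleton: "measure std_normal {x} = 0"
  using isCont_std_normal_cdf[of x] by (simp add: std_normal.isCont_cdf)

text \<open>Tail inequalities, such as those for the Mills ratio, are obtained by comparing
  derivatives, with the limit 0 at minus infinity as initial value.\<close>

lemma nonneg_of_deriv_nonneg_tendsto_0_at_bot:
  fixes D D' :: "real \<Rightarrow> real"
  assumes "\<And>y. y \<le> x \<Longrightarrow> (D has_real_derivative D' y) (at y)" "\<And>y. y \<le> x \<Longrightarrow> 0 \<le> D' y" "(D \<longlongrightarrow> 0) at_bot"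
  shows "0 \<le> D x"
proof (rule tendsto_upperbound[OF assms(3)])
  have "D y \<le> D x" if "y \<le> x" for y
    by (rule DERIV_nonneg_imp_nondecreasing[OF that]) (use assms in force)
  then show "\<forall>\<^sub>F y in at_bot. D y \<le> D x" unfolding eventually_at_bot_linorder by blast
qed simp

lemma std_normal_density_at_bot: "(std_normal_density \<longlongrightarrow> 0) at_bot"
  unfolding std_normal_density_def by real_asymp

lemma std_normal_cdf_le_density: "x \<le> -1 \<Longrightarrow> std_normal_cdf x \<le> std_normal_density x"
proof -
  assume x: "x \<le> -1"
  have "0 \<le> std_normal_density x - std_normal_cdf x"
  proof (rule nonneg_of_deriv_nonneg_tendsto_0_at_bot[where D = "\<lambda>y. std_normal_density y - std_normal_cdf y" and D' = "\<lambda>y. (- y - 1) * std_normal_density y"])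
    show "((\<lambda>y. std_normal_density y - std_normal_cdf y) has_real_derivative (- y - 1) * std_normal_density y) (at y)" for y
      by (auto intro!: derivative_eq_intros DERIV_std_normal_cdf simp: algebra_simps)
    show "((\<lambda>y. std_normal_density y - std_normal_cdf y) \<longlongrightarrow> 0) at_bot"
      using tendsto_diff[OF std_normal_density_at_bot std_normal.cdf_lim_at_bot] by simp
  qed (use x in \<open>auto intro!: mult_nonneg_nonneg\<close>)
  then show ?thesis by simp
qed

lemma tendsto_power_mult_std_normal_cdf_at_bot: "((\<lambda>x. x ^ k * std_normal_cdf x) \<longlongrightarrow> 0) at_bot"
proof (rule Lim_null_comparison)
  show "\<forall>\<^sub>F x in at_bot. norm (x ^ k * std_normal_cdf x) \<le> \<bar>x\<bar> ^ k * std_normal_density x"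
    using eventually_le_at_bot[of "-1"]
  proof eventually_elim
    case (elim x)
    then show ?case using std_normal_cdf_le_density[of x] std_normal.cdf_nonneg[of x]
      by (auto simp: abs_mult power_abs intro!: mult_left_mono)
  qed
  show "((\<lambda>x. \<bar>x\<bar> ^ k * std_normal_density x) \<longlongrightarrow> 0) at_bot"
    unfolding std_normal_density_def by real_asymp
qed

lemma Mills_ratio_lower: "0 \<le> std_normal_density x + x * std_normal_cdf x"
proof (rule nonneg_of_deriv_nonneg_tendsto_0_at_bot[where D = "\<lambda>y. std_normal_density y + y * std_normal_cdf y" and D' = std_normal_cdf])
  show "((\<lambda>y. std_normal_density y + y * std_normal_cdf y) has_real_derivative std_normal_cdf y) (at y)" for y
    by (auto intro!: derivative_eq_intros DERIV_std_normal_cdf simp: algebra_simps)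
  show "((\<lambda>y. std_normal_density y + y * std_normal_cdf y) \<longlongrightarrow> 0) at_bot"
    using tendsto_add[OF std_normal_density_at_bot tendsto_power_mult_std_normal_cdf_at_bot[of 1]] by simp
qed (rule std_normal.cdf_nonneg)

lemma std_normal_density_minus: "std_normal_density (- x) = std_normal_density x"
  by (simp add: std_normal_density_def)

lemma std_normal_cdf_minus: "std_normal_cdf (- x) = 1 - std_normal_cdf x"
proof -
  let ?S = "\<lambda>y. std_normal_cdf y + std_normal_cdf (- y)"
  have "(?S has_real_derivative 0) (at y)" for y
    by (auto intro!: derivative_eq_intros DERIV_chain2[OF DERIV_std_normal_cdf] DERIV_std_normal_cdf simp: std_normal_density_minus)
  then have const: "?S y = ?S x" for y
    by (intro DERIV_isconst_all) auto
  have "((\<lambda>y. std_normal_cdf (- y)) \<longlongrightarrow> 0) at_top"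
    using std_normal.cdf_lim_at_bot by (simp add: filterlim_at_bot_mirror)
  then have "(?S \<longlongrightarrow> 1 + 0) at_top"
    by (intro tendsto_add std_normal.cdf_lim_at_top_prob)
  moreover have "?S = (\<lambda>y. ?S x)" using const by (rule ext)
  ultimately have "((\<lambda>y. ?S x) \<longlongrightarrow> 1) (at_top :: real filter)" by simp
  then have "?S x = 1" by (simp add: tendsto_const_iff)
  then show ?thesis by simp
qed

lemma Mills_ratio_upper: "x * (1 - std_normal_cdf x) \<le> std_normal_density x"
  using Mills_ratio_lower[of "- x"] by (simp add: std_normal_cdf_minus std_normal_density_minus)

lemma tendsto_power_mult_std_normal_cdf_at_top: "((\<lambda>x. x ^ k * (1 - std_normal_cdf x)) \<longlongrightarrow> 0) at_top"
proof -
  have "((\<lambda>x. (- 1) ^ k * (x ^ k * std_normal_cdf x)) \<longlongrightarrow> (- 1) ^ k * 0) at_bot"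
    by (intro tendsto_intros tendsto_power_mult_std_normal_cdf_at_bot)
  then have "((\<lambda>x. (- 1) ^ k * ((- x) ^ k * std_normal_cdf (- x))) \<longlongrightarrow> 0) at_top"
    unfolding filterlim_at_bot_mirror by simp
  moreover have "(- 1) ^ k * ((- x) ^ k * std_normal_cdf (- x)) = x ^ k * (1 - std_normal_cdf x)" for x
    by (simp add: std_normal_cdf_minus power_minus[of x k] mult.assoc[symmetric])
  ultimately show ?thesis by simp
qed

text \<open>The bounded solution of Stein's equation \<open>\<psi>' x - x * \<psi> x = indicator {..z} x - \<Phi> z\<close>, and its
  derivative, taken from the left at the kink \<open>z\<close>.\<close>

definition stein_solution :: "real \<Rightarrow> real \<Rightarrow> real" where
  "stein_solution z x = (std_normal_cdf (min x z) - std_normal_cdf x * std_normal_cdf z) / std_normal_density x"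

definition stein_derivative :: "real \<Rightarrow> real \<Rightarrow> real" where
  "stein_derivative z x = x * stein_solution z x + indicator {..z} x - std_normal_cdf z"

text \<open>For x \<le> z the derivative factors as (1 - \<Phi>(z)) (1 + m) with m \<ge> -1. If x
  \<le> 0, both factors lie in [0,1]; if x > 0, then 1 - \<Phi>(z) is replaced by the larger 1 -
  \<Phi>(x), and m (1 - \<Phi>(x)) = \<Phi>(x) n with n \<le> 1 finishes. The case x > z is the
  mirror image.\<close>

lemma abs_stein_derivative_le_1: "\<bar>stein_derivative z x\<bar> \<le> 1"
proof -
  note p = std_normal_density_positive[of x]
  let ?P = "std_normal_cdf x" and ?Z = "std_normal_cdf z" and ?f = "std_normal_density x"
  have P: "0 \<le> ?P" "?P \<le> 1" "0 \<le> ?Z" "?Z \<le> 1"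
    using std_normal.cdf_nonneg std_normal.cdf_bounded_prob by auto
  define m where "m = x * ?P / ?f"
  define n where "n = x * (1 - ?P) / ?f"
  have m: "- 1 \<le> m" using Mills_ratio_lower[of x] p by (simp add: m_def field_simps)
  have n: "n \<le> 1" using Mills_ratio_upper[of x] p by (simp add: n_def field_simps)
  have mn: "m * (1 - ?P) = ?P * n" by (simp add: m_def n_def)
  show ?thesis
  proof (cases "x \<le> z")
    case True
    then have eq: "stein_derivative z x = (1 - ?Z) * (1 + m)"
      using p by (simp add: stein_derivative_def stein_solution_def m_def field_simps)
    have "(1 - ?Z) * (1 + m) \<le> 1"
    proof (cases "x \<le> 0")
      case True
      then have "m \<le> 0" using p P by (simp add: m_def divide_le_0_iff mult_nonpos_nonneg)
      then show ?thesis using P m mult_mono[of "1 - ?Z" 1 "1 + m" 1] by simp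
    next
      case False
      have "(1 - ?Z) * (1 + m) \<le> (1 - ?P) * (1 + m)"
        using True m by (intro mult_right_mono) (auto intro: std_normal.cdf_nondecreasing)
      also have "\<dots> = (1 - ?P) + ?P * n" using mn by (simp add: algebra_simps)
      also have "\<dots> \<le> (1 - ?P) + ?P * 1" using n P by (intro add_mono mult_left_mono) auto
      finally show ?thesis by simp
    qed
    moreover have "0 \<le> (1 - ?Z) * (1 + m)" using P m by simp
    ultimately show ?thesis unfolding eq by simp
  next
    case False
    then have eq: "stein_derivative z x = - (?Z * (1 - n))"
      using p by (simp add: stein_derivative_def stein_solution_def n_def field_simps)
    have "?Z * (1 - n) \<le> 1"
    proof (cases "0 \<le> x")
      case True
      then have "0 \<le> n" using p P by (simp add: n_def)
      then show ?thesis using P n mult_mono[of ?Z 1 "1 - n" 1] by simp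
    next
      case x: False
      have "?Z * (1 - n) \<le> ?P * (1 - n)"
        using False n by (intro mult_right_mono) (auto intro: std_normal.cdf_nondecreasing)
      also have "\<dots> = ?P + (1 - ?P) * (- m)" using mn by (simp add: algebra_simps)
      also have "\<dots> \<le> ?P + (1 - ?P) * 1" using m P by (intro add_mono mult_left_mono) auto
      finally show ?thesis by simp
    qed
    moreover have "0 \<le> ?Z * (1 - n)" using P n by simp
    ultimately show ?thesis unfolding eq by simp
  qed
qed

lemma DERIV_If_le:
  fixes f g f' g' :: "real \<Rightarrow> real"
  assumes "\<And>x. (f has_real_derivative f' x) (at x)" "\<And>x. (g has_real_derivative g' x) (at x)"
    and "f z = g z" "f' z = g' z"
  shows "((\<lambda>x. if x \<le> z then f x else g x) has_real_derivative (if x \<le> z then f' x else g' x)) (at x)"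
proof -
  have cl: "closure {..z} \<inter> closure {z<..} = {z}" by auto
  have "((\<lambda>x. if x \<in> {..z} then f x else g x) has_vector_derivative (if x \<in> {..z} then f' x else g' x)) (at x within UNIV)"
    by (rule has_vector_derivative_If_within_closures[where T = "{z<..}"])
      (use assms in \<open>auto simp: has_real_derivative_iff_has_vector_derivative has_vector_derivative_at_within\<close>)
  then show ?thesis by (simp add: has_real_derivative_iff_has_vector_derivative)
qed

text \<open>The derivative of the Stein solution drops by 1 at z, and so does that of
  \<open>min x z\<close>. Subtracting it leaves a continuously differentiable function, so only the
  explicit function min has to be smoothed later.\<close>

lemma DERIV_stein_solution_minus_min:
  "((\<lambda>x. stein_solution z x - min x z) has_real_derivative x * stein_solution z x - std_normal_cdf z) (at x)"
proof -
  let ?Z = "std_normal_cdf z"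
  let ?l = "\<lambda>x. std_normal_cdf x * (1 - ?Z) / std_normal_density x - x"
  let ?r = "\<lambda>x. ?Z * (1 - std_normal_cdf x) / std_normal_density x - z"
  let ?l' = "\<lambda>x. x * (std_normal_cdf x * (1 - ?Z) / std_normal_density x) - ?Z"
  let ?r' = "\<lambda>x. x * (?Z * (1 - std_normal_cdf x) / std_normal_density x) - ?Z"
  have nz: "std_normal_density x \<noteq> 0" for x using std_normal_density_positive[of x] by simp
  have "(?l has_real_derivative ?l' x) (at x)" "(?r has_real_derivative ?r' x) (at x)" for x
    by (auto intro!: derivative_eq_intros DERIV_std_normal_cdf nz simp: field_simps nz)
  then have "((\<lambda>x. if x \<le> z then ?l x else ?r x) has_real_derivative (if x \<le> z then ?l' x else ?r' x)) (at x)"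
    by (rule DERIV_If_le) (simp_all add: mult_ac)
  moreover have "(\<lambda>x. if x \<le> z then ?l x else ?r x) = (\<lambda>x. stein_solution z x - min x z)"
    by (auto simp: stein_solution_def algebra_simps)
  moreover have "(if x \<le> z then ?l' x else ?r' x) = x * stein_solution z x - ?Z"
    by (auto simp: stein_solution_def algebra_simps)
  ultimately show ?thesis by simp
qed

lemma isCont_stein_solution: "isCont (stein_solution z) x"
proof -
  have "isCont (\<lambda>x. (stein_solution z x - min x z) + min x z) x"
    by (intro continuous_intros DERIV_isCont[OF DERIV_stein_solution_minus_min])
  then show ?thesis by simp
qed

lemma isCont_stein_derivative: "x \<noteq> z \<Longrightarrow> isCont (stein_derivative z) x"
  unfolding stein_derivative_def [abs_def]
  by (intro continuous_intros isCont_stein_solution) (auto simp: isCont_indicator)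

lemma borel_measurable_stein [measurable]:
  "stein_solution z \<in> borel_measurable borel" "stein_derivative z \<in> borel_measurable borel"
proof -
  show [measurable]: "stein_solution z \<in> borel_measurable borel"
    by (intro borel_measurable_continuous_onI continuous_at_imp_continuous_on ballI isCont_stein_solution)
  show "stein_derivative z \<in> borel_measurable borel"
    unfolding stein_derivative_def [abs_def] by measurable
qed

text \<open>On each side of z the integrand has an elementary antiderivative in terms of the density
  and distribution function; integrating x^2 produces the 1/3. At z the cubic terms of both sides
  cancel, and the weights 1 - \<Phi>(z) and \<Phi>(z) of the remaining terms add up to 1.\<close>

lemma expectation_mult_stein_derivative:
  "(LINT x|std_normal. x * stein_derivative z x) = (z\<^sup>2 - 1) * std_normal_density z / 3"
proof -
  let ?Z = "std_normal_cdf z" and ?f = std_normal_density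
  let ?g = "\<lambda>x. ?f x * (x * stein_derivative z x)"
  let ?L = "\<lambda>x. x ^ 3 * (std_normal_cdf x * (1 - ?Z)) / 3 + (x\<^sup>2 - 1) * ?f x * (1 - ?Z) / 3"
  let ?R = "\<lambda>x. x ^ 3 * (?Z * (1 - std_normal_cdf x)) / 3 - (x\<^sup>2 - 1) * ?f x * ?Z / 3"
  have nz: "?f x \<noteq> 0" for x using std_normal_density_positive[of x] by simp
  have int: "integrable lborel ?g"
  proof (subst integrable_std_normal_iff[symmetric])
    show "integrable std_normal (\<lambda>x. x * stein_derivative z x)"
    proof (rule Bochner_Integration.integrable_bound)
      show "integrable std_normal (\<lambda>x. x)" using integrable_std_normal_distribution_moment[of 1] by simp
      show "AE x in std_normal. norm (x * stein_derivative z x) \<le> norm x"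
        using abs_stein_derivative_le_1[of z] by (intro AE_I2) (simp add: abs_mult mult_left_le)
    qed simp
  qed simp
  have si: "set_integrable lborel A ?g" if "A \<in> sets borel" for A
    unfolding set_integrable_def using integrable_mult_indicator[OF _ int, of A] that by simp
  have contg: "isCont ?g x" if "x \<noteq> z" for x
    using that by (intro continuous_intros isCont_std_normal_density isCont_stein_derivative)
  have dL: "(?L has_real_derivative ?f x * (x * (x * (std_normal_cdf x * (1 - ?Z) / ?f x) + 1 - ?Z))) (at x)" for x
    using nz[of x] by (auto intro!: derivative_eq_intros DERIV_std_normal_cdf simp: field_simps power2_eq_square power3_eq_cube)
  have dR: "(?R has_real_derivative ?f x * (x * (x * (?Z * (1 - std_normal_cdf x) / ?f x) - ?Z))) (at x)" for x
    using nz[of x] by (auto intro!: derivative_eq_intros DERIV_std_normal_cdf simp: field_simps power2_eq_square power3_eq_cube)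
  have fz: "((\<lambda>x. (x\<^sup>2 - 1) * ?f x) \<longlongrightarrow> 0) at_bot" "((\<lambda>x. (x\<^sup>2 - 1) * ?f x) \<longlongrightarrow> 0) at_top"
    unfolding std_normal_density_def by real_asymp+
  have "(LBINT x=-\<infinity>..z. ?g x) = ?L z - 0"
  proof (rule interval_integral_FTC_integrable[where F = ?L])
    show "(?L has_vector_derivative ?g x) (at x)" if "ereal x < ereal z" for x
      using dL[of x] that unfolding has_real_derivative_iff_has_vector_derivative[symmetric]
      by (simp add: stein_derivative_def stein_solution_def algebra_simps)
    have "(?L \<longlongrightarrow> 0) at_bot"
      using tendsto_add[OF tendsto_divide[OF tendsto_mult_right[OF tendsto_power_mult_std_normal_cdf_at_bot[of 3], of "1 - ?Z"] tendsto_const[of 3]]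
        tendsto_divide[OF tendsto_mult_right[OF fz(1), of "1 - ?Z"] tendsto_const[of 3]]] by (simp add: mult_ac)
    then show "((?L \<circ> real_of_ereal) \<longlongrightarrow> 0) (at_right (-\<infinity>))" by (simp add: ereal_tendsto_simps)
    have "isCont ?L z" by (rule DERIV_isCont[OF dL])
    then show "((?L \<circ> real_of_ereal) \<longlongrightarrow> ?L z) (at_left (ereal z))"
      by (simp add: ereal_tendsto_simps isCont_def filterlim_at_split)
  qed (use contg si in auto)
  moreover have "(LBINT x=z..\<infinity>. ?g x) = 0 - ?R z"
  proof (rule interval_integral_FTC_integrable[where F = ?R])
    show "(?R has_vector_derivative ?g x) (at x)" if "ereal z < ereal x" for x
      using dR[of x] that unfolding has_real_derivative_iff_has_vector_derivative[symmetric]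
      by (simp add: stein_derivative_def stein_solution_def algebra_simps)
    have "(?R \<longlongrightarrow> 0) at_top"
      using tendsto_diff[OF tendsto_divide[OF tendsto_mult_right[OF tendsto_power_mult_std_normal_cdf_at_top[of 3], of "?Z"] tendsto_const[of 3]]
        tendsto_divide[OF tendsto_mult_right[OF fz(2), of "?Z"] tendsto_const[of 3]]] by (simp add: mult_ac)
    then show "((?R \<circ> real_of_ereal) \<longlongrightarrow> 0) (at_left \<infinity>)" by (simp add: ereal_tendsto_simps)
    have "isCont ?R z" by (rule DERIV_isCont[OF dR])
    then show "((?R \<circ> real_of_ereal) \<longlongrightarrow> ?R z) (at_right (ereal z))"
      by (simp add: ereal_tendsto_simps isCont_def filterlim_at_split)
  qed (use contg si in auto)
  moreover have "(LBINT x=-\<infinity>..z. ?g x) + (LBINT x=z..\<infinity>. ?g x) = (LBINT x=-\<infinity>..\<infinity>. ?g x)"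
    by (rule interval_integral_sum) (simp add: interval_lebesgue_integrable_def si)
  moreover have "(LBINT x=-\<infinity>..\<infinity>. ?g x) = (LBINT x. ?g x)"
    by (simp add: interval_lebesgue_integral_def set_lebesgue_integral_def)
  ultimately have "(LBINT x. ?g x) = ?L z - ?R z" by simp
  also have "\<dots> = (z\<^sup>2 - 1) * ?f z / 3" by (simp add: field_simps)
  finally show ?thesis by (subst integral_std_normal) simp_all
qed

text \<open>Continuously differentiable approximations of \<open>stein_solution z\<close>: only the jump of the
  derivative at \<open>z\<close> is smoothed.\<close>

definition stein_approx :: "real \<Rightarrow> nat \<Rightarrow> real \<Rightarrow> real" where
  "stein_approx z k x = stein_solution z x - min x z
     + (if x \<le> z then x else z + (1 - exp (- real (Suc k) * (x - z))) / real (Suc k))"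

definition stein_approx_derivative :: "real \<Rightarrow> nat \<Rightarrow> real \<Rightarrow> real" where
  "stein_approx_derivative z k x = x * stein_solution z x - std_normal_cdf z
     + (if x \<le> z then 1 else exp (- real (Suc k) * (x - z)))"

text \<open>The exponential branch meets the identity at z in value and slope, so the two pieces
  glue to a continuously differentiable function.\<close>

lemma DERIV_stein_approx: "(stein_approx z k has_real_derivative stein_approx_derivative z k x) (at x)"
proof -
  have d: "((\<lambda>x. z + (1 - exp (- c * (x - z))) / c) has_real_derivative exp (- c * (x - z))) (at x)" if "c \<noteq> 0" for c x
    using that by (auto intro!: derivative_eq_intros)
  then show ?thesis
    unfolding stein_approx_def [abs_def] stein_approx_derivative_def
    by (intro DERIV_add DERIV_stein_solution_minus_min DERIV_If_le d DERIV_ident) simp_all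
qed

lemma isCont_stein_approx_derivative: "isCont (stein_approx_derivative z k) x"
proof -
  have "continuous_on UNIV (\<lambda>x. if x \<in> {..z} then 1 else exp (- real (Suc k) * (x - z)))"
    by (rule continuous_on_subset[OF continuous_on_If[where s = "{..z}" and t = "{z..}"]])
      (auto intro!: continuous_intros)
  then have "isCont (\<lambda>x. if x \<in> {..z} then 1 else exp (- real (Suc k) * (x - z))) x"
    by (simp add: continuous_on_eq_continuous_at)
  then show ?thesis unfolding stein_approx_derivative_def [abs_def]
    by (intro continuous_intros isCont_stein_solution) simp
qed

lemma abs_stein_approx_derivative_le_3: "\<bar>stein_approx_derivative z k x\<bar> \<le> 3"
proof -
  have "\<bar>x * stein_solution z x - std_normal_cdf z\<bar> \<le> 2"
    using abs_stein_derivative_le_1[of z x] indicator_pos_le[where 'a = real, of "{..z}" x] indicator_le_1[where 'a = real, of "{..z}" x]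
    unfolding stein_derivative_def by linarith
  moreover have "\<bar>if x \<le> z then 1 else exp (- real (Suc k) * (x - z))\<bar> \<le> 1"
    using mult_nonpos_nonneg[of "- real (Suc k)" "x - z"] by auto
  ultimately show ?thesis unfolding stein_approx_derivative_def by linarith
qed

lemma stein_approx_at_kink: "stein_approx z k z = stein_solution z z"
  by (simp add: stein_approx_def)

lemma tendsto_exp_minus_Suc_mult: "0 < y \<Longrightarrow> (\<lambda>k. exp (- real (Suc k) * y)) \<longlonglongrightarrow> 0"
  by real_asymp

lemma tendsto_stein_approx: "(\<lambda>k. stein_approx z k x) \<longlonglongrightarrow> stein_solution z x"
proof (cases "x \<le> z")
  case False
  then have "(\<lambda>k. (1 - exp (- real (Suc k) * (x - z))) / real (Suc k)) \<longlonglongrightarrow> 0"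
    by real_asymp
  from tendsto_add[OF tendsto_const[of "stein_solution z x - min x z + z"] this] False
  show ?thesis by (simp add: stein_approx_def add.assoc)
qed (simp add: stein_approx_def)

lemma tendsto_stein_approx_derivative: "(\<lambda>k. stein_approx_derivative z k x) \<longlonglongrightarrow> stein_derivative z x"
proof (cases "x \<le> z")
  case False
  then have "(\<lambda>k. exp (- real (Suc k) * (x - z))) \<longlonglongrightarrow> 0" by (intro tendsto_exp_minus_Suc_mult) simp
  from tendsto_add[OF tendsto_const[of "x * stein_solution z x - std_normal_cdf z"] this] False
  show ?thesis by (simp add: stein_approx_derivative_def stein_derivative_def)
qed (simp add: stein_approx_derivative_def stein_derivative_def algebra_simps)

subsection \<open>Kolmogorov bound and exact asymptotics\<close>

lemma exists_antiderivative:
  fixes f :: "real \<Rightarrow> real"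
  assumes "continuous_on UNIV f"
  obtains F where "\<And>x. (F has_real_derivative f x) (at x)"
  using einterval_antiderivative[of "-\<infinity>" \<infinity> f] assms
  by (auto simp: continuous_on_eq_continuous_at has_real_derivative_iff_has_vector_derivative)

context second_chaos_variable begin

lemma integrable_F: "integrable M F"
  by (rule square_integrable_imp_integrable[OF measurable_F integrable_square])

lemma integrable_mult_of_linear_growth:
  assumes [measurable]: "q \<in> borel_measurable borel" and q: "\<And>x. \<bar>q x\<bar> \<le> a + b * \<bar>x\<bar>"
  shows "integrable M (\<lambda>\<omega>. F \<omega> * q (F \<omega>))"
proof (rule Bochner_Integration.integrable_bound)
  show "integrable M (\<lambda>\<omega>. a * \<bar>F \<omega>\<bar> + b * (F \<omega>)\<^sup>2)"
    using integrable_F integrable_square by simp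
  have "\<bar>x * q x\<bar> \<le> a * \<bar>x\<bar> + b * x\<^sup>2" for x
    using mult_left_mono[OF q[of x], of "\<bar>x\<bar>"] by (simp add: abs_mult algebra_simps power2_eq_square)
  then show "AE \<omega> in M. norm (F \<omega> * q (F \<omega>)) \<le> norm (a * \<bar>F \<omega>\<bar> + b * (F \<omega>)\<^sup>2)"
    by (intro AE_I2) (auto intro: order_trans[OF _ abs_ge_self])
qed simp

text \<open>\<open>stein_bound\<close> demands a continuous derivative, so it is applied to the
  smoothed solutions minus q and k tends to infinity by dominated convergence. The function q makes
  the result serve twice: q = 0 gives the Kolmogorov bound, a primitive of an approximation of psi'
  the asymptotics.\<close>

lemma stein_bound_stein_solution:
  assumes q: "\<And>x. (q has_real_derivative q' x) (at x)" "continuous_on UNIV q'" "\<And>x. \<bar>q' x\<bar> \<le> C"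
  shows "(expectation (\<lambda>\<omega>. stein_derivative z (F \<omega>) - q' (F \<omega>)) - expectation (\<lambda>\<omega>. F \<omega> * (stein_solution z (F \<omega>) - q (F \<omega>))))\<^sup>2
    \<le> (8 * s 4 + (2 * s 2 - 1)\<^sup>2) * expectation (\<lambda>\<omega>. (stein_derivative z (F \<omega>) - q' (F \<omega>))\<^sup>2)"
proof -
  have C: "0 \<le> C" using q(3)[of 0] by linarith
  let ?\<psi> = "\<lambda>k x. stein_approx z k x - q x" and ?\<psi>' = "\<lambda>k x. stein_approx_derivative z k x - q' x"
  have d: "(?\<psi> k has_real_derivative ?\<psi>' k x) (at x)" for k x
    by (intro DERIV_diff DERIV_stein_approx q)
  have c: "continuous_on UNIV (?\<psi>' k)" for k
    by (intro continuous_on_diff q continuous_at_imp_continuous_on ballI isCont_stein_approx_derivative)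
  have b: "\<bar>?\<psi>' k x\<bar> \<le> 3 + C" for k x
    using abs_stein_approx_derivative_le_3[of z k x] q(3)[of x] by linarith
  have cont: "continuous_on UNIV (?\<psi> k)" for k using d by (meson DERIV_isCont continuous_at_imp_continuous_on)
  have [measurable]: "?\<psi> k \<in> borel_measurable borel" "?\<psi>' k \<in> borel_measurable borel" for k
    using c cont by (auto intro: borel_measurable_continuous_onI)
  have "continuous_on UNIV q" using q(1) by (meson DERIV_isCont continuous_at_imp_continuous_on)
  then have [measurable]: "q \<in> borel_measurable borel" "q' \<in> borel_measurable borel"
    using q(2) by (auto intro: borel_measurable_continuous_onI)
  \<comment> \<open>Independent of k, because all approximations take the same value at z.\<close>
  define a where "a = \<bar>stein_solution z z - q z\<bar> + (3 + C) * \<bar>z\<bar>"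
  have growth: "\<bar>?\<psi> k x\<bar> \<le> a + (3 + C) * \<bar>x\<bar>" for k x
  proof -
    have "\<bar>?\<psi> k x - ?\<psi> k z\<bar> \<le> (3 + C) * \<bar>x - z\<bar>"
      by (rule Lipschitz_of_bounded_derivative[OF d b])
    also have "\<dots> \<le> (3 + C) * (\<bar>x\<bar> + \<bar>z\<bar>)" using C by (intro mult_left_mono abs_triangle_ineq4) auto
    finally show ?thesis unfolding a_def stein_approx_at_kink distrib_left by linarith
  qed
  have l1: "(\<lambda>k. expectation (\<lambda>\<omega>. ?\<psi>' k (F \<omega>))) \<longlonglongrightarrow> expectation (\<lambda>\<omega>. stein_derivative z (F \<omega>) - q' (F \<omega>))"
    by (rule integral_dominated_convergence[where w = "\<lambda>_. 3 + C"])
      (use b in \<open>auto intro!: tendsto_intros tendsto_stein_approx_derivative\<close>)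
  have l2: "(\<lambda>k. expectation (\<lambda>\<omega>. (?\<psi>' k (F \<omega>))\<^sup>2)) \<longlonglongrightarrow> expectation (\<lambda>\<omega>. (stein_derivative z (F \<omega>) - q' (F \<omega>))\<^sup>2)"
    by (rule integral_dominated_convergence[where w = "\<lambda>_. (3 + C)\<^sup>2"])
      (use power_mono[OF b abs_ge_zero, of _ _ 2] in \<open>auto intro!: tendsto_intros tendsto_stein_approx_derivative\<close>)
  have l3: "(\<lambda>k. expectation (\<lambda>\<omega>. F \<omega> * ?\<psi> k (F \<omega>))) \<longlonglongrightarrow> expectation (\<lambda>\<omega>. F \<omega> * (stein_solution z (F \<omega>) - q (F \<omega>)))"
  proof (rule integral_dominated_convergence[where w = "\<lambda>\<omega>. a * \<bar>F \<omega>\<bar> + (3 + C) * (F \<omega>)\<^sup>2"])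
    show "integrable M (\<lambda>\<omega>. a * \<bar>F \<omega>\<bar> + (3 + C) * (F \<omega>)\<^sup>2)"
      using integrable_F integrable_square by simp
    have "\<bar>x * ?\<psi> k x\<bar> \<le> a * \<bar>x\<bar> + (3 + C) * x\<^sup>2" for x k
    proof -
      have "\<bar>x * ?\<psi> k x\<bar> \<le> \<bar>x\<bar> * (a + (3 + C) * \<bar>x\<bar>)"
        unfolding abs_mult by (intro mult_left_mono growth) simp
      also have "\<dots> = a * \<bar>x\<bar> + (3 + C) * \<bar>x\<bar>\<^sup>2" by (simp only: power2_eq_square distrib_left mult_ac)
      finally show ?thesis by simp
    qed
    then show "AE \<omega> in M. norm (F \<omega> * ?\<psi> k (F \<omega>)) \<le> a * \<bar>F \<omega>\<bar> + (3 + C) * (F \<omega>)\<^sup>2" for k by simp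
  qed (auto intro!: tendsto_intros tendsto_stein_approx)
  have "(\<lambda>k. (expectation (\<lambda>\<omega>. ?\<psi>' k (F \<omega>)) - expectation (\<lambda>\<omega>. F \<omega> * ?\<psi> k (F \<omega>)))\<^sup>2) \<longlonglongrightarrow>
     (expectation (\<lambda>\<omega>. stein_derivative z (F \<omega>) - q' (F \<omega>)) - expectation (\<lambda>\<omega>. F \<omega> * (stein_solution z (F \<omega>) - q (F \<omega>))))\<^sup>2"
    by (intro tendsto_intros l1 l3)
  moreover have "(\<lambda>k. (8 * s 4 + (2 * s 2 - 1)\<^sup>2) * expectation (\<lambda>\<omega>. (?\<psi>' k (F \<omega>))\<^sup>2)) \<longlonglongrightarrow>
     (8 * s 4 + (2 * s 2 - 1)\<^sup>2) * expectation (\<lambda>\<omega>. (stein_derivative z (F \<omega>) - q' (F \<omega>))\<^sup>2)"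
    by (intro tendsto_intros l2)
  ultimately show ?thesis
    by (rule LIMSEQ_le) (use stein_bound[OF d c b] in blast)
qed

text \<open>Stein's equation evaluated at F and integrated. The same equation shows that
  \<open>x * stein_solution z x\<close> is bounded, whence integrability.\<close>

lemma cdf_eq_stein:
  "expectation (\<lambda>\<omega>. stein_derivative z (F \<omega>)) - expectation (\<lambda>\<omega>. F \<omega> * stein_solution z (F \<omega>))
    = prob {\<omega> \<in> space M. F \<omega> \<le> z} - std_normal_cdf z"
  "integrable M (\<lambda>\<omega>. F \<omega> * stein_solution z (F \<omega>))" "integrable M (\<lambda>\<omega>. stein_derivative z (F \<omega>))"
proof -
  show i2: "integrable M (\<lambda>\<omega>. stein_derivative z (F \<omega>))"
    by (rule integrable_const_bound[of _ 1]) (auto intro: abs_stein_derivative_le_1)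
  have eq: "x * stein_solution z x = stein_derivative z x - (indicator {..z} x - std_normal_cdf z)" for x
    by (simp add: stein_derivative_def)
  have ind: "integrable M (\<lambda>\<omega>. indicat_real {..z} (F \<omega>))"
    by (rule integrable_const_bound[of _ 1]) (auto simp: indicator_def)
  then have i3: "integrable M (\<lambda>\<omega>. indicat_real {..z} (F \<omega>) - std_normal_cdf z)" by simp
  show i1: "integrable M (\<lambda>\<omega>. F \<omega> * stein_solution z (F \<omega>))"
    unfolding eq using i2 i3 by simp
  have "expectation (\<lambda>\<omega>. indicat_real {..z} (F \<omega>)) = expectation (indicat_real {\<omega> \<in> space M. F \<omega> \<le> z})"
    by (intro Bochner_Integration.integral_cong) (auto simp: indicator_def)
  with ind show "expectation (\<lambda>\<omega>. stein_derivative z (F \<omega>)) - expectation (\<lambda>\<omega>. F \<omega> * stein_solution z (F \<omega>))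
    = prob {\<omega> \<in> space M. F \<omega> \<le> z} - std_normal_cdf z"
    unfolding eq using i2 i3 by (simp add: prob_space)
qed

text \<open>In cumulants this is the square root of kappa_4 / 6 + (kappa_2 - 1)^2, since kappa_4 =
  48 s_4 and kappa_2 = 2 s_2.\<close>

definition discrepancy :: real where
  "discrepancy = sqrt (8 * s 4 + (2 * s 2 - 1)\<^sup>2)"

lemma discrepancy_nonneg: "0 \<le> discrepancy"
  using trace4_nonneg by (simp add: discrepancy_def)

lemma discrepancy_square: "discrepancy\<^sup>2 = 8 * s 4 + (2 * s 2 - 1)\<^sup>2"
  using trace4_nonneg by (simp add: discrepancy_def)

lemma abs_cdf_diff_le: "\<bar>prob {\<omega> \<in> space M. F \<omega> \<le> z} - std_normal_cdf z\<bar> \<le> discrepancy"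
proof -
  have "(prob {\<omega> \<in> space M. F \<omega> \<le> z} - std_normal_cdf z)\<^sup>2 \<le> discrepancy\<^sup>2 * expectation (\<lambda>\<omega>. (stein_derivative z (F \<omega>))\<^sup>2)"
    using stein_bound_stein_solution[of "\<lambda>_. 0" "\<lambda>_. 0" 0 z] cdf_eq_stein(1)[of z] by (simp add: discrepancy_square)
  also have "\<dots> \<le> discrepancy\<^sup>2 * 1"
  proof (intro mult_left_mono)
    have "(stein_derivative z x)\<^sup>2 \<le> 1" for x using abs_stein_derivative_le_1[of z x] by (simp add: abs_square_le_1)
    then show "expectation (\<lambda>\<omega>. (stein_derivative z (F \<omega>))\<^sup>2) \<le> 1"
      by (intro integral_le_const integrable_const_bound[of _ 1]) auto
  qed simp
  finally show ?thesis using discrepancy_nonneg by - (rule power2_le_imp_le, simp_all)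
qed

text \<open>With q a primitive of p, the Stein solution splits into its difference from q, estimated
  by the Stein inequality, and q itself, expanded to second order. Both errors carry the full factor
  \<open>discrepancy\<close>; what remains is an L^2 distance and a square root of the discrepancy.
  The coefficient 4 s_3 is kappa_3 / 2.\<close>

lemma cdf_expansion:
  assumes p: "\<And>x. (p has_real_derivative p' x) (at x)" "continuous_on UNIV p'" "\<And>x. \<bar>p x\<bar> \<le> C" "\<And>x. \<bar>p' x\<bar> \<le> C'"
  shows "\<bar>prob {\<omega> \<in> space M. F \<omega> \<le> z} - std_normal_cdf z
      - ((1 - 2 * s 2) * expectation (\<lambda>\<omega>. p (F \<omega>)) - 4 * s 3 * expectation (\<lambda>\<omega>. p' (F \<omega>)))\<bar>
    \<le> discrepancy * (sqrt (expectation (\<lambda>\<omega>. (stein_derivative z (F \<omega>) - p (F \<omega>))\<^sup>2)) + 2 * sqrt discrepancy * C')"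
proof -
  have contp: "continuous_on UNIV p" using p(1) by (meson DERIV_isCont continuous_at_imp_continuous_on)
  obtain q where q: "\<And>x. (q has_real_derivative p x) (at x)" using exists_antiderivative[OF contp] by blast
  have contq: "continuous_on UNIV q" using q(1) by (meson DERIV_isCont continuous_at_imp_continuous_on)
  have [measurable]: "q \<in> borel_measurable borel" "p \<in> borel_measurable borel"
    using contp contq by (auto intro: borel_measurable_continuous_onI)
  have C: "0 \<le> C" "0 \<le> C'" using p(3)[of 0] p(4)[of 0] by linarith+
  have ip: "integrable M (\<lambda>\<omega>. p (F \<omega>))" by (rule integrable_const_bound[of _ C]) (use p in auto)
  have iq: "integrable M (\<lambda>\<omega>. F \<omega> * q (F \<omega>))"
  proof (rule integrable_mult_of_linear_growth)
    show "\<bar>q x\<bar> \<le> \<bar>q 0\<bar> + C * \<bar>x\<bar>" for x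
      using Lipschitz_of_bounded_derivative[of q p C x 0] q p(3) by fastforce
  qed simp
  let ?D = "prob {\<omega> \<in> space M. F \<omega> \<le> z} - std_normal_cdf z" and ?V = "expectation (\<lambda>\<omega>. (stein_derivative z (F \<omega>) - p (F \<omega>))\<^sup>2)"
  let ?Eq = "expectation (\<lambda>\<omega>. F \<omega> * q (F \<omega>))" and ?Ep = "expectation (\<lambda>\<omega>. p (F \<omega>))" and ?Ep' = "expectation (\<lambda>\<omega>. p' (F \<omega>))"
  have "expectation (\<lambda>\<omega>. stein_derivative z (F \<omega>) - p (F \<omega>)) - expectation (\<lambda>\<omega>. F \<omega> * (stein_solution z (F \<omega>) - q (F \<omega>))) = ?D - (?Ep - ?Eq)"
    using cdf_eq_stein[of z] ip iq by (simp add: right_diff_distrib)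
  then have "(?D - (?Ep - ?Eq))\<^sup>2 \<le> discrepancy\<^sup>2 * ?V"
    using stein_bound_stein_solution[OF q contp p(3), of z] by (simp add: discrepancy_square)
  also have "\<dots> = (discrepancy * sqrt ?V)\<^sup>2"
    by (simp add: power_mult_distrib integral_nonneg_AE)
  finally have 1: "\<bar>?D - (?Ep - ?Eq)\<bar> \<le> discrepancy * sqrt ?V"
    using discrepancy_nonneg by - (rule power2_le_imp_le, simp_all add: integral_nonneg_AE)
  have "(?Eq - 2 * s 2 * ?Ep - 4 * s 3 * ?Ep')\<^sup>2 \<le> 32 * (s 4 * sqrt (s 4)) * C'\<^sup>2"
    by (rule expansion_bound[OF q p(1,2,3,4)])
  \<comment> \<open>From 8 s_4 \<le> \<open>discrepancy\<^sup>2\<close> it follows that sqrt(s_4) is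
    at most the discrepancy, so 32 s_4^(3/2) is at most 4 times its cube.\<close>
  also have "\<dots> \<le> (discrepancy * (2 * sqrt discrepancy * C'))\<^sup>2"
  proof -
    have s4: "8 * s 4 \<le> discrepancy\<^sup>2" unfolding discrepancy_square by simp
    then have "sqrt (s 4) \<le> sqrt (discrepancy\<^sup>2)" using trace4_nonneg by (intro real_sqrt_le_mono) linarith
    then have "sqrt (s 4) \<le> discrepancy" using discrepancy_nonneg by simp
    then have "(8 * s 4) * sqrt (s 4) \<le> discrepancy\<^sup>2 * discrepancy"
      using s4 trace4_nonneg by (intro mult_mono) auto
    then have "4 * ((8 * s 4) * sqrt (s 4)) * C'\<^sup>2 \<le> 4 * (discrepancy\<^sup>2 * discrepancy) * C'\<^sup>2"
      by (intro mult_right_mono mult_left_mono) auto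
    then show ?thesis using discrepancy_nonneg by (simp add: power_mult_distrib mult_ac)
  qed
  finally have 2: "\<bar>?Eq - 2 * s 2 * ?Ep - 4 * s 3 * ?Ep'\<bar> \<le> discrepancy * (2 * sqrt discrepancy * C')"
    using discrepancy_nonneg C by - (rule power2_le_imp_le, simp_all)
  show ?thesis using 1 2 by (simp add: algebra_simps)
qed

end

section \<open>The Stein identity and smooth approximation of the Stein derivative in L^2\<close>

lemma std_normal_expectation_derivative:
  fixes h h' :: "real \<Rightarrow> real"
  assumes h: "\<And>x. (h has_real_derivative h' x) (at x)" "continuous_on UNIV h'" "\<And>x. \<bar>h x\<bar> \<le> C" "\<And>x. \<bar>h' x\<bar> \<le> C'"
  shows "(LINT x|std_normal. h' x) = (LINT x|std_normal. x * h x)"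
proof -
  have conth: "continuous_on UNIV h" using h(1) by (meson DERIV_isCont continuous_at_imp_continuous_on)
  have [measurable]: "h \<in> borel_measurable borel" "h' \<in> borel_measurable borel"
    using h(2) conth by (auto intro: borel_measurable_continuous_onI)
  have C: "0 \<le> C" using h(3)[of 0] by linarith
  have i1: "integrable std_normal h'"
    by (rule std_normal.integrable_const_bound[of _ C']) (use h in auto)
  have i2: "integrable std_normal (\<lambda>x. x * h x)"
  proof (rule Bochner_Integration.integrable_bound)
    show "integrable std_normal (\<lambda>x. C * x)" using integrable_std_normal_distribution_moment[of 1] by simp
    show "AE x in std_normal. norm (x * h x) \<le> norm (C * x)"
      using h(3) C by (intro AE_I2) (auto simp: abs_mult mult.commute[of C] intro!: mult_left_mono)
  qed simp
  have "(LBINT x. std_normal_density x * (h' x - x * h x)) = 0 - 0"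
  proof (rule LBINT_eq_limit_diff[where F = "\<lambda>x. h x * std_normal_density x"])
    show "((\<lambda>x. h x * std_normal_density x) has_real_derivative std_normal_density x * (h' x - x * h x)) (at x)" for x
      by (auto intro!: derivative_eq_intros h simp: algebra_simps)
    show "continuous_on UNIV (\<lambda>x. std_normal_density x * (h' x - x * h x))"
      by (intro continuous_intros h conth continuous_at_imp_continuous_on ballI isCont_std_normal_density)
    show "integrable lborel (\<lambda>x. std_normal_density x * (h' x - x * h x))"
      using i1 i2 by (subst integrable_std_normal_iff[symmetric]) auto
    have bd: "norm (h x * std_normal_density x) \<le> C * std_normal_density x" for x
      using h(3)[of x] by (auto simp: abs_mult intro!: mult_right_mono)
    have "((\<lambda>x. C * std_normal_density x) \<longlongrightarrow> 0) at_bot" "((\<lambda>x. C * std_normal_density x) \<longlongrightarrow> 0) at_top"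
      unfolding std_normal_density_def by real_asymp+
    then show "((\<lambda>x. h x * std_normal_density x) \<longlongrightarrow> 0) at_bot" "((\<lambda>x. h x * std_normal_density x) \<longlongrightarrow> 0) at_top"
      by (auto intro: Lim_null_comparison[OF always_eventually[OF allI[OF bd]]])
  qed
  then have "(LINT x|std_normal. h' x - x * h x) = 0"
    by (subst integral_std_normal) auto
  then show ?thesis using i1 i2 by simp
qed

text \<open>A difference quotient of \<open>stein_approx\<close>, that is, the mean of its
  derivative over an interval of length 1 / (k + 1). The averaging gains the missing order of
  smoothness: \<open>stein_approx_derivative\<close> is continuous but in general has a corner at
  z.\<close>

definition stein_mollified :: "real \<Rightarrow> nat \<Rightarrow> real \<Rightarrow> real" where
  "stein_mollified z k x = real (Suc k) * (stein_approx z k (x + 1 / real (Suc k)) - stein_approx z k x)"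

definition stein_mollified_derivative :: "real \<Rightarrow> nat \<Rightarrow> real \<Rightarrow> real" where
  "stein_mollified_derivative z k x =
     real (Suc k) * (stein_approx_derivative z k (x + 1 / real (Suc k)) - stein_approx_derivative z k x)"

lemma DERIV_stein_mollified: "(stein_mollified z k has_real_derivative stein_mollified_derivative z k x) (at x)"
proof -
  have "((\<lambda>x. stein_approx z k (x + 1 / real (Suc k))) has_real_derivative stein_approx_derivative z k (x + 1 / real (Suc k)) * 1) (at x)"
    by (rule DERIV_chain2[OF DERIV_stein_approx]) (auto intro!: derivative_eq_intros)
  then show ?thesis unfolding stein_mollified_def [abs_def] stein_mollified_derivative_def
    by (intro DERIV_cmult DERIV_diff DERIV_stein_approx) simp
qed

lemma continuous_stein_mollified_derivative: "continuous_on UNIV (stein_mollified_derivative z k)"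
proof -
  have c: "continuous_on UNIV (stein_approx_derivative z k)"
    by (intro continuous_at_imp_continuous_on ballI isCont_stein_approx_derivative)
  show ?thesis unfolding stein_mollified_derivative_def [abs_def]
    by (intro continuous_intros c continuous_on_compose2[OF c]) auto
qed

lemma stein_mollified_mean_value:
  obtains \<xi> where "x < \<xi>" "\<xi> < x + 1 / real (Suc k)" "stein_mollified z k x = stein_approx_derivative z k \<xi>"
proof -
  have "x < x + 1 / real (Suc k)" by simp
  from MVT2[OF this DERIV_stein_approx]
  obtain \<xi> where \<xi>: "x < \<xi>" "\<xi> < x + 1 / real (Suc k)"
    "stein_approx z k (x + 1 / real (Suc k)) - stein_approx z k x = (x + 1 / real (Suc k) - x) * stein_approx_derivative z k \<xi>"
    by blast
  have "stein_mollified z k x = stein_approx_derivative z k \<xi>"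
    unfolding stein_mollified_def \<xi>(3) by simp
  then show ?thesis using \<xi>(1,2) that by blast
qed

lemma abs_stein_mollified_le: "\<bar>stein_mollified z k x\<bar> \<le> 3"
  by (metis stein_mollified_mean_value abs_stein_approx_derivative_le_3)

lemma abs_stein_mollified_derivative_le: "\<bar>stein_mollified_derivative z k x\<bar> \<le> real (Suc k) * 6"
proof -
  have "\<bar>stein_approx_derivative z k (x + 1 / real (Suc k)) - stein_approx_derivative z k x\<bar> \<le> 6"
    using abs_stein_approx_derivative_le_3[of z k "x + 1 / real (Suc k)"] abs_stein_approx_derivative_le_3[of z k x] by linarith
  then show ?thesis unfolding stein_mollified_derivative_def abs_mult by (intro mult_mono) auto
qed

text \<open>The mean value points converge to x from the right, and away from z the exponential tail
  there behaves like the indicator. At z itself the tail contributes 1 - 1/e instead of 1, but a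
  point is a null set for the normal law.\<close>

lemma tendsto_stein_mollified:
  assumes "x \<noteq> z"
  shows "(\<lambda>k. stein_mollified z k x) \<longlonglongrightarrow> stein_derivative z x"
proof -
  have "\<forall>k. \<exists>\<xi>. x < \<xi> \<and> \<xi> < x + 1 / real (Suc k) \<and> stein_mollified z k x = stein_approx_derivative z k \<xi>"
    using stein_mollified_mean_value by metis
  then obtain \<xi> where \<xi>: "\<And>k. x < \<xi> k" "\<And>k. \<xi> k < x + 1 / real (Suc k)" "\<And>k. stein_mollified z k x = stein_approx_derivative z k (\<xi> k)"
    by metis
  have \<xi>lim: "\<xi> \<longlonglongrightarrow> x"
  proof (rule tendsto_sandwich[of "\<lambda>_. x" _ _ "\<lambda>k. x + 1 / real (Suc k)"])
    show "(\<lambda>k. x + 1 / real (Suc k)) \<longlonglongrightarrow> x" by real_asymp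
  qed (use \<xi> in \<open>auto intro!: always_eventually less_imp_le\<close>)
  have c: "(\<lambda>k. \<xi> k * stein_solution z (\<xi> k) - std_normal_cdf z) \<longlonglongrightarrow> x * stein_solution z x - std_normal_cdf z"
    by (intro tendsto_intros \<xi>lim isCont_tendsto_compose[OF isCont_stein_solution])
  have h: "(\<lambda>k. if \<xi> k \<le> z then 1 else exp (- real (Suc k) * (\<xi> k - z))) \<longlonglongrightarrow> (indicator {..z} x :: real)"
  proof (cases "x < z")
    case True
    have "eventually (\<lambda>k. \<xi> k < z) sequentially" using \<xi>lim True by (rule order_tendstoD)
    then have "eventually (\<lambda>k. 1 = (if \<xi> k \<le> z then 1 else exp (- real (Suc k) * (\<xi> k - z)))) sequentially"
      by eventually_elim simp
    from Lim_transform_eventually[OF tendsto_const this] True show ?thesis by simp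
  next
    case False
    then have xz: "z < x" using assms by simp
    have "(\<lambda>k. exp (- real (Suc k) * (\<xi> k - z))) \<longlonglongrightarrow> 0"
    proof (rule tendsto_sandwich[of "\<lambda>_. 0" _ _ "\<lambda>k. exp (- real (Suc k) * (x - z))"])
      show "\<forall>\<^sub>F k in sequentially. exp (- real (Suc k) * (\<xi> k - z)) \<le> exp (- real (Suc k) * (x - z))"
        using \<xi>(1) by (intro always_eventually allI) (simp only: exp_le_cancel_iff, intro mult_left_mono_neg, auto intro: less_imp_le)
      show "(\<lambda>k. exp (- real (Suc k) * (x - z))) \<longlonglongrightarrow> 0" by (rule tendsto_exp_minus_Suc_mult) (use xz in simp)
    qed auto
    moreover have "\<not> \<xi> k \<le> z" for k using \<xi>(1)[of k] xz by simp
    ultimately show ?thesis using xz by simp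
  qed
  show ?thesis
    using tendsto_add[OF c h] unfolding \<xi>(3) stein_approx_derivative_def stein_derivative_def by (simp add: algebra_simps)
qed

lemma tendsto_stein_mollified_L2:
  "(\<lambda>k. LINT x|std_normal. (stein_derivative z x - stein_mollified z k x)\<^sup>2) \<longlonglongrightarrow> 0"
  "(\<lambda>k. LINT x|std_normal. x * stein_mollified z k x) \<longlonglongrightarrow> (LINT x|std_normal. x * stein_derivative z x)"
proof -
  have ne: "AE x in std_normal. x \<noteq> z"
    by (rule AE_I[of _ _ "{z}"]) (auto simp: std_normal.emeasure_eq_measure std_normal_singleton)
  have [measurable]: "stein_mollified z k \<in> borel_measurable borel" for k
    using DERIV_stein_mollified by (meson DERIV_isCont continuous_at_imp_continuous_on borel_measurable_continuous_onI)
  have lim: "AE x in std_normal. (\<lambda>k. stein_mollified z k x) \<longlonglongrightarrow> stein_derivative z x"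
    using ne by eventually_elim (rule tendsto_stein_mollified)
  have "(\<lambda>k. LINT x|std_normal. (stein_derivative z x - stein_mollified z k x)\<^sup>2) \<longlonglongrightarrow> (LINT x|std_normal. (0::real))"
  proof (rule integral_dominated_convergence[where w = "\<lambda>_. 16"])
    show "AE x in std_normal. (\<lambda>k. (stein_derivative z x - stein_mollified z k x)\<^sup>2) \<longlonglongrightarrow> 0"
      using lim
    proof eventually_elim
      case (elim x)
      have "(\<lambda>k. (stein_derivative z x - stein_mollified z k x)\<^sup>2) \<longlonglongrightarrow> (stein_derivative z x - stein_derivative z x)\<^sup>2"
        by (intro tendsto_intros elim)
      then show ?case by simp
    qed
    have "(stein_derivative z x - stein_mollified z k x)\<^sup>2 \<le> 4\<^sup>2" for x k
    proof -
      have "\<bar>stein_derivative z x - stein_mollified z k x\<bar> \<le> 4"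
        using abs_stein_derivative_le_1[of z x] abs_stein_mollified_le[of z k x] by linarith
      from power_mono[OF this abs_ge_zero, of 2] show ?thesis by simp
    qed
    then show "AE x in std_normal. norm ((stein_derivative z x - stein_mollified z k x)\<^sup>2) \<le> 16" for k by simp
  qed auto
  then show "(\<lambda>k. LINT x|std_normal. (stein_derivative z x - stein_mollified z k x)\<^sup>2) \<longlonglongrightarrow> 0" by simp
  show "(\<lambda>k. LINT x|std_normal. x * stein_mollified z k x) \<longlonglongrightarrow> (LINT x|std_normal. x * stein_derivative z x)"
  proof (rule integral_dominated_convergence[where w = "\<lambda>x. 3 * \<bar>x\<bar>"])
    show "AE x in std_normal. (\<lambda>k. x * stein_mollified z k x) \<longlonglongrightarrow> x * stein_derivative z x"
      using lim by eventually_elim (intro tendsto_intros)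
    show "integrable std_normal (\<lambda>x. 3 * \<bar>x\<bar>)" using integrable_std_normal_distribution_moment[of 1] by simp
    show "AE x in std_normal. norm (x * stein_mollified z k x) \<le> 3 * \<bar>x\<bar>" for k
      using abs_stein_mollified_le[of z k] by (intro AE_I2) (simp add: abs_mult mult.commute[of 3] mult_left_mono)
  qed auto
qed

section \<open>Limit theorems for sequences in the second chaos\<close>

context prob_space begin

text \<open>The normal law has no atoms, so one point of discontinuity is allowed. This admits the
  Stein derivative, which jumps at z.\<close>

lemma weak_conv_expectation_tendsto:
  fixes g :: "real \<Rightarrow> real"
  assumes [measurable]: "\<And>n. F n \<in> borel_measurable M" "g \<in> borel_measurable borel"
    and weak: "weak_conv_m (\<lambda>n. distr M borel (F n)) std_normal"
    and g: "\<And>x. x \<noteq> z \<Longrightarrow> isCont g x" "\<And>x. \<bar>g x\<bar> \<le> C"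
  shows "(\<lambda>n. expectation (\<lambda>\<omega>. g (F n \<omega>))) \<longlonglongrightarrow> (LINT x|std_normal. g x)"
proof -
  have "emeasure std_normal {x. \<not> isCont g x} \<le> emeasure std_normal {z}"
    by (rule emeasure_mono) (use g in auto)
  then have "emeasure std_normal {x. \<not> isCont g x} = 0"
    by (simp add: std_normal.emeasure_eq_measure std_normal_singleton)
  then have "(\<lambda>n. integral\<^sup>L (distr M borel (F n)) g) \<longlonglongrightarrow> integral\<^sup>L std_normal g"
    by (intro weak_conv_imp_bdd_ae_continuous_conv[OF _ real_dist_normal_dist weak, where B = C])
      (use g in \<open>auto intro!: real_distribution_distr\<close>)
  then show ?thesis by (simp add: integral_distr)
qed

text \<open>Divided by e n, the expansion for the k-th mollification has a main term tending to -
  \<alpha>/2 E[p_k'(N)] and an error tending to the L^2(N) distance of p_k from psi'. Since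
  E[p_k'(N)] = E[N p_k(N)], no derivative of psi' occurs in the limit over k, and 1/2 times the 1/3
  of \<open>expectation_mult_stein_derivative\<close> gives the 1/6.\<close>

lemma second_chaos_exact_asymptotics:
  fixes F :: "nat \<Rightarrow> 'a \<Rightarrow> real"
  assumes F: "\<And>n. second_chaos_variable M (F n) (s n)"
    and weak: "weak_conv_m (\<lambda>n. distr M borel (F n)) std_normal"
  defines "e \<equiv> \<lambda>n. second_chaos_variable.discrepancy (s n)"
  assumes e0: "e \<longlonglongrightarrow> 0"
    and var: "(\<lambda>n. (2 * s n 2 - 1) / e n) \<longlonglongrightarrow> 0"
    and skew: "(\<lambda>n. 8 * s n 3 / e n) \<longlonglongrightarrow> \<alpha>"
  shows "(\<lambda>n. (prob {\<omega> \<in> space M. F n \<omega> \<le> z} - std_normal_cdf z) / e n)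
    \<longlonglongrightarrow> \<alpha> / 6 * (1 - z\<^sup>2) * std_normal_density z"
proof -
  interpret F: second_chaos_variable M "F n" "s n" for n by (rule F)
  have e: "e n = F.discrepancy n" "0 \<le> e n" for n by (simp_all add: e_def F.discrepancy_nonneg)
  let ?D = "\<lambda>n. (prob {\<omega> \<in> space M. F n \<omega> \<le> z} - std_normal_cdf z) / e n"
  define p where "p = stein_mollified z"
  define p' where "p' = stein_mollified_derivative z"
  define a where "a k = (LINT x|std_normal. (stein_derivative z x - p k x)\<^sup>2)" for k
  define b where "b k = (LINT x|std_normal. x * p k x)" for k
  define b0 where "b0 = (LINT x|std_normal. x * stein_derivative z x)"
  have a: "a \<longlonglongrightarrow> 0" and b: "b \<longlonglongrightarrow> b0"
    unfolding a_def b_def b0_def p_def by (rule tendsto_stein_mollified_L2)+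
  have contp: "isCont (p k) x" "isCont (p' k) x" for k x
    unfolding p_def p'_def using DERIV_isCont[OF DERIV_stein_mollified] continuous_stein_mollified_derivative
    by (auto simp: continuous_on_eq_continuous_at)
  have [measurable]: "p k \<in> borel_measurable borel" "p' k \<in> borel_measurable borel" for k
    by (intro borel_measurable_continuous_onI continuous_at_imp_continuous_on ballI contp)+
  have key: "\<forall>\<^sub>F n in sequentially. \<bar>?D n + \<alpha> / 2 * b k\<bar> < sqrt (a k) + \<epsilon>" if "0 < \<epsilon>" for k \<epsilon>
  proof -
    let ?Ep = "\<lambda>n. expectation (\<lambda>\<omega>. p k (F n \<omega>))" and ?Ep' = "\<lambda>n. expectation (\<lambda>\<omega>. p' k (F n \<omega>))"
    let ?V = "\<lambda>n. expectation (\<lambda>\<omega>. (stein_derivative z (F n \<omega>) - p k (F n \<omega>))\<^sup>2)"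
    let ?m = "\<lambda>n. (1 - 2 * s n 2) * ?Ep n - 4 * s n 3 * ?Ep' n"
    let ?K = "real (Suc k) * 6"
    have bound: "\<bar>?D n - ?m n / e n\<bar> \<le> sqrt (?V n) + 2 * sqrt (e n) * ?K" for n
    \<comment> \<open>A quotient by \<open>e n = 0\<close> is 0, so the bound is trivial for such
      n.\<close>
    proof (cases "e n = 0")
      case True then show ?thesis by (simp add: integral_nonneg_AE)
    next
      case False
      then have "0 < e n" using e(2)[of n] by simp
      moreover have "\<bar>(prob {\<omega> \<in> space M. F n \<omega> \<le> z} - std_normal_cdf z) - ?m n\<bar> \<le> e n * (sqrt (?V n) + 2 * sqrt (e n) * ?K)"
        unfolding e(1) p_def p'_def
        by (rule F.cdf_expansion[OF DERIV_stein_mollified continuous_stein_mollified_derivative abs_stein_mollified_le abs_stein_mollified_derivative_le])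
      moreover have "?D n - ?m n / e n = ((prob {\<omega> \<in> space M. F n \<omega> \<le> z} - std_normal_cdf z) - ?m n) / e n"
        by (simp add: diff_divide_distrib)
      ultimately show ?thesis by (simp add: divide_le_eq mult.commute)
    qed
    have "?Ep \<longlonglongrightarrow> (LINT x|std_normal. p k x)"
      by (rule weak_conv_expectation_tendsto[OF _ _ weak contp(1)]) (use abs_stein_mollified_le[of z k, folded p_def] in auto)
    moreover have "?Ep' \<longlonglongrightarrow> (LINT x|std_normal. p' k x)"
      by (rule weak_conv_expectation_tendsto[OF _ _ weak contp(2)])
        (use abs_stein_mollified_derivative_le[of z k, folded p'_def] in auto)
    moreover have "(LINT x|std_normal. p' k x) = b k"
      unfolding b_def p_def p'_def
      by (rule std_normal_expectation_derivative[OF DERIV_stein_mollified continuous_stein_mollified_derivative abs_stein_mollified_le abs_stein_mollified_derivative_le])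
    ultimately have "(\<lambda>n. - ((2 * s n 2 - 1) / e n) * ?Ep n - 1 / 2 * (8 * s n 3 / e n) * ?Ep' n)
       \<longlonglongrightarrow> - 0 * (LINT x|std_normal. p k x) - 1 / 2 * \<alpha> * b k"
      by (intro tendsto_intros var skew) simp_all
    moreover have "- ((2 * s n 2 - 1) / e n) * ?Ep n - 1 / 2 * (8 * s n 3 / e n) * ?Ep' n = ?m n / e n" for n
      by (cases "e n = 0") (simp_all add: field_simps)
    ultimately have m: "(\<lambda>n. ?m n / e n) \<longlonglongrightarrow> - (\<alpha> / 2 * b k)" by simp
    have V: "?V \<longlonglongrightarrow> a k" unfolding a_def
    proof (rule weak_conv_expectation_tendsto[OF _ _ weak])
      show "isCont (\<lambda>x. (stein_derivative z x - p k x)\<^sup>2) x" if "x \<noteq> z" for x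
        by (intro continuous_intros isCont_stein_derivative contp that)
      show "\<bar>(stein_derivative z x - p k x)\<^sup>2\<bar> \<le> 4\<^sup>2" for x
      proof -
        have "\<bar>stein_derivative z x - p k x\<bar> \<le> 4"
          using abs_stein_derivative_le_1[of z x] abs_stein_mollified_le[of z k x] unfolding p_def by linarith
        from power_mono[OF this abs_ge_zero, of 2] show ?thesis by simp
      qed
    qed auto
    have "(\<lambda>n. sqrt (?V n) + 2 * sqrt (e n) * ?K + \<bar>?m n / e n + \<alpha> / 2 * b k\<bar>)
      \<longlonglongrightarrow> sqrt (a k) + 2 * sqrt 0 * ?K + \<bar>- (\<alpha> / 2 * b k) + \<alpha> / 2 * b k\<bar>"
      by (intro tendsto_intros V e0 m)
    then have "\<forall>\<^sub>F n in sequentially. sqrt (?V n) + 2 * sqrt (e n) * ?K + \<bar>?m n / e n + \<alpha> / 2 * b k\<bar> < sqrt (a k) + \<epsilon>"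
      by (rule order_tendstoD) (use that in simp)
    then show ?thesis
    proof eventually_elim
      case (elim n)
      then show ?case using bound[of n] by linarith
    qed
  qed
  have "?D \<longlonglongrightarrow> - (\<alpha> / 2 * b0)"
  proof (rule tendstoI)
    fix \<epsilon> :: real assume "0 < \<epsilon>"
    have "(\<lambda>k. sqrt (a k) + \<bar>\<alpha> / 2 * b0 - \<alpha> / 2 * b k\<bar>) \<longlonglongrightarrow> sqrt 0 + \<bar>\<alpha> / 2 * b0 - \<alpha> / 2 * b0\<bar>"
      by (intro tendsto_intros a b)
    then have "\<forall>\<^sub>F k in sequentially. sqrt (a k) + \<bar>\<alpha> / 2 * b0 - \<alpha> / 2 * b k\<bar> < \<epsilon> / 2"
      by (rule order_tendstoD) (use \<open>0 < \<epsilon>\<close> in simp)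
    then obtain k where k: "sqrt (a k) + \<bar>\<alpha> / 2 * b0 - \<alpha> / 2 * b k\<bar> < \<epsilon> / 2"
      by (auto simp: eventually_sequentially)
    from key[of "\<epsilon> / 2" k] \<open>0 < \<epsilon>\<close>
    have "\<forall>\<^sub>F n in sequentially. \<bar>?D n + \<alpha> / 2 * b k\<bar> < sqrt (a k) + \<epsilon> / 2" by simp
    then show "\<forall>\<^sub>F n in sequentially. dist (?D n) (- (\<alpha> / 2 * b0)) < \<epsilon>"
    proof eventually_elim
      case (elim n)
      then show ?case using k unfolding dist_real_def by linarith
    qed
  qed
  moreover have "- (\<alpha> / 2 * b0) = \<alpha> / 6 * (1 - z\<^sup>2) * std_normal_density z"
    unfolding b0_def expectation_mult_stein_derivative by (simp add: field_simps)
  ultimately show ?thesis by (simp only:)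
qed

text \<open>Convergence of the characteristic function at one point t suffices, without convergence
  of moments: its modulus tends to the Gaussian value, while \<open>norm_law_char_ge\<close> keeps
  it above that value by a factor exp(2/5 t^4 s_4). The factor 5 / (2 t^4) inverts this exponent
  after exp x \<ge> 1 + x.\<close>

lemma second_chaos_weak_conv_imp_fourth_trace_tendsto_0:
  fixes F :: "nat \<Rightarrow> 'a \<Rightarrow> real"
  assumes F: "\<And>n. second_chaos_variable M (F n) (s n)"
    and weak: "weak_conv_m (\<lambda>n. distr M borel (F n)) std_normal"
    and var: "(\<lambda>n. 2 * s n 2) \<longlonglongrightarrow> 1"
  shows "(\<lambda>n. s n 4) \<longlonglongrightarrow> 0"
proof -
  interpret F: second_chaos_variable M "F n" "s n" for n by (rule F)
  \<comment> \<open>For t = 1/4 the requirement \<open>4 * t * sqrt (s n 2) \<le> 1\<close> holds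
    once s_2 < 1, which is eventually true as s_2 tends to 1/2.\<close>
  define t :: real where "t = 1 / 4"
  let ?c = "\<lambda>n. norm (law_char M (F n) t)"
  have c: "?c \<longlonglongrightarrow> exp (- t\<^sup>2 / 2)"
    using tendsto_norm[OF levy_continuity1[OF _ real_dist_normal_dist weak, of t]]
    by (simp add: char_std_normal_distribution real_distribution_distr)
  have s2: "(\<lambda>n. s n 2) \<longlonglongrightarrow> 1 / 2"
    using tendsto_divide[OF var tendsto_const[of 2]] by simp
  have "(\<lambda>n. ?c n * exp (t\<^sup>2 * s n 2)) \<longlonglongrightarrow> exp (- t\<^sup>2 / 2) * exp (t\<^sup>2 * (1 / 2))"
    by (intro tendsto_intros c s2)
  then have "(\<lambda>n. ?c n * exp (t\<^sup>2 * s n 2)) \<longlonglongrightarrow> 1" by (simp flip: exp_add)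
  from tendsto_mult_left[OF tendsto_diff[OF this tendsto_const[of 1]], of "5 / (2 * t ^ 4)"]
  have upper: "(\<lambda>n. 5 / (2 * t ^ 4) * (?c n * exp (t\<^sup>2 * s n 2) - 1)) \<longlonglongrightarrow> 0" by simp
  have ev: "\<forall>\<^sub>F n in sequentially. s n 2 < 1" using s2 by (rule order_tendstoD) simp
  have "\<forall>\<^sub>F n in sequentially. s n 4 \<le> 5 / (2 * t ^ 4) * (?c n * exp (t\<^sup>2 * s n 2) - 1)"
    using ev
  proof eventually_elim
    case (elim n)
    then have "4 * t * sqrt (s n 2) \<le> 1" by (simp add: t_def)
    then have "exp (2 / 5 * t ^ 4 * s n 4 - t\<^sup>2 * s n 2) \<le> ?c n"
      by (intro F.norm_law_char_ge) (simp_all add: t_def)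
    then have "exp (2 / 5 * t ^ 4 * s n 4 - t\<^sup>2 * s n 2) * exp (t\<^sup>2 * s n 2) \<le> ?c n * exp (t\<^sup>2 * s n 2)"
      by (intro mult_right_mono) auto
    then have "exp (2 / 5 * t ^ 4 * s n 4) \<le> ?c n * exp (t\<^sup>2 * s n 2)" by (simp flip: exp_add)
    then have "2 / 5 * t ^ 4 * s n 4 \<le> ?c n * exp (t\<^sup>2 * s n 2) - 1"
      using exp_ge_add_one_self[of "2 / 5 * t ^ 4 * s n 4"] by linarith
    then show ?case by (simp add: t_def field_simps)
  qed
  then show ?thesis
    by (intro tendsto_sandwich[OF _ _ tendsto_const upper]) (auto intro: F.trace4_nonneg always_eventually)
qed

text \<open>The Kolmogorov bound gives convergence of the distribution functions at every
  point.\<close>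

lemma second_chaos_weak_conv:
  fixes F :: "nat \<Rightarrow> 'a \<Rightarrow> real"
  assumes F: "\<And>n. second_chaos_variable M (F n) (s n)"
    and e0: "(\<lambda>n. second_chaos_variable.discrepancy (s n)) \<longlonglongrightarrow> 0"
  shows "weak_conv_m (\<lambda>n. distr M borel (F n)) std_normal"
  unfolding weak_conv_m_def weak_conv_def
proof (intro allI impI)
  interpret F: second_chaos_variable M "F n" "s n" for n by (rule F)
  fix z
  have "cdf (distr M borel (F n)) z = prob {\<omega> \<in> space M. F n \<omega> \<le> z}" for n
    unfolding cdf_def by (subst measure_distr) (auto simp: vimage_def Int_def conj_commute)
  then have "norm (cdf (distr M borel (F n)) z - std_normal_cdf z) \<le> F.discrepancy n" for n
    using F.abs_cdf_diff_le[of n z] by simp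
  from Lim_null_comparison[OF always_eventually[OF allI[OF this]] e0]
  show "(\<lambda>n. cdf (distr M borel (F n)) z) \<longlonglongrightarrow> std_normal_cdf z" by (simp add: LIM_zero_iff)
qed

end

theorem proposition3p8:
  fixes M :: "'a measure"
    and X :: "'h::{real_inner, polish_space} \<Rightarrow> 'a \<Rightarrow> real"
    and T :: "'h \<Rightarrow> 'h \<Rightarrow> 't::{real_inner, complete_space}"
    and f :: "nat \<Rightarrow> 't"
    and F :: "nat \<Rightarrow> 'a \<Rightarrow> real"
    and \<kappa> :: "nat \<Rightarrow> nat \<Rightarrow> real"
    and \<Phi> :: "real \<Rightarrow> real"
  assumes "isonormal_gaussian_process M X"
    and "hilbert_tensor_square T"
    and "\<And>n. n \<ge> 1 \<Longrightarrow> f n \<in> symmetric_tensors T"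
    and "\<And>n. n \<ge> 1 \<Longrightarrow> double_wiener_ito M X T (f n) (F n)"
    and "\<And>p n. p \<ge> 1 \<Longrightarrow> n \<ge> 1 \<Longrightarrow> \<kappa> p n = cumulant M (F n) p"
    and "\<And>z. \<Phi> z = cdf std_normal_distribution z"
    and "\<kappa> 2 \<longlonglongrightarrow> 1"
  shows "(weak_conv_m (\<lambda>n. distr M borel (F n)) std_normal_distribution \<longleftrightarrow> \<kappa> 4 \<longlonglongrightarrow> 0) \<and>
    (\<kappa> 4 \<longlonglongrightarrow> 0 \<longrightarrow>
      (\<forall>n\<ge>1. kolmogorov_dist (distr M borel (F n)) std_normal_distribution
                 \<le> sqrt (\<kappa> 4 n / 6 + (\<kappa> 2 n - 1)\<^sup>2)) \<and>
      (\<forall>\<alpha>::real.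
         (\<lambda>n. (\<kappa> 2 n - 1) / sqrt (\<kappa> 4 n / 6 + (\<kappa> 2 n - 1)\<^sup>2)) \<longlonglongrightarrow> 0 \<longrightarrow>
         (\<lambda>n. \<kappa> 3 n / sqrt (\<kappa> 4 n / 6 + (\<kappa> 2 n - 1)\<^sup>2)) \<longlonglongrightarrow> \<alpha> \<longrightarrow>
         (\<lambda>n. \<kappa> 8 n / (\<kappa> 4 n / 6 + (\<kappa> 2 n - 1)\<^sup>2)\<^sup>2) \<longlonglongrightarrow> 0 \<longrightarrow>
         (\<forall>z. (\<lambda>n. (\<P>(\<omega> in M. F n \<omega> \<le> z) - \<Phi> z) / sqrt (\<kappa> 4 n / 6 + (\<kappa> 2 n - 1)\<^sup>2))
                \<longlonglongrightarrow> \<alpha> / fact 3 * (1 / sqrt (2 * pi)) * (1 - z\<^sup>2) * exp (- z\<^sup>2 / 2)) \<and>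
         (\<alpha> \<noteq> 0 \<longrightarrow>
           (\<exists>c n0. 0 < c \<and> c < 1 \<and> 1 \<le> n0 \<and>
             (\<forall>n\<ge>n0. c * sqrt (\<kappa> 4 n / 6 + (\<kappa> 2 n - 1)\<^sup>2)
                        \<le> (SUP z. \<bar>\<P>(\<omega> in M. F n \<omega> \<le> z) - \<Phi> z\<bar>))))))"
proof -
  interpret isonormal_gaussian_process M X by fact
  have "\<exists>s. second_chaos_variable M (F (Suc n)) s" for n
    using double_wiener_ito_second_chaos_variable[OF assms(4)[of "Suc n"]] by auto
  \<comment> \<open>Everything is shifted to \<open>Suc n\<close>, because F 0 and the values
    \<kappa> p 0 are arbitrary; limits are unaffected.\<close>
  then obtain s where s: "\<And>n. second_chaos_variable M (F (Suc n)) (s n)" by metis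
  interpret C: second_chaos_variable M "F (Suc n)" "s n" for n by (rule s)
  define e where "e n = sqrt (\<kappa> 4 n / 6 + (\<kappa> 2 n - 1)\<^sup>2)" for n
  have \<kappa>: "\<kappa> 2 (Suc n) = 2 * s n 2" "\<kappa> 3 (Suc n) = 8 * s n 3" "\<kappa> 4 (Suc n) = 48 * s n 4" for n
    using assms(5) by (simp_all add: C.cumulants)
  have e: "e (Suc n) = C.discrepancy n" for n by (simp add: e_def \<kappa> C.discrepancy_def)
  have Suc: "X \<longlonglongrightarrow> l \<longleftrightarrow> (\<lambda>n. X (Suc n)) \<longlonglongrightarrow> l" for X :: "nat \<Rightarrow> real" and l
    by (simp add: filterlim_sequentially_Suc)
  have weak_Suc: "weak_conv_m (\<lambda>n. distr M borel (F n)) std_normal \<longleftrightarrow> weak_conv_m (\<lambda>n. distr M borel (F (Suc n))) std_normal"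
    unfolding weak_conv_m_def weak_conv_def by (subst (1) Suc) simp
  have var: "(\<lambda>n. 2 * s n 2) \<longlonglongrightarrow> 1" using assms(7) by (subst (asm) Suc) (simp add: \<kappa>)
  have \<kappa>4: "\<kappa> 4 \<longlonglongrightarrow> 0 \<longleftrightarrow> (\<lambda>n. s n 4) \<longlonglongrightarrow> 0"
    unfolding Suc[of "\<kappa> 4"] \<kappa> using tendsto_mult_left_iff[of 48 "\<lambda>n. s n 4" 0 sequentially] by simp
  have e0: "(\<lambda>n. C.discrepancy n) \<longlonglongrightarrow> 0" if "\<kappa> 4 \<longlonglongrightarrow> 0"
  proof -
    have "(\<lambda>n. C.discrepancy n) \<longlonglongrightarrow> sqrt (8 * 0 + (1 - 1)\<^sup>2)"
      unfolding C.discrepancy_def using that \<kappa>4 by (intro tendsto_intros var) auto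
    then show ?thesis by simp
  qed
  have prob_le: "\<bar>prob {\<omega> \<in> space M. F (Suc n) \<omega> \<le> z} - \<Phi> z\<bar> \<le> e (Suc n)" for n z
    using C.abs_cdf_diff_le[of n z] by (simp add: e assms(6))
  have weak: "weak_conv_m (\<lambda>n. distr M borel (F n)) std_normal" if "\<kappa> 4 \<longlonglongrightarrow> 0"
    unfolding weak_Suc by (rule second_chaos_weak_conv[OF s e0[OF that]])
  have "weak_conv_m (\<lambda>n. distr M borel (F n)) std_normal \<longleftrightarrow> \<kappa> 4 \<longlonglongrightarrow> 0"
    using weak second_chaos_weak_conv_imp_fourth_trace_tendsto_0[OF s _ var] unfolding \<kappa>4 weak_Suc by blast
  moreover have "kolmogorov_dist (distr M borel (F n)) std_normal \<le> e n" if "n \<ge> 1" for n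
  proof -
    obtain m where n: "n = Suc m" using \<open>n \<ge> 1\<close> by (cases n) auto
    have "cdf (distr M borel (F n)) z = prob {\<omega> \<in> space M. F n \<omega> \<le> z}" for z
      unfolding cdf_def n by (subst measure_distr) (auto simp: vimage_def Int_def conj_commute)
    then show ?thesis unfolding kolmogorov_dist_def using prob_le[of m]
      by (intro cSUP_least) (auto simp: n assms(6))
  qed
  moreover have "(\<lambda>n. (prob {\<omega> \<in> space M. F n \<omega> \<le> z} - \<Phi> z) / e n)
        \<longlonglongrightarrow> \<alpha> / fact 3 * (1 / sqrt (2 * pi)) * (1 - z\<^sup>2) * exp (- z\<^sup>2 / 2)"
    if "\<kappa> 4 \<longlonglongrightarrow> 0" "(\<lambda>n. (\<kappa> 2 n - 1) / e n) \<longlonglongrightarrow> 0" "(\<lambda>n. \<kappa> 3 n / e n) \<longlonglongrightarrow> \<alpha>" for \<alpha> z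
  proof -
    have "(\<lambda>n. (2 * s n 2 - 1) / C.discrepancy n) \<longlonglongrightarrow> 0" using that(2) by (subst (asm) Suc) (simp add: \<kappa> e)
    moreover have "(\<lambda>n. 8 * s n 3 / C.discrepancy n) \<longlonglongrightarrow> \<alpha>" using that(3) by (subst (asm) Suc) (simp add: \<kappa> e)
    ultimately have "(\<lambda>n. (prob {\<omega> \<in> space M. F (Suc n) \<omega> \<le> z} - std_normal_cdf z) / C.discrepancy n)
        \<longlonglongrightarrow> \<alpha> / 6 * (1 - z\<^sup>2) * std_normal_density z"
      using weak[OF that(1)] unfolding weak_Suc by (intro second_chaos_exact_asymptotics[OF s] e0 that)
    then show ?thesis
      by (subst Suc) (simp add: e assms(6) std_normal_density_def fact_numeral mult_ac)
  qed
  moreover have "\<exists>c n0. 0 < c \<and> c < 1 \<and> 1 \<le> n0 \<and> (\<forall>n\<ge>n0. c * e n \<le> (SUP z. \<bar>prob {\<omega> \<in> space M. F n \<omega> \<le> z} - \<Phi> z\<bar>))"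
    if lim: "\<And>z. (\<lambda>n. (prob {\<omega> \<in> space M. F n \<omega> \<le> z} - \<Phi> z) / e n)
        \<longlonglongrightarrow> \<alpha> / fact 3 * (1 / sqrt (2 * pi)) * (1 - z\<^sup>2) * exp (- z\<^sup>2 / 2)" and "\<alpha> \<noteq> 0" for \<alpha>
  proof -
    \<comment> \<open>The modulus of the limit at z = 0, where 1 - z^2 does not vanish.\<close>
    define L where "L = \<bar>\<alpha> / fact 3 * (1 / sqrt (2 * pi))\<bar>"
    have L: "0 < L" using \<open>\<alpha> \<noteq> 0\<close> by (simp add: L_def)
    define c where "c = min (1 / 2) (L / 2)"
    have c: "0 < c" "c < 1" "c < L" using L by (auto simp: c_def)
    have "(\<lambda>n. \<bar>(prob {\<omega> \<in> space M. F n \<omega> \<le> 0} - \<Phi> 0) / e n\<bar>) \<longlonglongrightarrow> L"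
      using tendsto_rabs[OF lim[of 0]] by (simp add: L_def)
    then have "\<forall>\<^sub>F n in sequentially. c < \<bar>(prob {\<omega> \<in> space M. F n \<omega> \<le> 0} - \<Phi> 0) / e n\<bar>"
      using c(3) by (rule order_tendstoD)
    then obtain N where N: "\<And>n. n \<ge> N \<Longrightarrow> c < \<bar>(prob {\<omega> \<in> space M. F n \<omega> \<le> 0} - \<Phi> 0) / e n\<bar>"
      by (auto simp: eventually_sequentially)
    have "c * e n \<le> (SUP z. \<bar>prob {\<omega> \<in> space M. F n \<omega> \<le> z} - \<Phi> z\<bar>)" if "n \<ge> max 1 N" for n
    proof -
      obtain m where n: "n = Suc m" using \<open>n \<ge> max 1 N\<close> by (cases n) auto
      have "e n \<ge> 0" by (simp add: n e C.discrepancy_nonneg)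
      moreover have "c < \<bar>prob {\<omega> \<in> space M. F n \<omega> \<le> 0} - \<Phi> 0\<bar> / \<bar>e n\<bar>"
        using N[of n] that by simp
      ultimately have "c * e n \<le> \<bar>prob {\<omega> \<in> space M. F n \<omega> \<le> 0} - \<Phi> 0\<bar>"
        by (cases "e n = 0") (simp_all add: less_divide_eq)
      \<comment> \<open>The Kolmogorov bound makes the set bounded, so that the supremum is an upper
        bound of it.\<close>
      also have "\<dots> \<le> (SUP z. \<bar>prob {\<omega> \<in> space M. F n \<omega> \<le> z} - \<Phi> z\<bar>)"
        using prob_le[of m] by (intro cSUP_upper bdd_aboveI2[of _ _ "e n"]) (auto simp: n)
      finally show ?thesis .
    qed
    then show ?thesis using c by (intro exI[of _ c] exI[of _ "max 1 N"]) auto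
  qed
  ultimately show ?thesis unfolding e_def by blast
qed

end
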